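(* Let $G$ be a finitely generated group equipped with the word-length function $|\cdot|$ associated with a symmetric finite generating subset. Let $V$ be the associated volume function and assume that $G$ has polynomial volume growth. Let $\phi:[0,\infty)\to[1,\infty)$ be a continuous regularly varying function of positive index. Let $r$ be the inverse function of $$t\mapsto t^2\Big/\int_0^t\frac{s\,ds}{\phi(s)}.$$ Let $\nu_\phi$ be a symmetric probability measure on $G$ such that $$\nu_\phi(g)\simeq\frac{1}{\phi(|g|)V(|g|)}.$$ Then $\nu_\phi$ is strongly $(|\cdot|,r)$-controlled.
   Context: Notation: $f\simeq g$ means that there are constants $0<c\le C<\infty$ with $cg\le f\le Cg$ on the relevant domain. A probability measure $\mu$ on $G$ is symmetric if $\mu(g)=\mu(g^{-1})$. The word length $|g|$ with respect to a finite symmetric generating set $\mathcal S$ is the least $k$ with $g=u_1\cdots u_k$, $u_i\in\mathcal S$ ($|e|=0$); $V(t)=\#\{g\in G:|g|\le t\}$; $G$ has polynomial volume growth (of degree $D$) if $V(t)\simeq t^D$ for $t\ge1$. For a probability measure $\mu$ on $G$, $\mu^{(n)}$ is the $n$-fold convolution power, and the random walk $(X_n)_{n\ge0}$ driven by $\mu$ is $X_n=X_0\xi_1\cdots\xi_n$ with $(\xi_i)$ i.i.d. of law $\mu$; $\mathbf P_x$ is its law when $X_0=x$. A norm on $G$ is a function $\|\cdot\|:G\to[0,\infty)$ with $\|g\|=0$ iff $g=e$ and $\|gh\|\le\|g\|+\|h\|$; its volume function is $V(t)=\#\{g:\|g\|\le t\}$. The word length is a norm. Strong control: let $r:(0,\infty)\to(0,\infty)$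 be an increasing continuous function with inverse $\rho$. A symmetric probability measure $\mu$ on $G$ is strongly $(\|\cdot\|,r)$-controlled if: (1) there exists $C\in(0,\infty)$ and, for any $\kappa>0$, there exists $c(\kappa)>0$ such that, for all $n\ge1$ and all $g$ with $\|g\|\le\kappa r(n)$, $c(\kappa)V(r(n))^{-1}\le\mu^{(2n)}(g)\le CV(r(n))^{-1}$; (2) there exist $\epsilon,\gamma_1,\gamma_2\in(0,\infty)$, $\gamma_2\ge1$, such that, for all $n,\tau$ with $\frac12\rho(\tau/\gamma_1)\le n\le\rho(\tau/\gamma_1)$, $\inf_{x:\|x\|\le\tau}\mathbf P_x\big(\sup_{0\le k\le n}\|X_k\|\le\gamma_2\tau;\ \|X_n\|\le\tau\big)\ge\epsilon$.
   Formalization: Since the given function tends to 2φ(0) > 0 at 0 and need not be monotone for small t, it has no inverse on all of (0,∞); r is taken to be any increasing continuous bijection of (0,∞) that inverts it for all large t. *)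

theory Defs
  imports "HOL-Probability.Probability" "HOL-Algebra.Generated_Groups"
begin

section \<open>Comparison of functions and regular variation\<close>

definition simeq_on :: "'b set \<Rightarrow> ('b \<Rightarrow> real) \<Rightarrow> ('b \<Rightarrow> real) \<Rightarrow> bool" where
  "simeq_on A f g \<longleftrightarrow>
     (\<exists>c C. 0 < c \<and> c \<le> C \<and> (\<forall>x\<in>A. c * g x \<le> f x \<and> f x \<le> C * g x))"

text \<open>Regular variation at infinity in the sense of Karamata: \<open>f\<close> is measurable and positive
  on some half-line, and \<open>f (l * t) / f t\<close> tends to \<open>l\<close> to the power \<open>\<alpha>\<close>, for each \<open>l > 0\<close>.\<close>

definition regularly_varying :: "(real \<Rightarrow> real) \<Rightarrow> real \<Rightarrow> bool" where
  "regularly_varying f \<alpha> \<longleftrightarrow>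
     (\<exists>a. f \<in> borel_measurable (restrict_space borel {a..}) \<and> (\<forall>t\<ge>a. 0 < f t)) \<and>
     (\<forall>l>0. ((\<lambda>t. f (l * t) / f t) \<longlongrightarrow> l powr \<alpha>) at_top)"


section \<open>Norms, word length and volume on a group\<close>

definition symmetric_generating_set :: "('a, 'b) monoid_scheme \<Rightarrow> 'a set \<Rightarrow> bool" where
  "symmetric_generating_set G S \<longleftrightarrow>
     S \<subseteq> carrier G \<and> (\<forall>s\<in>S. inv\<^bsub>G\<^esub> s \<in> S) \<and> generate G S = carrier G"

definition word_length :: "('a, 'b) monoid_scheme \<Rightarrow> 'a set \<Rightarrow> 'a \<Rightarrow> real" where
  "word_length G S g =
     real (LEAST k. \<exists>us. length us = k \<and> set us \<subseteq> S \<and> foldr (mult G) us \<one>\<^bsub>G\<^esub> = g)"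

definition group_norm :: "('a, 'b) monoid_scheme \<Rightarrow> ('a \<Rightarrow> real) \<Rightarrow> bool" where
  "group_norm G N \<longleftrightarrow>
     (\<forall>g\<in>carrier G. 0 \<le> N g \<and> (N g = 0 \<longleftrightarrow> g = \<one>\<^bsub>G\<^esub>)) \<and>
     (\<forall>g\<in>carrier G. \<forall>h\<in>carrier G. N (g \<otimes>\<^bsub>G\<^esub> h) \<le> N g + N h)"

definition volume_fun :: "('a, 'b) monoid_scheme \<Rightarrow> ('a \<Rightarrow> real) \<Rightarrow> real \<Rightarrow> real" where
  "volume_fun G N t = real (card {g \<in> carrier G. N g \<le> t})"

definition polynomial_growth :: "('a, 'b) monoid_scheme \<Rightarrow> 'a set \<Rightarrow> bool" where
  "polynomial_growth G S \<longleftrightarrow>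
     (\<exists>D. simeq_on {1..} (volume_fun G (word_length G S)) (\<lambda>t. t powr D))"


section \<open>Random walks\<close>

text \<open>A finitely generated group is countable, so its probability measures are exactly the
  probability mass functions supported on the carrier.\<close>

definition symmetric_prob :: "('a, 'b) monoid_scheme \<Rightarrow> 'a pmf \<Rightarrow> bool" where
  "symmetric_prob G \<mu> \<longleftrightarrow>
     set_pmf \<mu> \<subseteq> carrier G \<and> (\<forall>g\<in>carrier G. pmf \<mu> g = pmf \<mu> (inv\<^bsub>G\<^esub> g))"

primrec conv_power :: "('a, 'b) monoid_scheme \<Rightarrow> 'a pmf \<Rightarrow> nat \<Rightarrow> 'a pmf" where
  "conv_power G \<mu> 0 = return_pmf \<one>\<^bsub>G\<^esub>"
| "conv_power G \<mu> (Suc n) = map_pmf (\<lambda>(x, y). x \<otimes>\<^bsub>G\<^esub> y) (pair_pmf (conv_power G \<mu> n) \<mu>)"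

text \<open>The canonical space of the i.i.d. increments.  Each factor is restricted to the (countable)
  carrier so that events depending on finitely many increments are measurable even if the
  ambient type is uncountable.  The increment \<open>\<xi>\<close> of index \<open>k + 1\<close> is \<open>\<omega> k\<close>.\<close>

definition increments :: "('a, 'b) monoid_scheme \<Rightarrow> 'a pmf \<Rightarrow> (nat \<Rightarrow> 'a) measure" where
  "increments G \<mu> = (\<Pi>\<^sub>M i\<in>UNIV. restrict_space (measure_pmf \<mu>) (carrier G))"

primrec walk :: "('a, 'b) monoid_scheme \<Rightarrow> 'a \<Rightarrow> (nat \<Rightarrow> 'a) \<Rightarrow> nat \<Rightarrow> 'a" where
  "walk G x \<omega> 0 = x"
| "walk G x \<omega> (Suc k) = walk G x \<omega> k \<otimes>\<^bsub>G\<^esub> \<omega> k"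

definition walk_prob ::
  "('a, 'b) monoid_scheme \<Rightarrow> 'a pmf \<Rightarrow> 'a \<Rightarrow> ((nat \<Rightarrow> 'a) \<Rightarrow> bool) \<Rightarrow> real" where
  "walk_prob G \<mu> x E =
     measure (increments G \<mu>) {\<omega> \<in> space (increments G \<mu>). E (walk G x \<omega>)}"


section \<open>Strong control\<close>

definition increasing_bijection :: "(real \<Rightarrow> real) \<Rightarrow> bool" where
  "increasing_bijection r \<longleftrightarrow>
     strict_mono_on {0<..} r \<and> continuous_on {0<..} r \<and> bij_betw r {0<..} {0<..}"

definition strongly_controlled ::
  "('a, 'b) monoid_scheme \<Rightarrow> ('a \<Rightarrow> real) \<Rightarrow> (real \<Rightarrow> real) \<Rightarrow> 'a pmf \<Rightarrow> bool" where
  "strongly_controlled G N r \<mu> \<longleftrightarrow>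
     group_norm G N \<and> increasing_bijection r \<and> symmetric_prob G \<mu> \<and>
     (\<exists>C>0. \<forall>\<kappa>>0. \<exists>c>0. \<forall>n\<ge>1. \<forall>g\<in>carrier G. N g \<le> \<kappa> * r (real n) \<longrightarrow>
        c * inverse (volume_fun G N (r (real n))) \<le> pmf (conv_power G \<mu> (2 * n)) g \<and>
        pmf (conv_power G \<mu> (2 * n)) g \<le> C * inverse (volume_fun G N (r (real n)))) \<and>
     (let \<rho> = the_inv_into {0<..} r in
      \<exists>\<epsilon>>0. \<exists>\<gamma>\<^sub>1>0. \<exists>\<gamma>\<^sub>2\<ge>1. \<forall>n::nat. \<forall>\<tau>>0.
        1 / 2 * \<rho> (\<tau> / \<gamma>\<^sub>1) \<le> real n \<and> real n \<le> \<rho> (\<tau> / \<gamma>\<^sub>1) \<longrightarrow>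
        (INF x\<in>{x \<in> carrier G. N x \<le> \<tau>}.
           walk_prob G \<mu> x (\<lambda>X. (SUP k\<in>{0..n}. N (X k)) \<le> \<gamma>\<^sub>2 * \<tau> \<and> N (X n) \<le> \<tau>)) \<ge> \<epsilon>)"

text \<open>The function to be inverted is \<open>t\<^sup>2 / (\<integral>\<^sub>0\<^sup>t s / \<phi> s ds)\<close>.  For continuous \<open>\<phi> \<ge> 1\<close>
  it tends to \<open>2 * \<phi> 0 > 0\<close> at \<open>0\<close>, and it need not be monotone for small \<open>t\<close>, so it is never
  a bijection of the positive half-line; for regularly varying \<open>\<phi>\<close> of positive index it is
  strictly increasing to infinity for large \<open>t\<close>.  Hence ``\<open>r\<close> is its inverse'' is read as:
  \<open>r\<close> is an increasing bijection of the positive half-line which inverts it for all large \<open>t\<close>.\<close>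

definition scaling :: "(real \<Rightarrow> real) \<Rightarrow> real \<Rightarrow> real" where
  "scaling \<phi> t = t\<^sup>2 / integral {0..t} (\<lambda>s. s / \<phi> s)"

definition inverse_near_infinity :: "(real \<Rightarrow> real) \<Rightarrow> (real \<Rightarrow> real) \<Rightarrow> bool" where
  "inverse_near_infinity r f \<longleftrightarrow>
     increasing_bijection r \<and> (\<forall>\<^sub>F t in at_top. r (f t) = t)"

end

theory Submission
  imports Defs
begin

text \<open>
  Why the theorem is true.  Write \<open>V\<close> for the volume, \<open>\<mu>\<^sup>k\<close> for the law of the walk after
  \<open>k\<close> steps, and \<open>W t\<close> for the integral of \<open>s / \<phi> s\<close> over \<open>[0, t]\<close>, so that \<open>r\<close> is the
  inverse of \<open>t\<^sup>2 / W t\<close> near infinity.  Everything rests on comparing, in \<open>\<ell>\<^sup>2\<close>, a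
  function with its right translates.

  Upper bound.  For any subadditive symmetric \<open>N\<close>, such as \<open>N h = \<parallel>f - f(\<cdot> h)\<parallel>\<^sub>2\<close>,
  one has \<open>N(g)\<^sup>2 \<le> C (R\<^sup>2 / W R) E[N(\<xi>)\<^sup>2]\<close> for \<open>|g| \<le> R\<close>, where \<open>\<xi>\<close> is one
  step of the walk (\<open>pseudo_poincare\<close>).  For \<open>f = \<mu>\<^sup>n\<close> the two sides are
  \<open>2 (\<mu>\<^sup>2\<^sup>n(e) - \<mu>\<^sup>2\<^sup>n(g))\<close> and a multiple of the loss of return probability in one step.
  Averaged over a ball this is a Nash inequality; since the even return probabilities are
  convex in time, it gives \<open>\<mu>\<^sup>2\<^sup>n(e) \<le> C / V(r n)\<close> (\<open>ret_upper\<close>).  Not averaged, it bounds the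
  oscillation of \<open>\<mu>\<^sup>2\<^sup>n\<close> at distances below a small multiple of \<open>r n\<close>.

  Displacement.  Let \<open>f\<close> be the tent \<open>x \<mapsto> max 0 (L - |x|)\<close>.  The \<open>\<ell>\<^sup>2\<close> displacement
  \<open>E \<parallel>f - f(\<cdot> X\<^sub>n)\<parallel>\<^sup>2\<close> grows at most linearly in \<open>n\<close>; an element longer than \<open>2 L\<close>
  contributes \<open>2 \<parallel>f\<parallel>\<^sup>2\<close> to it, and one step contributes at most a multiple of
  \<open>\<parallel>f\<parallel>\<^sup>2 E[min 1 (|\<xi>|\<^sup>2 / L\<^sup>2)]\<close>.  Hence \<open>P(|X\<^sub>n| \<ge> 2 L) \<le> C n W(L) / L\<^sup>2\<close>
  (\<open>displacement_tail_scaling\<close>), for jumps of any size.  By Cauchy-Schwarz this bounds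
  \<open>\<mu>\<^sup>2\<^sup>n(e)\<close> from below, and with the oscillation bound it yields the lower bound on a ball of
  radius \<open>\<eta> r n\<close> for some \<open>\<eta> > 0\<close> (\<open>near_diagonal\<close>).

  Larger balls.  If \<open>\<alpha> > 1\<close>, halving the time divides \<open>r\<close> by a factor below two, so an element
  slightly out of reach in time \<open>n\<close> is a product of two elements within reach in time \<open>n / 2\<close>;
  iterating this covers any multiple of \<open>r n\<close> (\<open>lower_bound_chain\<close>).  If \<open>\<alpha> \<le> 1\<close>, then
  \<open>\<phi> t\<close> is at most a multiple of \<open>t\<^sup>2 / W t\<close>, so within time \<open>n\<close> a single jump to a prescribed
  ball of radius comparable to \<open>r n\<close> has probability bounded below (\<open>lower_bound_jump\<close>).

  Confinement.  The walk ends in the ball of radius \<open>\<tau>\<close> with probability bounded below, and by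
  Ottaviani's inequality leaves the ball of radius \<open>\<gamma>\<^sub>2 \<tau>\<close> with a probability that is small
  for large \<open>\<gamma>\<^sub>2\<close> (\<open>confinement\<close>).
\<close>

section \<open>Regular variation\<close>

text \<open>Additive form of the uniform convergence theorem of Karamata theory, weakened to uniform
  boundedness.  The closed sets of those \<open>u\<close> for which the increment stays within \<open>1\<close> of
  its limit from time \<open>n\<close> on exhaust the line, so by Baire one of them contains an interval; differences of two
  points of that interval cover a neighbourhood of \<open>0\<close>.\<close>

lemma log_increments_bounded_near_0:
  fixes h :: "real \<Rightarrow> real"
  assumes cont: "continuous_on UNIV h"
    and lim: "\<And>u. ((\<lambda>x. h (x + u) - h x) \<longlongrightarrow> \<alpha> * u) at_top"
  shows "\<exists>\<delta>>0. \<exists>x0. \<forall>x\<ge>x0. \<forall>u. \<bar>u\<bar> \<le> \<delta> \<longrightarrow> \<bar>h (x + u) - h x\<bar> \<le> 2 + \<bar>\<alpha>\<bar> * \<delta>"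
proof -
  define E where "E n = {u. \<forall>x\<ge>real n. \<bar>h (x + u) - h x - \<alpha> * u\<bar> \<le> 1}" for n :: nat
  have E_alt: "E n = (\<Inter>x\<in>{real n..}. {u. \<bar>h (x + u) - h x - \<alpha> * u\<bar> \<le> 1})" for n
    by (auto simp: E_def)
  have closed_E: "closed (E n)" for n
    unfolding E_alt
    by (intro closed_INT ballI closed_Collect_le continuous_intros
          continuous_on_compose2[OF cont]) auto
  have E_UNIV: "(\<Union>n. E n) = UNIV"
  proof (safe; simp)
    fix u
    have "eventually (\<lambda>x. dist (h (x + u) - h x) (\<alpha> * u) < 1) at_top"
      using lim[of u] by (rule tendstoD) simp
    then obtain x0 where "\<And>x. x \<ge> x0 \<Longrightarrow> dist (h (x + u) - h x) (\<alpha> * u) < 1"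
      by (auto simp: eventually_at_top_linorder)
    then have "u \<in> E (nat \<lceil>x0\<rceil>)"
      by (auto simp: E_def dist_real_def less_imp_le) (smt (verit) of_nat_ceiling)
    then show "\<exists>n. u \<in> E n" by blast
  qed
  have "\<exists>n. interior (E n) \<noteq> {}"
  proof (rule ccontr)
    assume "\<not> ?thesis"
    then have int: "interior (E n) = {}" for n by blast
    have "UNIV \<subseteq> closure (\<Inter>(range (\<lambda>n. - E n)))"
    proof (rule Baire)
      fix T assume "T \<in> range (\<lambda>n. - E n)"
      then show "openin (top_of_set UNIV) T \<and> UNIV \<subseteq> closure T"
        using closed_E int by (auto simp: closure_complement open_Compl)
    qed auto
    moreover have "\<Inter>(range (\<lambda>n. - E n)) = {}"
      using E_UNIV by auto
    ultimately show False by simp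
  qed
  then obtain n v where "v \<in> interior (E n)" by blast
  then obtain \<delta> where \<delta>: "\<delta> > 0" "cball v \<delta> \<subseteq> E n"
    by (meson mem_interior_cball)
  have "\<bar>h (x + u) - h x\<bar> \<le> 2 + \<bar>\<alpha>\<bar> * \<delta>" if x: "x \<ge> real n + v" and u: "\<bar>u\<bar> \<le> \<delta>" for x u
  proof -
    have "v + u \<in> E n" "v \<in> E n"
      using \<delta> u by (auto simp: dist_real_def subset_iff)
    then have "\<bar>h ((x - v) + (v + u)) - h (x - v) - \<alpha> * (v + u)\<bar> \<le> 1"
      "\<bar>h ((x - v) + v) - h (x - v) - \<alpha> * v\<bar> \<le> 1"
      using x unfolding E_def mem_Collect_eq by (metis le_diff_eq)+
    then have "\<bar>h (x + u) - h x\<bar> \<le> 2 + \<bar>\<alpha> * u\<bar>"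
      by (simp add: algebra_simps)
    also have "\<bar>\<alpha> * u\<bar> \<le> \<bar>\<alpha>\<bar> * \<delta>"
      using u by (simp add: abs_mult mult_left_mono)
    finally show ?thesis by simp
  qed
  with \<delta>(1) show ?thesis by blast
qed

lemma log_increments_bounded:
  fixes h :: "real \<Rightarrow> real"
  assumes cont: "continuous_on UNIV h"
    and lim: "\<And>u. ((\<lambda>x. h (x + u) - h x) \<longlongrightarrow> \<alpha> * u) at_top"
  shows "\<exists>K x0. \<forall>x\<ge>x0. \<forall>u. \<bar>u\<bar> \<le> L \<longrightarrow> \<bar>h (x + u) - h x\<bar> \<le> K"
proof -
  obtain \<delta> x0 where \<delta>: "\<delta> > 0"
    and b: "\<And>x u. x \<ge> x0 \<Longrightarrow> \<bar>u\<bar> \<le> \<delta> \<Longrightarrow> \<bar>h (x + u) - h x\<bar> \<le> 2 + \<bar>\<alpha>\<bar> * \<delta>"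
    using log_increments_bounded_near_0[OF assms] by blast
  have iter: "\<bar>h (x + real k * u) - h x\<bar> \<le> real k * (2 + \<bar>\<alpha>\<bar> * \<delta>)"
    if "\<bar>u\<bar> \<le> \<delta>" "x \<ge> x0 + real k * \<delta>" for x u and k :: nat
    using that(2)
  proof (induction k)
    case (Suc k)
    have 1: "\<bar>h (x + real k * u) - h x\<bar> \<le> real k * (2 + \<bar>\<alpha>\<bar> * \<delta>)"
      using Suc.prems \<delta> by (intro Suc.IH) (simp add: algebra_simps)
    have "- (real k * \<delta>) \<le> real k * u"
      using that(1) by (metis abs_le_D2 minus_le_iff mult_left_mono mult_minus_right of_nat_0_le_iff)
    then have "\<bar>h ((x + real k * u) + u) - h (x + real k * u)\<bar> \<le> 2 + \<bar>\<alpha>\<bar> * \<delta>"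
      using Suc.prems \<delta> by (intro b that(1)) (simp add: algebra_simps)
    with 1 show ?case by (simp add: algebra_simps)
  qed auto
  obtain k :: nat where k: "real k * \<delta> \<ge> \<bar>L\<bar> + \<delta>"
    using \<delta> by (metis ex_less_of_nat_mult less_imp_le)
  have k0: "k > 0" using k \<delta> by (cases k) auto
  have "\<bar>h (x + u) - h x\<bar> \<le> real k * (2 + \<bar>\<alpha>\<bar> * \<delta>)"
    if "x \<ge> x0 + real k * \<delta>" "\<bar>u\<bar> \<le> L" for x u
  proof -
    have "\<bar>u / real k\<bar> \<le> \<delta>"
      using k k0 \<delta> that(2) by (simp add: abs_divide field_simps)
    from iter[OF this that(1)] show ?thesis using k0 by simp
  qed
  then show ?thesis by blast
qed

locale gauge =
  fixes \<phi> :: "real \<Rightarrow> real" and \<alpha> :: real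
  assumes cont: "continuous_on {0..} \<phi>" and ge1: "\<And>t. 0 \<le> t \<Longrightarrow> 1 \<le> \<phi> t"
    and \<alpha>_pos: "0 < \<alpha>" and rv: "regularly_varying \<phi> \<alpha>"
begin

lemma \<phi>_pos: "0 \<le> t \<Longrightarrow> 0 < \<phi> t"
  using ge1[of t] by simp

lemma ratio_lim: "l > 0 \<Longrightarrow> ((\<lambda>t. \<phi> (l * t) / \<phi> t) \<longlongrightarrow> l powr \<alpha>) at_top"
  using rv by (auto simp: regularly_varying_def)

lemma \<phi>_bounded: "\<exists>B\<ge>1. \<forall>t. 0 \<le> t \<and> t \<le> T \<longrightarrow> \<phi> t \<le> B"
proof -
  have "compact (\<phi> ` {0..T})"
    by (intro compact_continuous_image continuous_on_subset[OF cont]) auto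
  then have "bdd_above (\<phi> ` {0..T})"
    by (intro bounded_imp_bdd_above compact_imp_bounded)
  then obtain B where "\<And>t. 0 \<le> t \<Longrightarrow> t \<le> T \<Longrightarrow> \<phi> t \<le> B"
    unfolding bdd_above_def by (metis atLeastAtMost_iff imageI)
  then show ?thesis by (intro exI[of _ "max 1 B"]) (auto simp: le_max_iff_disj)
qed

text \<open>Boundedness of the increments of \<open>ln \<phi> (exp x)\<close> near infinity is comparability of \<open>\<phi>\<close>
  over octaves there; on bounded intervals \<open>\<phi>\<close> lies between \<open>1\<close> and a constant.\<close>

lemma \<phi>_comparable:
  "\<exists>C\<ge>1. \<forall>s t. 0 \<le> s \<and> 0 \<le> t \<and> s \<le> 2 * t \<and> t \<le> 2 * s \<longrightarrow> \<phi> s \<le> C * \<phi> t"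
proof -
  define h where "h x = ln (\<phi> (exp x))" for x
  have conth: "continuous_on UNIV h"
  proof -
    have "continuous_on UNIV (\<lambda>x. \<phi> (exp x))"
      by (rule continuous_on_compose2[OF cont, of UNIV exp]) (auto intro: continuous_intros)
    then show ?thesis
      unfolding h_def using \<phi>_pos by (intro continuous_on_ln) (auto simp: order_less_imp_not_eq2)
  qed
  have limh: "((\<lambda>x. h (x + u) - h x) \<longlongrightarrow> \<alpha> * u) at_top" for u
  proof -
    have "((\<lambda>x. \<phi> (exp u * exp x) / \<phi> (exp x)) \<longlongrightarrow> exp u powr \<alpha>) at_top"
      by (rule filterlim_compose[OF ratio_lim exp_at_top]) simp
    then have "((\<lambda>x. ln (\<phi> (exp u * exp x) / \<phi> (exp x))) \<longlongrightarrow> ln (exp u powr \<alpha>)) at_top"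
      by (intro tendsto_ln) auto
    moreover have "ln (\<phi> (exp u * exp x) / \<phi> (exp x)) = h (x + u) - h x" for x
      using \<phi>_pos[of "exp x"] \<phi>_pos[of "exp u * exp x"]
      by (simp add: h_def ln_div exp_add mult.commute)
    ultimately show ?thesis by (simp add: ln_powr)
  qed
  obtain K x0 where K: "\<And>x u. x \<ge> x0 \<Longrightarrow> \<bar>u\<bar> \<le> ln 2 \<Longrightarrow> \<bar>h (x + u) - h x\<bar> \<le> K"
    using log_increments_bounded[OF conth limh, of "ln 2"] by blast
  define T where "T = exp x0"
  obtain B where B: "B \<ge> 1" "\<And>t. 0 \<le> t \<Longrightarrow> t \<le> 2 * T \<Longrightarrow> \<phi> t \<le> B"
    using \<phi>_bounded[of "2 * T"] by blast
  have T: "T > 0" by (simp add: T_def)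
  have "\<phi> s \<le> max B (exp K) * \<phi> t"
    if "0 \<le> s" "0 \<le> t" "s \<le> 2 * t" "t \<le> 2 * s" for s t
  proof (cases "t \<ge> T")
    case False
    then have "\<phi> s \<le> B" using that by (intro B(2)) auto
    also have "B \<le> max B (exp K) * 1" by simp
    also have "\<dots> \<le> max B (exp K) * \<phi> t"
      using ge1[OF that(2)] B(1) by (intro mult_left_mono) auto
    finally show ?thesis .
  next
    case True
    then have t: "t > 0" and s: "s > 0" using T that by auto
    have "\<bar>ln (s / t)\<bar> \<le> ln 2"
    proof -
      have "ln (s / t) \<le> ln 2" using s t that by (subst ln_le_cancel_iff) (auto simp: field_simps)
      moreover have "ln (t / s) \<le> ln 2" using s t that by (subst ln_le_cancel_iff) (auto simp: field_simps)
      ultimately show ?thesis using s t by (simp add: ln_div)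
    qed
    moreover have "ln t \<ge> x0" using True t by (simp add: T_def ln_ge_iff)
    ultimately have "\<bar>h (ln t + ln (s / t)) - h (ln t)\<bar> \<le> K" by (intro K)
    then have "h (ln s) - h (ln t) \<le> K" using s t by (simp add: ln_div)
    then have "ln (\<phi> s / \<phi> t) \<le> K"
      using s t \<phi>_pos[of s] \<phi>_pos[of t] by (simp add: h_def ln_div)
    then have "\<phi> s / \<phi> t \<le> exp K"
      using s t \<phi>_pos[of s] \<phi>_pos[of t] by (metis divide_pos_pos exp_le_cancel_iff exp_ln less_imp_le)
    then have "\<phi> s \<le> exp K * \<phi> t"
      using t \<phi>_pos[of t] by (simp add: field_simps)
    also have "\<dots> \<le> max B (exp K) * \<phi> t"
      using t \<phi>_pos[of t] by (intro mult_right_mono) auto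
    finally show ?thesis .
  qed
  then show ?thesis using B(1) by (intro exI[of _ "max B (exp K)"]) auto
qed

text \<open>Along powers of two \<open>\<phi>\<close> eventually grows at a geometric rate, so a sum of reciprocals is
  of the order of its first term.\<close>

lemma dyadic_reciprocal_sum:
  "\<exists>C>0. \<forall>i k. (\<Sum>j<k. 1 / \<phi> (2 ^ (i + j))) \<le> C / \<phi> (2 ^ i)"
proof -
  define q where "q = (1 + 2 powr \<alpha>) / 2"
  have q: "1 < q" "q < 2 powr \<alpha>" using \<alpha>_pos by (auto simp: q_def)
  have "\<forall>\<^sub>F t in at_top. \<phi> (2 * t) / \<phi> t > q"
    using ratio_lim[of 2] q(2) by (intro order_tendstoD(1)) auto
  then obtain t0 where t0: "\<And>t. t \<ge> t0 \<Longrightarrow> \<phi> (2 * t) / \<phi> t > q"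
    by (auto simp: eventually_at_top_linorder)
  obtain j0 :: nat where j0: "t0 < 2 ^ j0" using real_arch_pow[of 2 t0] by auto
  define a where "a j = \<phi> (2 ^ j)" for j :: nat
  have a_pos: "a j > 0" and a_ge1: "a j \<ge> 1" for j using \<phi>_pos ge1 by (auto simp: a_def)
  have grow: "a (Suc j) \<ge> q * a j" if "j \<ge> j0" for j
  proof -
    have "(2::real) ^ j0 \<le> 2 ^ j" using that by (intro power_increasing) auto
    then have "\<phi> (2 * 2 ^ j) / \<phi> (2 ^ j) > q" using j0 by (intro t0) linarith
    then show ?thesis using a_pos[of j] by (simp add: a_def field_simps)
  qed
  \<comment> \<open>The constant solving \<open>1 + D / q = D\<close> makes the geometric comparison inductive.\<close>
  define D where "D = q / (q - 1)"
  have D: "D > 0" "1 + D / q = D" using q by (auto simp: D_def field_simps)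
  have tail: "(\<Sum>j<k. 1 / a (i + j)) \<le> D / a i" if "i \<ge> j0" for i k
    using that
  proof (induction k arbitrary: i)
    case (Suc k)
    have "(\<Sum>j<Suc k. 1 / a (i + j)) = 1 / a i + (\<Sum>j<k. 1 / a (Suc i + j))"
      by (subst sum.lessThan_Suc_shift) simp
    also have "\<dots> \<le> 1 / a i + D / a (Suc i)"
      using Suc.prems by (intro add_left_mono Suc.IH) auto
    also have "D / a (Suc i) \<le> D / (q * a i)"
      using D(1) grow[OF Suc.prems] q a_pos[of i] by (intro divide_left_mono) (auto simp: mult_pos_pos a_pos)
    also have "1 / a i + D / (q * a i) = (1 + D / q) / a i"
      using q a_pos[of i] by (simp add: field_simps)
    finally show ?case using D(2) by simp
  qed (use D a_pos in \<open>auto intro: divide_nonneg_pos less_imp_le\<close>)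
  obtain B where B: "B \<ge> 1" "\<And>t. 0 \<le> t \<Longrightarrow> t \<le> 2 ^ j0 \<Longrightarrow> \<phi> t \<le> B"
    using \<phi>_bounded[of "2 ^ j0"] by blast
  define C where "C = B * (real j0 + D) + D"
  have "(\<Sum>j<k. 1 / a (i + j)) \<le> C / a i" for i k
  proof (cases "i \<ge> j0")
    case True
    have "D / a i \<le> C / a i"
      using a_pos[of i] B D by (intro divide_right_mono) (auto simp: C_def)
    then show ?thesis using tail[OF True, of k] by linarith
  next
    case False
    have "(\<Sum>j<k. 1 / a (i + j)) \<le> (\<Sum>j<(j0 - i) + k. 1 / a (i + j))"
      using a_pos by (intro sum_mono2) (auto intro: less_imp_le)
    also have "\<dots> = (\<Sum>j<j0 - i. 1 / a (i + j)) + (\<Sum>j<k. 1 / a (j0 + j))"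
    proof -
      have "(\<Sum>j<m + k. f j) = (\<Sum>j<m. f j) + (\<Sum>j<k. f (m + j))" for m and f :: "nat \<Rightarrow> real"
        by (induction k) simp_all
      from this[of "\<lambda>j. 1 / a (i + j)" "j0 - i"] show ?thesis
        using False by (simp add: add.assoc[symmetric])
    qed
    also have "(\<Sum>j<j0 - i. 1 / a (i + j)) \<le> (\<Sum>j<j0 - i. 1)"
      using a_ge1 by (intro sum_mono) (auto simp: divide_le_eq_1)
    also have "(\<Sum>j<j0 - i. 1) \<le> real j0" by simp
    also have "(\<Sum>j<k. 1 / a (j0 + j)) \<le> D / a j0" by (intro tail) simp
    also have "D / a j0 \<le> D" using D(1) a_ge1[of j0] by (simp add: divide_le_eq mult_le_cancel_left1)
    finally have *: "(\<Sum>j<k. 1 / a (i + j)) \<le> real j0 + D" by simp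
    have "a i \<le> B" using False unfolding a_def by (intro B(2) power_increasing) auto
    then have "(real j0 + D) * a i \<le> (real j0 + D) * B" using D by (intro mult_left_mono) auto
    also have "\<dots> \<le> C" using D by (simp add: C_def mult.commute)
    finally have "real j0 + D \<le> C / a i" using a_pos[of i] by (simp add: field_simps)
    with * show ?thesis by simp
  qed
  moreover have "C > 0" using B D unfolding C_def by (intro add_nonneg_pos) auto
  ultimately show ?thesis unfolding a_def by blast
qed

definition W :: "real \<Rightarrow> real" where
  "W t = integral {0..t} (\<lambda>s. s / \<phi> s)"

lemma scaling_W: "scaling \<phi> t = t\<^sup>2 / W t"
  by (simp add: scaling_def W_def)

lemma cont_integrand: "continuous_on {0..} (\<lambda>s. s / \<phi> s)"
  using \<phi>_pos by (intro continuous_intros cont) (auto simp: order_less_imp_not_eq2)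

lemma integrand_integrable: "0 \<le> a \<Longrightarrow> (\<lambda>s. s / \<phi> s) integrable_on {a..b}"
  by (intro integrable_continuous_real continuous_on_subset[OF cont_integrand]) auto

lemma W_deriv:
  assumes "0 < t" shows "(W has_real_derivative t / \<phi> t) (at t)"
proof -
  have "(W has_real_derivative t / \<phi> t) (at t within {0..t + 1})"
    unfolding W_def using assms
    by (intro integral_has_real_derivative continuous_on_subset[OF cont_integrand]) auto
  moreover have "at t within {0..t + 1} = at t"
    using assms by (intro at_within_interior) auto
  ultimately show ?thesis by simp
qed

lemma W_diff: "0 \<le> a \<Longrightarrow> a \<le> b \<Longrightarrow> W b - W a = integral {a..b} (\<lambda>s. s / \<phi> s)"
  unfolding W_def
  using Henstock_Kurzweil_Integration.integral_combine[of 0 a b "\<lambda>s. s / \<phi> s"] integrand_integrable[of 0 b] by simp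

lemma W_mono: "0 \<le> a \<Longrightarrow> a \<le> b \<Longrightarrow> W a \<le> W b"
proof -
  assume *: "0 \<le> a" "a \<le> b"
  have "0 \<le> integral {a..b} (\<lambda>s. s / \<phi> s)"
    using * \<phi>_pos by (intro integral_nonneg integrand_integrable) (auto intro: divide_nonneg_pos)
  then show ?thesis using W_diff[OF *] by simp
qed

lemma W_pos: assumes "0 < t" shows "0 < W t"
proof -
  obtain B where B: "B \<ge> 1" "\<And>s. 0 \<le> s \<Longrightarrow> s \<le> t \<Longrightarrow> \<phi> s \<le> B"
    using \<phi>_bounded[of t] by blast
  have "integral {t / 2..t} (\<lambda>s. (t / 2) / B) \<le> integral {t / 2..t} (\<lambda>s. s / \<phi> s)"
    using assms B \<phi>_pos by (intro integral_le integrand_integrable integrable_const_ivl frac_le) auto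
  then have "t / 2 * ((t / 2) / B) \<le> W t - W (t / 2)"
    using assms by (simp add: W_diff)
  moreover have "W (t / 2) \<ge> 0" using W_mono[of 0 "t / 2"] assms by (simp add: W_def)
  moreover have "t / 2 * ((t / 2) / B) > 0" using assms B by simp
  ultimately show ?thesis by linarith
qed

lemma scaling_pos: "0 < t \<Longrightarrow> 0 < scaling \<phi> t"
  by (simp add: scaling_W W_pos)


lemma W_dyadic_increment:
  "\<exists>C>0. \<forall>t>0. W (2 * t) - W t \<le> C * (t\<^sup>2 / \<phi> t) \<and> t\<^sup>2 / \<phi> t \<le> C * (W (2 * t) - W t)"
proof -
  obtain C where C: "C \<ge> 1"
    "\<And>s t. 0 \<le> s \<Longrightarrow> 0 \<le> t \<Longrightarrow> s \<le> 2 * t \<Longrightarrow> t \<le> 2 * s \<Longrightarrow> \<phi> s \<le> C * \<phi> t"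
    using \<phi>_comparable by blast
  have "W (2 * t) - W t \<le> (2 * C) * (t\<^sup>2 / \<phi> t) \<and> t\<^sup>2 / \<phi> t \<le> (2 * C) * (W (2 * t) - W t)"
    if t: "t > 0" for t
  proof -
    have p: "\<phi> t > 0" using t \<phi>_pos by simp
    have eq: "W (2 * t) - W t = integral {t..2 * t} (\<lambda>s. s / \<phi> s)"
      using t by (intro W_diff) auto
    have up: "s / \<phi> s \<le> 2 * t * C / \<phi> t" if "s \<in> {t..2 * t}" for s
    proof -
      have ps: "\<phi> s > 0" using t that \<phi>_pos by simp
      have "\<phi> t \<le> C * \<phi> s" using t that by (intro C(2)) auto
      then have "s * \<phi> t \<le> (2 * t) * (C * \<phi> s)"
        using t that p ps C(1) by (intro mult_mono) auto
      then show ?thesis using ps p by (simp add: field_simps)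
    qed
    have "integral {t..2 * t} (\<lambda>s. s / \<phi> s) \<le> integral {t..2 * t} (\<lambda>s. 2 * t * C / \<phi> t)"
      using t up by (intro integral_le integrand_integrable integrable_const_ivl) auto
    also have "\<dots> = (2 * C) * (t\<^sup>2 / \<phi> t)"
      using t by (simp add: power2_eq_square)
    finally have 1: "W (2 * t) - W t \<le> (2 * C) * (t\<^sup>2 / \<phi> t)" using eq by simp
    have lo: "t / (C * \<phi> t) \<le> s / \<phi> s" if "s \<in> {t..2 * t}" for s
    proof -
      have ps: "\<phi> s > 0" using t that \<phi>_pos by simp
      have "\<phi> s \<le> C * \<phi> t" using t that by (intro C(2)) auto
      then have "t * \<phi> s \<le> s * (C * \<phi> t)"
        using t that p ps C(1) by (intro mult_mono) auto
      then show ?thesis using ps p C(1) by (simp add: field_simps)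
    qed
    have "t\<^sup>2 / (C * \<phi> t) = integral {t..2 * t} (\<lambda>s. t / (C * \<phi> t))"
      using t by (simp add: power2_eq_square)
    also have "\<dots> \<le> integral {t..2 * t} (\<lambda>s. s / \<phi> s)"
      using t lo by (intro integral_le integrand_integrable integrable_const_ivl) auto
    finally have "t\<^sup>2 / (C * \<phi> t) \<le> W (2 * t) - W t" using eq by simp
    then have "t\<^sup>2 / \<phi> t \<le> C * (W (2 * t) - W t)"
      using C(1) p by (simp add: field_simps)
    also have "\<dots> \<le> (2 * C) * (W (2 * t) - W t)"
      using C(1) W_mono[of t "2 * t"] t by (intro mult_right_mono) auto
    finally show ?thesis using 1 by simp
  qed
  then show ?thesis using C(1) by (intro exI[of _ "2 * C"]) auto
qed

definition dyadic_sum :: "nat \<Rightarrow> real" where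
  "dyadic_sum J = (\<Sum>j\<le>J. 4 ^ j / \<phi> (2 ^ j))"

lemma W_le_dyadic_sum: "\<exists>C>0. \<forall>J. W (2 ^ Suc J) \<le> C * dyadic_sum J"
proof -
  obtain C where C: "C > 0" "\<And>t. t > 0 \<Longrightarrow> W (2 * t) - W t \<le> C * (t\<^sup>2 / \<phi> t)"
    using W_dyadic_increment by blast
  define K where "K = max C (W 2 * \<phi> 1)"
  have K: "K \<ge> C" "K \<ge> W 2 * \<phi> 1" "K > 0" using C by (auto simp: K_def)
  have "W (2 ^ Suc J) \<le> K * dyadic_sum J" for J
  proof (induction J)
    case 0
    then show ?case using K(2) \<phi>_pos[of 1] by (simp add: dyadic_sum_def field_simps)
  next
    case (Suc J)
    have p: "(4::real) ^ Suc J = (2 ^ Suc J)\<^sup>2"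
      by (simp add: power_mult_distrib[symmetric] power2_eq_square)
    have "W (2 ^ Suc (Suc J)) \<le> W (2 ^ Suc J) + C * (4 ^ Suc J / \<phi> (2 ^ Suc J))"
      using C(2)[of "2 ^ Suc J"] unfolding p by simp
    also have "C * (4 ^ Suc J / \<phi> (2 ^ Suc J)) \<le> K * (4 ^ Suc J / \<phi> (2 ^ Suc J))"
      using K(1) \<phi>_pos[of "2 ^ Suc J"] by (intro mult_right_mono) auto
    finally show ?case using Suc.IH by (simp add: dyadic_sum_def distrib_left)
  qed
  then show ?thesis using K by blast
qed

lemma dyadic_sum_le_W: "\<exists>C>0. \<forall>J. dyadic_sum J \<le> C * W (2 ^ J)"
proof -
  obtain C where C: "C > 0" "\<And>t. t > 0 \<Longrightarrow> t\<^sup>2 / \<phi> t \<le> C * (W (2 * t) - W t)"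
    using W_dyadic_increment by blast
  obtain B where B: "B \<ge> 1"
    "\<And>s t. 0 \<le> s \<Longrightarrow> 0 \<le> t \<Longrightarrow> s \<le> 2 * t \<Longrightarrow> t \<le> 2 * s \<Longrightarrow> \<phi> s \<le> B * \<phi> t"
    using \<phi>_comparable by blast
  define K where "K = max (4 * B * C) (1 / (\<phi> 1 * W 1))"
  have K: "K \<ge> 4 * B * C" "K \<ge> 1 / (\<phi> 1 * W 1)" "K > 0"
    using C B by (auto simp: K_def less_max_iff_disj)
  have "dyadic_sum J \<le> K * W (2 ^ J)" for J
  proof (induction J)
    case 0
    then show ?case using K(2) \<phi>_pos[of 1] W_pos[of 1] by (simp add: dyadic_sum_def field_simps)
  next
    case (Suc J)
    have p: "(4::real) ^ J = (2 ^ J)\<^sup>2"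
      by (simp add: power_mult_distrib[symmetric] power2_eq_square)
    have "\<phi> (2 ^ J) \<le> B * \<phi> (2 ^ Suc J)" by (intro B(2)) auto
    then have "4 ^ Suc J / \<phi> (2 ^ Suc J) \<le> 4 * B * (4 ^ J / \<phi> (2 ^ J))"
      using \<phi>_pos[of "2 ^ J"] \<phi>_pos[of "2 ^ Suc J"] by (simp add: field_simps)
    also have "\<dots> \<le> 4 * B * (C * (W (2 ^ Suc J) - W (2 ^ J)))"
      using C(2)[of "2 ^ J"] B unfolding p by (intro mult_left_mono) auto
    also have "\<dots> \<le> K * (W (2 ^ Suc J) - W (2 ^ J))"
      using mult_right_mono[OF K(1), of "W (2 ^ Suc J) - W (2 ^ J)"] W_mono[of "2 ^ J" "2 ^ Suc J"]
      by (simp add: mult.assoc)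
    finally show ?case using Suc.IH by (simp add: dyadic_sum_def algebra_simps)
  qed
  then show ?thesis using K by blast
qed

text \<open>Karamata's theorem would give the exact index of \<open>W\<close>; an upper bound for it is enough.
  It holds because \<open>W (\<lambda> t) - q\<^sub>1 W t\<close> has nonpositive derivative for large \<open>t\<close>.  The resulting
  additive constant is absorbed when \<open>W\<close> is unbounded, and a bounded \<open>W\<close> converges.\<close>

lemma W_growth:
  assumes l: "1 < l" and q: "1 < q" "l powr (2 - \<alpha>) < q"
  shows "\<exists>T>0. \<forall>t\<ge>T. W (l * t) \<le> q * W t"
proof (cases "bdd_above (W ` {0..})")
  case True
  define M where "M = Sup (W ` {0..})"
  have le: "W t \<le> M" if "t \<ge> 0" for t
    unfolding M_def using True that by (intro cSup_upper) auto
  have Mpos: "M > 0" using le[of 1] W_pos[of 1] by simp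
  then have "M / q < M" using q by (simp add: field_simps)
  then obtain t0 where t0: "t0 \<ge> 0" "M / q < W t0"
    unfolding M_def using less_cSup_iff[of "W ` {0..}" "M / q"] True by (auto simp: M_def)
  have "W (l * t) \<le> q * W t" if "t \<ge> t0 + 1" for t
  proof -
    have "W t0 \<le> W t" using t0 that by (intro W_mono) auto
    then have "M \<le> q * W t" using t0 q by (simp add: field_simps) (smt (verit) mult_left_mono)
    moreover have "W (l * t) \<le> M" using l t0 that by (intro le) auto
    ultimately show ?thesis by simp
  qed
  then show ?thesis using t0 by (intro exI[of _ "t0 + 1"]) auto
next
  case False
  obtain q1 where q1: "l powr (2 - \<alpha>) < q1" "q1 < q" using dense[OF q(2)] by blast
  have q1_pos: "q1 > 0" using q1(1) by (smt (verit) powr_ge_zero)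
  have "l\<^sup>2 / q1 < l powr \<alpha>"
  proof -
    have "l powr (2 - \<alpha>) * l powr \<alpha> = l\<^sup>2"
      using l by (simp add: powr_add[symmetric])
    moreover have "l powr (2 - \<alpha>) * l powr \<alpha> < q1 * l powr \<alpha>"
      using q1 l by (intro mult_strict_right_mono) auto
    ultimately show ?thesis using q1_pos by (simp add: field_simps)
  qed
  then have "\<forall>\<^sub>F t in at_top. \<phi> (l * t) / \<phi> t > l\<^sup>2 / q1"
    using ratio_lim[of l] l by (intro order_tendstoD(1)) auto
  then obtain t0' where t0': "\<And>t. t \<ge> t0' \<Longrightarrow> \<phi> (l * t) / \<phi> t > l\<^sup>2 / q1"
    by (auto simp: eventually_at_top_linorder)
  define t0 where "t0 = max t0' 1"
  have t0: "t0 > 0" "\<And>t. t \<ge> t0 \<Longrightarrow> \<phi> (l * t) / \<phi> t > l\<^sup>2 / q1"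
    using t0' by (auto simp: t0_def)
  have decr: "W (l * t) - q1 * W t \<le> W (l * t0) - q1 * W t0" if "t \<ge> t0" for t
  proof (rule DERIV_nonpos_imp_nonincreasing[OF that])
    fix x assume x: "t0 \<le> x" "x \<le> t"
    have d1: "((\<lambda>t. W (l * t)) has_real_derivative (l * x) / \<phi> (l * x) * l) (at x)"
      using x t0 l by (intro DERIV_chain2[where f = W and g = "(*) l"] W_deriv)
        (auto intro!: derivative_eq_intros)
    have d2: "((\<lambda>t. W (l * t) - q1 * W t) has_real_derivative
        (l * x) / \<phi> (l * x) * l - q1 * (x / \<phi> x)) (at x)"
      using x t0 by (intro DERIV_diff d1 DERIV_cmult W_deriv) auto
    have p: "\<phi> x > 0" "\<phi> (l * x) > 0" using x t0 l \<phi>_pos by auto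
    have "l\<^sup>2 * \<phi> x \<le> q1 * \<phi> (l * x)"
      using t0(2)[OF x(1)] p q1_pos by (simp add: field_simps)
    then have "x * (l\<^sup>2 * \<phi> x) \<le> x * (q1 * \<phi> (l * x))" using x t0 by (intro mult_left_mono) auto
    then have "(l * x) / \<phi> (l * x) * l - q1 * (x / \<phi> x) \<le> 0"
      using p by (simp add: field_simps power2_eq_square)
    with d2 show "\<exists>y. ((\<lambda>t. W (l * t) - q1 * W t) has_real_derivative y) (at x) \<and> y \<le> 0"
      by blast
  qed
  obtain t1 where t1: "t1 \<ge> 0" "W t1 > W (l * t0) / (q - q1)"
    using False by (auto simp: bdd_above_def not_le)
  have "W (l * t) \<le> q * W t" if "t \<ge> max t0 t1" for t
  proof -
    have "W t1 \<le> W t" using t1 that by (intro W_mono) auto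
    then have "W (l * t0) / (q - q1) < W t" using t1 by simp
    then have "W (l * t0) \<le> (q - q1) * W t" using q1 by (simp add: field_simps)
    moreover have "W (l * t) - q1 * W t \<le> W (l * t0) - q1 * W t0" using that by (intro decr) auto
    moreover have "q1 * W t0 \<ge> 0" using W_pos[of t0] t0 q1_pos by simp
    ultimately show ?thesis by (simp add: algebra_simps)
  qed
  then show ?thesis using t0 by (intro exI[of _ "max t0 t1"]) auto
qed

lemma scaling_growth:
  assumes l: "1 < l" and Q: "0 < Q" "Q < l\<^sup>2" "Q < l powr \<alpha>"
  shows "\<exists>T>0. \<forall>t\<ge>T. Q * scaling \<phi> t \<le> scaling \<phi> (l * t)"
proof -
  have "l powr (2 - \<alpha>) < l\<^sup>2 / Q"
  proof -
    have "Q * l powr (2 - \<alpha>) < l powr \<alpha> * l powr (2 - \<alpha>)"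
      using Q l by (intro mult_strict_right_mono) auto
    also have "\<dots> = l\<^sup>2" using l by (simp add: powr_add[symmetric])
    finally show ?thesis using Q by (simp add: field_simps)
  qed
  moreover have "1 < l\<^sup>2 / Q" using Q by (simp add: field_simps)
  ultimately obtain T where T: "T > 0" "\<And>t. t \<ge> T \<Longrightarrow> W (l * t) \<le> l\<^sup>2 / Q * W t"
    using W_growth[OF l] by blast
  have "Q * scaling \<phi> t \<le> scaling \<phi> (l * t)" if t: "t \<ge> T" for t
  proof -
    have p: "W t > 0" "W (l * t) > 0" using T t l by (auto intro!: W_pos)
    have "Q * W (l * t) \<le> l\<^sup>2 * W t" using T(2)[OF t] Q by (simp add: field_simps)
    then have "t\<^sup>2 * (Q * W (l * t)) \<le> t\<^sup>2 * (l\<^sup>2 * W t)" by (intro mult_left_mono) auto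
    then show ?thesis using p by (simp add: scaling_W field_simps)
  qed
  with T(1) show ?thesis by blast
qed

lemma scaling_upper_growth:
  assumes "1 \<le> M" "0 < t" shows "scaling \<phi> (M * t) \<le> M\<^sup>2 * scaling \<phi> t"
proof -
  have "W t \<le> W (M * t)" using assms by (intro W_mono) auto
  then show ?thesis
    using W_pos[of t] assms by (auto simp: scaling_W power_mult_distrib intro!: divide_left_mono mult_pos_pos W_pos)
qed

lemma scaling_reverse_doubling:
  "\<exists>A\<ge>1. \<exists>T>0. \<forall>t\<ge>T. M * scaling \<phi> t \<le> scaling \<phi> (A * t)"
proof -
  have "1 < (2::real) powr \<alpha>" using \<alpha>_pos by simp
  then obtain p where p: "1 < p" "p < min (2\<^sup>2) (2 powr \<alpha>)"
    using dense[of 1 "min (2\<^sup>2) (2 powr \<alpha>)"] by auto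
  obtain T where T: "T > 0" "\<And>t. t \<ge> T \<Longrightarrow> p * scaling \<phi> t \<le> scaling \<phi> (2 * t)"
    using scaling_growth[of 2 p] p by auto
  have iter: "p ^ k * scaling \<phi> t \<le> scaling \<phi> (2 ^ k * t)" if "t \<ge> T" for t k
  proof (induction k)
    case (Suc k)
    have "t \<le> 2 ^ k * t" using that T(1) by simp
    then have "p * scaling \<phi> (2 ^ k * t) \<le> scaling \<phi> (2 * (2 ^ k * t))"
      using that by (intro T(2)) auto
    moreover have "p * (p ^ k * scaling \<phi> t) \<le> p * scaling \<phi> (2 ^ k * t)"
      using Suc.IH p by (intro mult_left_mono) auto
    ultimately show ?case by (simp add: mult.assoc)
  qed simp
  obtain k where k: "M < p ^ k" using real_arch_pow[OF p(1)] by blast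
  have "M * scaling \<phi> t \<le> scaling \<phi> (2 ^ k * t)" if "t \<ge> T" for t
    using iter[OF that, of k] k scaling_pos[of t] T(1) that
    by (smt (verit) mult_right_mono)
  then show ?thesis using T(1) by (intro exI[of _ "2 ^ k"]) auto
qed

text \<open>The index of \<open>scaling \<phi>\<close> is the minimum of \<open>\<alpha>\<close> and \<open>2\<close>, so some dilation by less than
  two more than doubles it.\<close>

lemma scaling_growth_gt_linear:
  assumes "1 < \<alpha>"
  shows "\<exists>l Q T. 1 < l \<and> l < 2 \<and> 2 < Q \<and> 0 < T \<and> (\<forall>t\<ge>T. Q * scaling \<phi> t \<le> scaling \<phi> (l * t))"
proof -
  define \<beta> where "\<beta> = min \<alpha> 2"
  have \<beta>: "1 < \<beta>" "\<beta> \<le> \<alpha>" "\<beta> \<le> 2" using assms by (auto simp: \<beta>_def)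
  \<comment> \<open>The exponent is chosen strictly between \<open>1 / \<beta>\<close> and \<open>1\<close>.\<close>
  define l :: real where "l = 2 powr ((1 + 1 / \<beta>) / 2)"
  have l: "1 < l" "l < 2"
  proof -
    show "1 < l" unfolding l_def using \<beta> by (intro gr_one_powr) (auto simp: add_pos_pos)
    have "l < 2 powr 1" unfolding l_def using \<beta> by (intro powr_less_mono) (auto simp: field_simps)
    then show "l < 2" by simp
  qed
  have "l powr \<beta> = 2 powr ((\<beta> + 1) / 2)" 
  proof -
    have "(1 + 1 / \<beta>) / 2 * \<beta> = (\<beta> + 1) / 2" using \<beta> by (simp add: field_simps)
    then show ?thesis by (simp add: l_def powr_powr)
  qed
  also have "\<dots> > 2 powr 1" using \<beta> by (intro powr_less_mono) auto
  finally have "2 < l powr \<beta>" by simp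
  then obtain Q where Q: "2 < Q" "Q < l powr \<beta>" using dense by blast
  have "l powr \<beta> \<le> l powr \<alpha>" using \<beta> l by (intro powr_mono) auto
  then have Qa: "Q < l powr \<alpha>" using Q(2) by (rule less_le_trans[rotated])
  have "l powr \<beta> \<le> l powr 2" using \<beta> l by (intro powr_mono) auto
  then have "Q < l\<^sup>2" using Q l by simp
  with Qa obtain T where "0 < T" "\<forall>t\<ge>T. Q * scaling \<phi> t \<le> scaling \<phi> (l * t)"
    using scaling_growth[OF l(1), of Q] Q by auto
  with Q l show ?thesis by blast
qed

text \<open>For index at most one the integral \<open>W\<close> is dominated by its last dyadic piece.\<close>

lemma gauge_le_scaling:
  assumes "\<alpha> \<le> 1"
  shows "\<exists>C>0. \<exists>T>0. \<forall>t\<ge>T. \<phi> t \<le> C * scaling \<phi> t"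
proof -
  have "(2::real) powr \<alpha> \<le> 2 powr 1" using assms by (intro powr_mono) auto
  then have "2 powr \<alpha> < (3::real)" by simp
  then have "\<forall>\<^sub>F t in at_top. \<phi> (2 * t) / \<phi> t < 3"
    using ratio_lim[of 2] by (intro order_tendstoD(2)) auto
  then obtain t0' where t0': "\<And>t. t \<ge> t0' \<Longrightarrow> \<phi> (2 * t) / \<phi> t < 3"
    by (auto simp: eventually_at_top_linorder)
  define t0 where "t0 = max t0' 1"
  have t0: "t0 > 0" "\<And>t. t \<ge> t0 \<Longrightarrow> \<phi> (2 * t) \<le> 3 * \<phi> t"
  proof -
    show "\<phi> (2 * t) \<le> 3 * \<phi> t" if "t \<ge> t0" for t
      using t0'[of t] \<phi>_pos[of t] that by (simp add: t0_def field_simps)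
  qed (simp add: t0_def)
  obtain B where B: "B > 0" "\<And>t. t > 0 \<Longrightarrow> W (2 * t) - W t \<le> B * (t\<^sup>2 / \<phi> t)"
    using W_dyadic_increment by blast
  obtain b where b: "b \<ge> 1" "\<And>s. 0 \<le> s \<Longrightarrow> s \<le> 2 * t0 \<Longrightarrow> \<phi> s \<le> b"
    using \<phi>_bounded[of "2 * t0"] by blast
  \<comment> \<open>\<open>t\<^sup>2 / \<phi> t\<close> gains the factor \<open>4 / 3\<close> over each octave, so \<open>W t \<le> K t\<^sup>2 / \<phi> t\<close> propagates as
    soon as \<open>K + B \<le> 4 K / 3\<close>.\<close>
  define K where "K = max (3 * B) (W (2 * t0) * b / t0\<^sup>2)"
  have "W (2 * t0) * b / t0\<^sup>2 \<le> K" by (simp add: K_def)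
  then have "W (2 * t0) * b \<le> K * t0\<^sup>2" using t0(1) by (simp add: pos_divide_le_eq)
  moreover have "K \<ge> 3 * B" "K > 0" using B by (auto simp: K_def less_max_iff_disj)
  ultimately have K: "K \<ge> 3 * B" "W (2 * t0) * b \<le> K * t0\<^sup>2" "K > 0" by auto
  have base: "W t \<le> K * (t\<^sup>2 / \<phi> t)" if "t0 \<le> t" "t \<le> 2 * t0" for t
  proof -
    have p: "\<phi> t > 0" "\<phi> t \<le> b" using that t0 b(2)[of t] \<phi>_pos by auto
    have "W t * \<phi> t \<le> W (2 * t0) * b"
      using that t0 p W_pos[of "2 * t0"] by (intro mult_mono W_mono) auto
    also have "\<dots> \<le> K * t0\<^sup>2" by (rule K(2))
    also have "\<dots> \<le> K * t\<^sup>2" using K(3) that t0 by (intro mult_left_mono power_mono) auto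
    finally show ?thesis using p by (simp add: field_simps)
  qed
  have "\<forall>t. t0 \<le> t \<and> t \<le> 2 ^ Suc k * t0 \<longrightarrow> W t \<le> K * (t\<^sup>2 / \<phi> t)" for k
  proof (induction k)
    case 0 then show ?case using base by simp
  next
    case (Suc k)
    show ?case
    proof (intro allI impI)
      fix t assume t: "t0 \<le> t \<and> t \<le> 2 ^ Suc (Suc k) * t0"
      show "W t \<le> K * (t\<^sup>2 / \<phi> t)"
      proof (cases "t \<le> 2 * t0")
        case True then show ?thesis using t base by simp
      next
        case False
        define s where "s = t / 2"
        have s: "t0 \<le> s" "s \<le> 2 ^ Suc k * t0" "t = 2 * s" using t False by (auto simp: s_def)
        have p: "\<phi> s > 0" "\<phi> t > 0" using s t0 \<phi>_pos by auto
        have "W t \<le> W s + B * (s\<^sup>2 / \<phi> s)" using B(2)[of s] s t0 by simp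
        also have "\<dots> \<le> K * (s\<^sup>2 / \<phi> s) + B * (s\<^sup>2 / \<phi> s)" using Suc.IH s by simp
        also have "\<dots> = (K + B) * (s\<^sup>2 / \<phi> s)" by (simp only: distrib_right)
        also have "\<dots> \<le> (4 / 3 * K) * (s\<^sup>2 / \<phi> s)" using K(1) p by (intro mult_right_mono) auto
        also have "\<dots> = K * (4 * s\<^sup>2 / (3 * \<phi> s))" by simp
        also have "\<dots> \<le> K * (4 * s\<^sup>2 / \<phi> t)"
          using t0(2)[OF s(1)] K(3) p s(3) by (intro mult_left_mono divide_left_mono) auto
        also have "4 * s\<^sup>2 = t\<^sup>2" by (simp add: s(3))
        finally show ?thesis by simp
      qed
    qed
  qed
  moreover have "\<exists>k. t \<le> 2 ^ Suc k * t0" for t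
  proof -
    obtain k where "t / t0 < 2 ^ k" using real_arch_pow[of 2 "t / t0"] by auto
    then have "t \<le> 2 ^ k * t0" using t0(1) by (simp add: field_simps)
    also have "\<dots> \<le> 2 ^ Suc k * t0" using t0(1) by simp
    finally show ?thesis by blast
  qed
  ultimately have fin: "W t \<le> K * (t\<^sup>2 / \<phi> t)" if "t \<ge> t0" for t using that by blast
  have "\<phi> t \<le> K * scaling \<phi> t" if "t \<ge> t0" for t
    using fin[OF that] W_pos[of t] \<phi>_pos[of t] t0(1) that by (simp add: scaling_W field_simps)
  then show ?thesis using K(3) t0(1) by blast
qed

end

section \<open>Words, balls and volume growth\<close>

lemma dyadic_bracket:
  fixes x :: real
  assumes "1 \<le> x"
  obtains J :: nat where "2 ^ J \<le> x" "x < 2 ^ Suc J"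
proof -
  obtain n where "x < 2 ^ n" using real_arch_pow[of 2 x] by auto
  then have ex: "x < 2 ^ Suc n" using assms by simp
  define J where "J = (LEAST J. x < 2 ^ Suc J)"
  have "x < 2 ^ Suc J" unfolding J_def using ex by (rule LeastI)
  moreover have "2 ^ J \<le> x"
  proof (cases J)
    case (Suc J')
    then have "\<not> x < 2 ^ Suc J'" using not_less_Least[of J' "\<lambda>J. x < 2 ^ Suc J"] by (simp add: J_def)
    then show ?thesis using Suc by simp
  qed (use assms in simp)
  ultimately show ?thesis using that by blast
qed

lemma integrable_indicator_pmf: "integrable (measure_pmf p) (indicator A :: _ \<Rightarrow> real)"
  by (rule measure_pmf.integrable_const_bound[where B = 1]) auto

lemma two_power_sq: "((2::real) ^ j)\<^sup>2 = 4 ^ j"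
  by (simp add: power2_eq_square power_mult_distrib[symmetric])

locale fg_group = group G for G (structure) +
  fixes S :: "'a set"
  assumes finite_S: "finite S" and gen_S: "symmetric_generating_set G S"
begin

abbreviation len :: "'a \<Rightarrow> real" where "len \<equiv> word_length G S"
abbreviation vol :: "real \<Rightarrow> real" where "vol \<equiv> volume_fun G len"

definition word :: "'a list \<Rightarrow> 'a" where "word us = foldr (\<otimes>) us \<one>"

definition ball_len :: "real \<Rightarrow> 'a set" where "ball_len t = {g \<in> carrier G. len g \<le> t}"

lemma S_carrier: "S \<subseteq> carrier G" and S_inv: "s \<in> S \<Longrightarrow> inv s \<in> S"
  and S_gen: "generate G S = carrier G"
  using gen_S by (auto simp: symmetric_generating_set_def)

lemma word_simps [simp]: "word [] = \<one>" "word (u # us) = u \<otimes> word us"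
  by (simp_all add: word_def)

lemma word_closed [simp]: "set us \<subseteq> S \<Longrightarrow> word us \<in> carrier G"
  by (induction us) (use S_carrier in auto)

lemma word_append: "set us \<subseteq> S \<Longrightarrow> set vs \<subseteq> S \<Longrightarrow> word (us @ vs) = word us \<otimes> word vs"
proof (induction us)
  case (Cons u us)
  then show ?case using S_carrier by (auto simp: m_assoc)
qed simp

lemma word_inv: "set us \<subseteq> S \<Longrightarrow> inv (word us) = word (rev (map (m_inv G) us))"
proof (induction us)
  case (Cons u us)
  then have "set (rev (map (m_inv G) us)) \<subseteq> S" using S_inv by auto
  with Cons show ?case using S_carrier S_inv[of u]
    by (auto simp: word_append inv_mult_group)
qed simp

lemma ex_word:
  assumes "g \<in> carrier G" shows "\<exists>us. set us \<subseteq> S \<and> word us = g"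
proof -
  have "g \<in> generate G S" using assms S_gen by simp
  then show ?thesis
  proof (induction rule: generate.induct)
    case one then show ?case by (intro exI[of _ "[]"]) simp
  next
    case (incl h)
    then show ?case using S_carrier by (intro exI[of _ "[h]"]) auto
  next
    case (inv h)
    then show ?case using S_carrier S_inv by (intro exI[of _ "[inv h]"]) auto
  next
    case (eng h1 h2)
    then obtain us vs where "set us \<subseteq> S" "word us = h1" "set vs \<subseteq> S" "word vs = h2" by blast
    then show ?case by (intro exI[of _ "us @ vs"]) (auto simp: word_append)
  qed
qed

lemma geodesic:
  assumes "g \<in> carrier G"
  obtains us where "set us \<subseteq> S" "word us = g" "real (length us) = len g"
proof -
  define P where "P k = (\<exists>us. length us = k \<and> set us \<subseteq> S \<and> foldr (\<otimes>) us \<one> = g)" for k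
  have "\<exists>k. P k" using ex_word[OF assms] by (auto simp: P_def word_def)
  then have "P (LEAST k. P k)" by (rule LeastI_ex)
  then show ?thesis using that by (auto simp: P_def word_length_def word_def)
qed

lemma len_word: "set us \<subseteq> S \<Longrightarrow> len (word us) \<le> length us"
  unfolding word_length_def word_def by (auto intro!: Least_le)

lemma len_nonneg [simp]: "0 \<le> len g"
  by (simp add: word_length_def)

lemma len_one [simp]: "len \<one> = 0"
  using len_word[of "[]"] len_nonneg[of \<one>] by (simp del: len_nonneg)

lemma len_eq_0: "g \<in> carrier G \<Longrightarrow> len g = 0 \<longleftrightarrow> g = \<one>"
  by (metis geodesic len_one length_0_conv of_nat_eq_0_iff word_simps(1))

lemma len_lt_1: "g \<in> carrier G \<Longrightarrow> len g < 1 \<Longrightarrow> g = \<one>"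
  by (metis geodesic len_eq_0 less_one of_nat_0 of_nat_less_1_iff)

lemma len_mult:
  assumes "g \<in> carrier G" "h \<in> carrier G" shows "len (g \<otimes> h) \<le> len g + len h"
proof -
  obtain us vs where "set us \<subseteq> S" "word us = g" "real (length us) = len g"
    "set vs \<subseteq> S" "word vs = h" "real (length vs) = len h"
    using assms by (metis geodesic)
  then show ?thesis using len_word[of "us @ vs"] by (simp add: word_append)
qed

lemma len_inv_le: "g \<in> carrier G \<Longrightarrow> len (inv g) \<le> len g"
proof -
  assume "g \<in> carrier G"
  then obtain us where us: "set us \<subseteq> S" "word us = g" "real (length us) = len g" by (rule geodesic)
  have "len (word (rev (map (m_inv G) us))) \<le> length (rev (map (m_inv G) us))"
    using us S_inv by (intro len_word) auto
  then show ?thesis using us by (simp add: word_inv[symmetric])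
qed

lemma len_inv [simp]: "g \<in> carrier G \<Longrightarrow> len (inv g) = len g"
  using len_inv_le[of g] len_inv_le[of "inv g"] by simp

lemma group_norm_len: "group_norm G len"
  by (auto simp: group_norm_def len_eq_0 len_mult)

lemma geodesic_split:
  assumes g: "g \<in> carrier G"
  obtains a b where "a \<in> carrier G" "b \<in> carrier G" "g = a \<otimes> b" "len a \<le> real i" "len b \<le> max 0 (len g - real i)"
proof -
  obtain us where us: "set us \<subseteq> S" "word us = g" "real (length us) = len g" using g by (rule geodesic)
  have sub: "set (take i us) \<subseteq> S" "set (drop i us) \<subseteq> S"
    using us(1) set_take_subset set_drop_subset by (meson order_trans)+
  show ?thesis
  proof (rule that)
    show "g = word (take i us) \<otimes> word (drop i us)"
      using word_append[OF sub] us by simp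
    have "len (word (take i us)) \<le> length (take i us)" by (intro len_word sub)
    then show "len (word (take i us)) \<le> real i" by simp
    have "len (word (drop i us)) \<le> length (drop i us)" by (intro len_word sub)
    also have "\<dots> \<le> max 0 (len g - real i)" using us(3) by simp
    finally show "len (word (drop i us)) \<le> max 0 (len g - real i)" .
  qed (use sub in auto)
qed

lemma ball_finite [simp]: "finite (ball_len t)"
proof (rule finite_subset)
  show "ball_len t \<subseteq> word ` {us. set us \<subseteq> S \<and> length us \<le> nat \<lfloor>t\<rfloor>}"
  proof
    fix g assume "g \<in> ball_len t"
    then have g: "g \<in> carrier G" "len g \<le> t" by (auto simp: ball_len_def)
    obtain us where us: "set us \<subseteq> S" "word us = g" "real (length us) = len g" using g(1) by (rule geodesic)
    then have "length us \<le> nat \<lfloor>t\<rfloor>" using g by (simp add: le_nat_floor)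
    then show "g \<in> word ` {us. set us \<subseteq> S \<and> length us \<le> nat \<lfloor>t\<rfloor>}" using us by blast
  qed
  show "finite (word ` {us. set us \<subseteq> S \<and> length us \<le> nat \<lfloor>t\<rfloor>})"
    using finite_S by (intro finite_imageI finite_lists_length_le)
qed

lemma ball_carrier: "g \<in> ball_len t \<Longrightarrow> g \<in> carrier G" and ball_len_le: "g \<in> ball_len t \<Longrightarrow> len g \<le> t"
  by (auto simp: ball_len_def)

lemma ball_mono: "s \<le> t \<Longrightarrow> ball_len s \<subseteq> ball_len t"
  by (auto simp: ball_len_def)

lemma one_in_ball: "0 \<le> t \<Longrightarrow> \<one> \<in> ball_len t"
  by (auto simp: ball_len_def)

lemma vol_eq: "vol t = real (card (ball_len t))"
  by (simp add: volume_fun_def ball_len_def)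

lemma vol_mono: "s \<le> t \<Longrightarrow> vol s \<le> vol t"
  unfolding vol_eq by (simp add: card_mono ball_mono)

lemma vol_ge_1: "0 \<le> t \<Longrightarrow> 1 \<le> vol t"
proof -
  assume "0 \<le> t"
  then have "card (ball_len t) > 0" using one_in_ball by (auto simp: card_gt_0_iff)
  then show ?thesis unfolding vol_eq by linarith
qed

lemma vol_pos: "0 \<le> t \<Longrightarrow> 0 < vol t"
  using vol_ge_1[of t] by simp

lemma countable_carrier: "countable (carrier G)"
proof -
  have "carrier G \<subseteq> (\<Union>n. ball_len (real n))"
    by (auto simp: ball_len_def) (metis geodesic order_refl)
  moreover have "countable (\<Union>n. ball_len (real n))"
    by (rule countable_UN) (simp_all add: countable_finite)
  ultimately show ?thesis by (rule countable_subset)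
qed

lemma sum_translate_ball_le:
  fixes f :: "'a \<Rightarrow> real"
  assumes z: "z \<in> carrier G" "len z \<le> s" and nn: "\<And>g. g \<in> carrier G \<Longrightarrow> 0 \<le> f g"
  shows "(\<Sum>h\<in>ball_len t. f (z \<otimes> h)) \<le> (\<Sum>h\<in>ball_len (s + t). f h)"
proof -
  have inj: "inj_on ((\<otimes>) z) (ball_len t)"
    using z by (auto simp: inj_on_def ball_len_def)
  have "(\<Sum>h\<in>ball_len t. f (z \<otimes> h)) = (\<Sum>h\<in>((\<otimes>) z) ` ball_len t. f h)"
    by (simp add: sum.reindex[OF inj])
  also have "\<dots> \<le> (\<Sum>h\<in>ball_len (s + t). f h)"
  proof (rule sum_mono2)
    show "(\<otimes>) z ` ball_len t \<subseteq> ball_len (s + t)"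
      using z len_mult by (force simp: ball_len_def)
  qed (auto dest: ball_carrier intro: nn)
  finally show ?thesis .
qed

lemma subadditive_le_mult:
  fixes N :: "'a \<Rightarrow> real"
  assumes one: "N \<one> = 0" and sub: "\<And>g h. g \<in> carrier G \<Longrightarrow> h \<in> carrier G \<Longrightarrow> N (g \<otimes> h) \<le> N g + N h"
    and M: "0 \<le> M" "\<And>z. z \<in> carrier G \<Longrightarrow> len z \<le> real s \<Longrightarrow> N z \<le> M"
  shows "g \<in> carrier G \<Longrightarrow> len g \<le> real k * real s \<Longrightarrow> N g \<le> real k * M"
proof (induction k arbitrary: g)
  case 0
  then have "g = \<one>" using len_eq_0[of g] len_nonneg[of g] by simp
  then show ?case using one by simp
next
  case (Suc k)
  obtain a b where ab: "a \<in> carrier G" "b \<in> carrier G" "g = a \<otimes> b" "len a \<le> real s"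
    "len b \<le> max 0 (len g - real s)" using Suc.prems(1) by (rule geodesic_split)
  have "0 \<le> real k * real s" by simp
  moreover have "len g - real s \<le> real k * real s" using Suc.prems(2) by (simp add: algebra_simps)
  ultimately have "len b \<le> real k * real s" using ab(5) by linarith
  then have "N b \<le> real k * M" using ab by (intro Suc.IH) auto
  moreover have "N a \<le> M" using ab M by auto
  ultimately show ?case using sub[of a b] ab by (simp add: algebra_simps)
qed

end

locale polynomial_growth_group = fg_group +
  assumes poly: "polynomial_growth G S"
begin

lemma vol_doubling: "\<exists>K\<ge>1. \<forall>t\<ge>0. vol (2 * t) \<le> K * vol t"
proof -
  obtain D c C where c: "0 < c" "c \<le> C"
    and b: "\<And>t. 1 \<le> t \<Longrightarrow> c * t powr D \<le> vol t" "\<And>t. 1 \<le> t \<Longrightarrow> vol t \<le> C * t powr D"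
    using poly by (auto simp: polynomial_growth_def simeq_on_def)
  define K where "K = max (vol 2) (C / c * 2 powr D)"
  have K: "K \<ge> 1" "K \<ge> vol 2" "K \<ge> C / c * 2 powr D" using vol_ge_1[of 2] by (auto simp: K_def)
  have "vol (2 * t) \<le> K * vol t" if t: "t \<ge> 0" for t
  proof (cases "t \<ge> 1")
    case True
    have "vol (2 * t) \<le> C * (2 * t) powr D" using True by (intro b(2)) auto
    also have "\<dots> = C / c * 2 powr D * (c * t powr D)" using True c by (simp add: powr_mult)
    also have "\<dots> \<le> K * vol t"
      using K b(1)[OF True] c True by (intro mult_mono) auto
    finally show ?thesis .
  next
    case False
    then have "vol (2 * t) \<le> vol 2" by (intro vol_mono) auto
    also have "\<dots> \<le> K * 1" using K by simp
    also have "\<dots> \<le> K * vol t" using vol_ge_1[OF t] K by (intro mult_left_mono) auto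
    finally show ?thesis .
  qed
  then show ?thesis using K by blast
qed

lemma vol_scale: "\<exists>K\<ge>1. \<forall>t\<ge>0. vol (M * t) \<le> K * vol t"
proof -
  obtain K where K: "K \<ge> 1" "\<And>t. t \<ge> 0 \<Longrightarrow> vol (2 * t) \<le> K * vol t" using vol_doubling by blast
  have iter: "vol (2 ^ k * t) \<le> K ^ k * vol t" if "t \<ge> 0" for t k
  proof (induction k)
    case (Suc k)
    have "vol (2 * (2 ^ k * t)) \<le> K * vol (2 ^ k * t)" using that by (intro K(2)) auto
    also have "\<dots> \<le> K * (K ^ k * vol t)" using Suc.IH K by (intro mult_left_mono) auto
    finally show ?case by (simp add: mult.assoc)
  qed simp
  obtain k where k: "M < 2 ^ k" using real_arch_pow[of 2 M] by auto
  have "vol (M * t) \<le> K ^ k * vol t" if "t \<ge> 0" for t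
  proof -
    have "vol (M * t) \<le> vol (2 ^ k * t)" using k that by (intro vol_mono mult_right_mono) auto
    then show ?thesis using iter[OF that, of k] by simp
  qed
  then show ?thesis using K by (intro exI[of _ "K ^ k"]) auto
qed

end

section \<open>The jump law: Poincare inequality and truncated second moment\<close>

locale jump_law = polynomial_growth_group G S + gauge \<phi> \<alpha>
  for G (structure) and S :: "'a set" and \<phi> :: "real \<Rightarrow> real" and \<alpha> +
  fixes \<nu> :: "'a pmf"
  assumes \<nu>_sym: "symmetric_prob G \<nu>"
    and \<nu>_simeq: "simeq_on (carrier G) (pmf \<nu>) (\<lambda>g. 1 / (\<phi> (len g) * vol (len g)))"
begin

lemma \<nu>_lower: "\<exists>c>0. \<forall>g\<in>carrier G. c / (\<phi> (len g) * vol (len g)) \<le> pmf \<nu> g"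
  using \<nu>_simeq by (auto simp: simeq_on_def)

lemma \<nu>_upper: "\<exists>C>0. \<forall>g\<in>carrier G. pmf \<nu> g \<le> C / (\<phi> (len g) * vol (len g))"
  using \<nu>_simeq by (auto simp: simeq_on_def) (metis less_le_trans)

lemma \<nu>_pos: "g \<in> carrier G \<Longrightarrow> 0 < pmf \<nu> g"
proof -
  assume g: "g \<in> carrier G"
  obtain c where "c > 0" "c / (\<phi> (len g) * vol (len g)) \<le> pmf \<nu> g" using \<nu>_lower g by blast
  moreover have "0 < \<phi> (len g) * vol (len g)" using \<phi>_pos vol_pos by simp
  ultimately show ?thesis by (meson divide_pos_pos less_le_trans)
qed

text \<open>The kernel \<open>1 / (\<phi> V)\<close> dominates a superposition of uniform kernels on dyadic balls: by the
  geometric growth of \<open>\<phi>\<close>, the balls containing \<open>h\<close> contribute about as much as the smallest one.\<close>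

lemma \<nu>_dominates_ball_kernels:
  "\<exists>C>0. \<forall>J. \<forall>h\<in>carrier G. h \<noteq> \<one> \<longrightarrow>
     (\<Sum>j | j \<le> J \<and> len h \<le> 2 ^ j. 1 / (\<phi> (2 ^ j) * vol (2 ^ j))) \<le> C * pmf \<nu> h"
proof -
  obtain C1 where C1: "C1 \<ge> 1"
    "\<And>s t. 0 \<le> s \<Longrightarrow> 0 \<le> t \<Longrightarrow> s \<le> 2 * t \<Longrightarrow> t \<le> 2 * s \<Longrightarrow> \<phi> s \<le> C1 * \<phi> t"
    using \<phi>_comparable by blast
  obtain C3 where C3: "C3 > 0" "\<And>i k. (\<Sum>j<k. 1 / \<phi> (2 ^ (i + j))) \<le> C3 / \<phi> (2 ^ i)"
    using dyadic_reciprocal_sum by blast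
  obtain c where c: "c > 0" "\<And>g. g \<in> carrier G \<Longrightarrow> c / (\<phi> (len g) * vol (len g)) \<le> pmf \<nu> g"
    using \<nu>_lower by blast
  have "(\<Sum>j | j \<le> J \<and> len h \<le> 2 ^ j. 1 / (\<phi> (2 ^ j) * vol (2 ^ j))) \<le> C3 * C1 / c * pmf \<nu> h"
    if h: "h \<in> carrier G" "h \<noteq> \<one>" for J h
  proof -
    have len1: "len h \<ge> 1" using len_lt_1[OF h(1)] h(2) by force
    define i where "i = (LEAST i. len h \<le> 2 ^ i)"
    have ex: "\<exists>i. len h \<le> 2 ^ i" using real_arch_pow[of 2 "len h"] by (auto intro: less_imp_le)
    have i1: "len h \<le> 2 ^ i" unfolding i_def using ex by (rule LeastI_ex)
    have i2: "2 ^ i \<le> 2 * len h"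
    proof (cases i)
      case (Suc i')
      then have "\<not> len h \<le> 2 ^ i'" using not_less_Least[of i' "\<lambda>i. len h \<le> 2 ^ i"] by (simp add: i_def)
      then show ?thesis using Suc by simp
    qed (use len1 in simp)
    have i3: "i \<le> j" if "len h \<le> 2 ^ j" for j unfolding i_def using that by (rule Least_le)
    have pi: "\<phi> (2 ^ i) > 0" "vol (2 ^ i) > 0" "\<phi> (len h) > 0" "vol (len h) > 0"
      using \<phi>_pos vol_pos by auto
    have "(\<Sum>j | j \<le> J \<and> len h \<le> 2 ^ j. 1 / (\<phi> (2 ^ j) * vol (2 ^ j)))
        \<le> (\<Sum>j | j \<le> J \<and> len h \<le> 2 ^ j. 1 / \<phi> (2 ^ j) * (1 / vol (2 ^ i)))"
    proof (rule sum_mono)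
      fix j assume j: "j \<in> {j. j \<le> J \<and> len h \<le> 2 ^ j}"
      have "vol (2 ^ i) \<le> vol (2 ^ j)" using i3 j by (intro vol_mono power_increasing) auto
      then show "1 / (\<phi> (2 ^ j) * vol (2 ^ j)) \<le> 1 / \<phi> (2 ^ j) * (1 / vol (2 ^ i))"
        using pi \<phi>_pos[of "2 ^ j"] by (simp add: frac_le)
    qed
    also have "\<dots> \<le> (\<Sum>j\<in>(+) i ` {..<Suc J}. 1 / \<phi> (2 ^ j) * (1 / vol (2 ^ i)))"
    proof (rule sum_mono2)
      show "{j. j \<le> J \<and> len h \<le> 2 ^ j} \<subseteq> (+) i ` {..<Suc J}"
      proof
        fix j assume "j \<in> {j. j \<le> J \<and> len h \<le> 2 ^ j}"
        then have "j = i + (j - i)" "j - i < Suc J" using i3[of j] by auto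
        then show "j \<in> (+) i ` {..<Suc J}" by blast
      qed
      show "0 \<le> 1 / \<phi> (2 ^ b) * (1 / vol (2 ^ i))" for b
        using \<phi>_pos[of "2 ^ b"] pi by simp
    qed simp
    also have "\<dots> = (\<Sum>j<Suc J. 1 / \<phi> (2 ^ (i + j))) * (1 / vol (2 ^ i))"
      by (subst sum.reindex) (simp_all only: inj_on_add o_def sum_distrib_right)
    also have "\<dots> \<le> C3 / \<phi> (2 ^ i) * (1 / vol (2 ^ i))"
      using C3(2)[of i "Suc J"] pi by (intro mult_right_mono) auto
    also have "\<dots> \<le> C3 * C1 / (\<phi> (len h) * vol (len h))"
    proof -
      have "\<phi> (len h) \<le> C1 * \<phi> (2 ^ i)" using i1 i2 by (intro C1(2)) auto
      moreover have "vol (len h) \<le> vol (2 ^ i)" using i1 by (rule vol_mono)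
      ultimately have "\<phi> (len h) * vol (len h) \<le> (C1 * \<phi> (2 ^ i)) * vol (2 ^ i)"
        using pi by (intro mult_mono) auto
      then have "C3 * (\<phi> (len h) * vol (len h)) \<le> C3 * ((C1 * \<phi> (2 ^ i)) * vol (2 ^ i))"
        using C3(1) by (intro mult_left_mono) auto
      then show ?thesis using pi by (simp add: field_simps)
    qed
    also have "\<dots> = C3 * C1 / c * (c / (\<phi> (len h) * vol (len h)))" using c(1) by simp
    also have "\<dots> \<le> C3 * C1 / c * pmf \<nu> h"
      using c C1(1) C3(1) h by (intro mult_left_mono) auto
    finally show ?thesis .
  qed
  moreover have "C3 * C1 / c > 0" using C1(1) C3(1) c by simp
  ultimately show ?thesis by blast
qed

text \<open>Pseudo-Poincare inequality, stated for any subadditive symmetric function; it will be used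
  for \<open>N h = \<parallel>f - f(\<cdot> h)\<parallel>\<^sub>2\<close>.  At each dyadic scale \<open>2\<^sup>j\<close> an element of length \<open>R\<close> is a
  product of \<open>R / 2\<^sup>j\<close> elements, each of which is compared with a uniformly chosen element of the
  ball; summing over the scales produces the weight \<open>\<Sum> 4\<^sup>j / \<phi> (2\<^sup>j)\<close>, which is of the order of \<open>W R\<close>.\<close>

lemma pseudo_poincare:
  "\<exists>C>0. \<forall>N :: 'a \<Rightarrow> real.
     (N \<one> = 0 \<and> (\<forall>g\<in>carrier G. 0 \<le> N g \<and> N g \<le> B \<and> N (inv g) = N g) \<and>
      (\<forall>g\<in>carrier G. \<forall>h\<in>carrier G. N (g \<otimes> h) \<le> N g + N h)) \<longrightarrow>
     (\<forall>R>0. \<forall>g\<in>carrier G. len g \<le> R \<longrightarrow>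
        (N g)\<^sup>2 \<le> C * scaling \<phi> R * measure_pmf.expectation \<nu> (\<lambda>h. (N h)\<^sup>2))"
proof -
  obtain C1 where C1: "C1 \<ge> 1"
    "\<And>s t. 0 \<le> s \<Longrightarrow> 0 \<le> t \<Longrightarrow> s \<le> 2 * t \<Longrightarrow> t \<le> 2 * s \<Longrightarrow> \<phi> s \<le> C1 * \<phi> t"
    using \<phi>_comparable by blast
  obtain K where K: "K \<ge> 1" "\<And>t. t \<ge> 0 \<Longrightarrow> vol (2 * t) \<le> K * vol t" using vol_doubling by blast
  obtain C2 where C2: "C2 > 0" "\<And>J h. h \<in> carrier G \<Longrightarrow> h \<noteq> \<one> \<Longrightarrow>
     (\<Sum>j | j \<le> J \<and> len h \<le> 2 ^ j. 1 / (\<phi> (2 ^ j) * vol (2 ^ j))) \<le> C2 * pmf \<nu> h"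
    using \<nu>_dominates_ball_kernels by blast
  obtain C4 where C4: "C4 > 0" "\<And>J. W (2 ^ Suc J) \<le> C4 * dyadic_sum J" using W_le_dyadic_sum by blast
  define C where "C = 16 * C1 * K * C2 * C4"
  have Cpos: "C > 0" using C1(1) K(1) C2(1) C4(1) by (simp add: C_def)
  have "(N g)\<^sup>2 \<le> C * scaling \<phi> R * measure_pmf.expectation \<nu> (\<lambda>h. (N h)\<^sup>2)"
    if N: "N \<one> = 0" "\<And>g. g \<in> carrier G \<Longrightarrow> 0 \<le> N g" "\<And>g. g \<in> carrier G \<Longrightarrow> N g \<le> B"
      "\<And>g. g \<in> carrier G \<Longrightarrow> N (inv g) = N g"
      "\<And>g h. g \<in> carrier G \<Longrightarrow> h \<in> carrier G \<Longrightarrow> N (g \<otimes> h) \<le> N g + N h"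
      and R: "R > 0" and g: "g \<in> carrier G" "len g \<le> R" for N R g
  proof -
    define E where "E = measure_pmf.expectation \<nu> (\<lambda>h. (N h)\<^sup>2)"
    have \<nu>_carrier: "set_pmf \<nu> \<subseteq> carrier G" using \<nu>_sym by (simp add: symmetric_prob_def)
    have intgr: "integrable (measure_pmf \<nu>) (\<lambda>h. (N h)\<^sup>2)"
    proof (rule measure_pmf.integrable_const_bound[where B = "B\<^sup>2"])
      show "AE h in measure_pmf \<nu>. norm ((N h)\<^sup>2) \<le> B\<^sup>2"
        using \<nu>_carrier N by (auto simp: AE_measure_pmf_iff intro!: power_mono)
    qed simp
    have E0: "E \<ge> 0" unfolding E_def by simp
    show ?thesis
    proof (cases "R < 1")
      case True
      then have "g = \<one>" using g len_lt_1 by auto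
      then show ?thesis using N(1) Cpos scaling_pos[OF R] E0 by (simp add: E_def)
    next
      case False
      then obtain J where J2: "2 ^ J \<le> R" and J1: "R < 2 ^ Suc J"
        using dyadic_bracket[of R] by force
      define a where "a j = \<phi> (2 ^ j)" for j :: nat
      define v where "v j = vol (2 ^ j)" for j :: nat
      define Q where "Q j = (\<Sum>h\<in>ball_len (2 ^ j). (N h)\<^sup>2)" for j :: nat
      have pos: "a j > 0" "v j > 0" "Q j \<ge> 0" for j
        using \<phi>_pos vol_pos by (auto simp: a_def v_def Q_def intro!: sum_nonneg)
      have small: "(N z)\<^sup>2 \<le> 4 * Q (Suc j) / v j" if z: "z \<in> carrier G" "len z \<le> 2 ^ j" for z j
      proof -
        have "v j * (N z)\<^sup>2 = (\<Sum>h\<in>ball_len (2 ^ j). (N z)\<^sup>2)"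
          by (simp add: v_def vol_eq)
        also have "\<dots> \<le> (\<Sum>h\<in>ball_len (2 ^ j). 2 * (N (z \<otimes> h))\<^sup>2 + 2 * (N h)\<^sup>2)"
        proof (rule sum_mono)
          fix h assume "h \<in> ball_len (2 ^ j)"
          then have h: "h \<in> carrier G" by (rule ball_carrier)
          have "N z = N ((z \<otimes> h) \<otimes> inv h)" using z h by (simp add: m_assoc)
          also have "\<dots> \<le> N (z \<otimes> h) + N (inv h)" using z h by (intro N(5)) auto
          finally have "N z \<le> N (z \<otimes> h) + N h" using N(4) h by simp
          then have "(N z)\<^sup>2 \<le> (N (z \<otimes> h) + N h)\<^sup>2" using N(2) z by (intro power_mono) auto
          also have "\<dots> \<le> 2 * (N (z \<otimes> h))\<^sup>2 + 2 * (N h)\<^sup>2"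
            using zero_le_power2[of "N (z \<otimes> h) - N h"] by (simp add: power2_eq_square algebra_simps)
          finally show "(N z)\<^sup>2 \<le> 2 * (N (z \<otimes> h))\<^sup>2 + 2 * (N h)\<^sup>2" .
        qed
        also have "\<dots> = 2 * (\<Sum>h\<in>ball_len (2 ^ j). (N (z \<otimes> h))\<^sup>2) + 2 * Q j"
          by (simp add: sum.distrib sum_distrib_left Q_def)
        also have "(\<Sum>h\<in>ball_len (2 ^ j). (N (z \<otimes> h))\<^sup>2) \<le> Q (Suc j)"
          using sum_translate_ball_le[OF z, of "\<lambda>h. (N h)\<^sup>2" "2 ^ j"] by (simp add: Q_def)
        also have "Q j \<le> Q (Suc j)"
          unfolding Q_def by (intro sum_mono2 ball_mono) auto
        finally show ?thesis using pos[of j] by (simp add: field_simps)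
      qed
      have scale: "4 ^ j / a j * (N g)\<^sup>2 \<le> 16 * C1 * K * 4 ^ J * (Q (Suc j) / (a (Suc j) * v (Suc j)))"
        if j: "j \<le> J" for j
      proof -
        define M where "M = sqrt (4 * Q (Suc j) / v j)"
        have M2: "M\<^sup>2 = 4 * Q (Suc j) / v j" and M0: "M \<ge> 0"
          using pos divide_nonneg_pos[of "4 * Q (Suc j)" "v j"] by (simp_all add: M_def)
        have zM: "N z \<le> M" if "z \<in> carrier G" "len z \<le> real (2 ^ j)" for z
          unfolding M_def using small[OF that(1)] that(2) by (intro real_le_rsqrt) simp
        have "len g \<le> real (2 ^ (Suc J - j)) * real (2 ^ j)"
          using j g J1 by (simp add: power_add[symmetric])
        then have "N g \<le> real (2 ^ (Suc J - j)) * M"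
          using N(1) N(5) M0 zM g(1) subadditive_le_mult[of N M "2 ^ j" g "2 ^ (Suc J - j)"] by blast
        then have "(N g)\<^sup>2 \<le> (real (2 ^ (Suc J - j)) * M)\<^sup>2" using N(2) g by (intro power_mono) auto
        also have "\<dots> = 4 ^ (Suc J - j) * (4 * Q (Suc j) / v j)"
          by (simp add: power_mult_distrib M2 two_power_sq)
        finally have "4 ^ j / a j * (N g)\<^sup>2 \<le> 4 ^ j / a j * (4 ^ (Suc J - j) * (4 * Q (Suc j) / v j))"
          using pos by (intro mult_left_mono) (auto intro: less_imp_le)
        also have "\<dots> = (4 ^ j * 4 ^ (Suc J - j)) * 4 * Q (Suc j) * (1 / (a j * v j))"
          by (simp add: field_simps)
        also have "(4::real) ^ j * 4 ^ (Suc J - j) = 4 * 4 ^ J"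
          using j by (simp add: power_add[symmetric])
        also have "4 * 4 ^ J * 4 * Q (Suc j) * (1 / (a j * v j))
            \<le> 4 * 4 ^ J * 4 * Q (Suc j) * (C1 * K / (a (Suc j) * v (Suc j)))"
        proof (rule mult_left_mono)
          have "a (Suc j) \<le> C1 * a j" unfolding a_def by (intro C1(2)) auto
          moreover have "v (Suc j) \<le> K * v j" using K(2)[of "2 ^ j"] by (simp add: v_def)
          ultimately have "a (Suc j) * v (Suc j) \<le> (C1 * a j) * (K * v j)"
            using pos C1(1) by (intro mult_mono) (auto intro: less_imp_le)
          then show "1 / (a j * v j) \<le> C1 * K / (a (Suc j) * v (Suc j))"
            using pos[of j] pos[of "Suc j"] by (simp add: field_simps)
        qed (use pos in auto)
        finally show ?thesis by (simp add: mult_ac)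
      qed
      have "dyadic_sum J * (N g)\<^sup>2 = (\<Sum>j\<le>J. 4 ^ j / a j * (N g)\<^sup>2)"
        by (simp add: dyadic_sum_def a_def sum_distrib_right)
      also have "\<dots> \<le> (\<Sum>j\<le>J. 16 * C1 * K * 4 ^ J * (Q (Suc j) / (a (Suc j) * v (Suc j))))"
        using scale by (intro sum_mono) auto
      also have "\<dots> = 16 * C1 * K * 4 ^ J * (\<Sum>j\<in>Suc ` {..J}. Q j / (a j * v j))"
        by (subst sum.reindex) (simp_all add: sum_distrib_left)
      also have "\<dots> \<le> 16 * C1 * K * 4 ^ J * (\<Sum>j\<le>Suc J. Q j / (a j * v j))"
      proof (intro mult_left_mono sum_mono2)
        show "0 \<le> Q j / (a j * v j)" for j
          using pos[of j] by (intro divide_nonneg_nonneg mult_nonneg_nonneg) simp_all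
      qed (use C1(1) K(1) in auto)
      finally have main': "dyadic_sum J * (N g)\<^sup>2 \<le> 16 * C1 * K * 4 ^ J * (\<Sum>j\<le>Suc J. Q j / (a j * v j))" .
      have "(\<Sum>j\<le>Suc J. Q j / (a j * v j)) \<le> C2 * E"
      proof -
        have "(\<Sum>j\<le>Suc J. Q j / (a j * v j)) =
            (\<Sum>j\<le>Suc J. \<Sum>h\<in>ball_len (2 ^ Suc J). if len h \<le> 2 ^ j then (N h)\<^sup>2 * (1 / (a j * v j)) else 0)"
        proof (rule sum.cong[OF refl])
          fix j assume j: "j \<in> {..Suc J}"
          have "ball_len (2 ^ j) = {h \<in> ball_len (2 ^ Suc J). len h \<le> 2 ^ j}"
          proof -
            have "(2::real) ^ j \<le> 2 ^ Suc J" using j by (intro power_increasing) auto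
            then show ?thesis by (auto simp: ball_len_def)
          qed
          then have "Q j / (a j * v j) = (\<Sum>h\<in>{h \<in> ball_len (2 ^ Suc J). len h \<le> 2 ^ j}. (N h)\<^sup>2 * (1 / (a j * v j)))"
            by (simp add: Q_def sum_divide_distrib)
          also have "\<dots> = (\<Sum>h\<in>ball_len (2 ^ Suc J). if len h \<le> 2 ^ j then (N h)\<^sup>2 * (1 / (a j * v j)) else 0)"
            by (rule sum.inter_filter) simp
          finally show "Q j / (a j * v j) = \<dots>" .
        qed
        also have "\<dots> = (\<Sum>h\<in>ball_len (2 ^ Suc J). \<Sum>j\<le>Suc J. if len h \<le> 2 ^ j then (N h)\<^sup>2 * (1 / (a j * v j)) else 0)"
          by (rule sum.swap)
        also have "\<dots> \<le> (\<Sum>h\<in>ball_len (2 ^ Suc J). C2 * ((N h)\<^sup>2 * pmf \<nu> h))"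
        proof (rule sum_mono)
          fix h assume "h \<in> ball_len (2 ^ Suc J)"
          then have h: "h \<in> carrier G" by (rule ball_carrier)
          have "(\<Sum>j\<le>Suc J. if len h \<le> 2 ^ j then (N h)\<^sup>2 * (1 / (a j * v j)) else 0)
              = (\<Sum>j | j \<in> {..Suc J} \<and> len h \<le> 2 ^ j. (N h)\<^sup>2 * (1 / (a j * v j)))"
            by (rule sum.inter_filter[symmetric]) simp
          also have "\<dots> = (N h)\<^sup>2 * (\<Sum>j | j \<le> Suc J \<and> len h \<le> 2 ^ j. 1 / (a j * v j))"
            by (simp add: sum_distrib_left)
          also have "\<dots> \<le> C2 * ((N h)\<^sup>2 * pmf \<nu> h)"
          proof (cases "h = \<one>")
            case True then show ?thesis using N(1) by simp
          next
            case False
            have "(N h)\<^sup>2 * (\<Sum>j | j \<le> Suc J \<and> len h \<le> 2 ^ j. 1 / (a j * v j)) \<le> (N h)\<^sup>2 * (C2 * pmf \<nu> h)"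
              using C2(2)[OF h False, of "Suc J"] unfolding a_def v_def by (rule mult_left_mono) simp
            then show ?thesis by (simp add: mult_ac)
          qed
          finally show "(\<Sum>j\<le>Suc J. if len h \<le> 2 ^ j then (N h)\<^sup>2 * (1 / (a j * v j)) else 0)
              \<le> C2 * ((N h)\<^sup>2 * pmf \<nu> h)" .
        qed
        also have "\<dots> = C2 * (\<Sum>h\<in>ball_len (2 ^ Suc J). (N h)\<^sup>2 * pmf \<nu> h)"
          by (simp add: sum_distrib_left)
        also have "(\<Sum>h\<in>ball_len (2 ^ Suc J). (N h)\<^sup>2 * pmf \<nu> h)
            = measure_pmf.expectation \<nu> (\<lambda>h. (N h)\<^sup>2 * indicator (ball_len (2 ^ Suc J)) h)"
          by (subst integral_measure_pmf_real[where A = "ball_len (2 ^ Suc J)"])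
             (auto simp: indicator_eq_0_iff intro!: sum.cong)
        also have "\<dots> \<le> E"
          unfolding E_def
          by (intro integral_mono integrable_real_mult_indicator intgr)
             (auto split: split_indicator)
        finally show ?thesis using C2(1) by simp
      qed
      then have "16 * C1 * K * 4 ^ J * (\<Sum>j\<le>Suc J. Q j / (a j * v j)) \<le> 16 * C1 * K * 4 ^ J * (C2 * E)"
        using C1(1) K(1) by (intro mult_left_mono) auto
      with main' have main: "dyadic_sum J * (N g)\<^sup>2 \<le> 16 * C1 * K * 4 ^ J * (C2 * E)"
        by (rule order_trans)
      have "W R \<le> W (2 ^ Suc J)" using R J1 by (intro W_mono) auto
      also have "\<dots> \<le> C4 * dyadic_sum J" by (rule C4(2))
      finally have "W R * (N g)\<^sup>2 \<le> C4 * (dyadic_sum J * (N g)\<^sup>2)"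
        using mult_right_mono[of "W R" "C4 * dyadic_sum J" "(N g)\<^sup>2"] by (simp add: mult.assoc)
      also have "\<dots> \<le> C4 * (16 * C1 * K * 4 ^ J * (C2 * E))"
        using main C4(1) by (intro mult_left_mono) auto
      also have "\<dots> = C * E * (2 ^ J)\<^sup>2"
        unfolding two_power_sq by (simp add: C_def)
      also have "\<dots> \<le> C * E * R\<^sup>2"
        using J2 Cpos E0 by (intro mult_left_mono power_mono) auto
      finally show ?thesis
        using W_pos[OF R] by (simp add: scaling_W E_def[symmetric] field_simps)
    qed
  qed
  then show ?thesis using Cpos by blast
qed

text \<open>The shell at scale \<open>2\<^sup>j\<close> has mass of order \<open>1 / \<phi> (2\<^sup>j)\<close> by volume doubling, and
  these masses decay geometrically.\<close>

lemma \<nu>_tail: "\<exists>C>0. \<forall>i. measure_pmf.prob \<nu> {h. 2 ^ i \<le> len h} \<le> C / \<phi> (2 ^ i)"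
proof -
  obtain C0 where C0: "C0 > 0" "\<And>g. g \<in> carrier G \<Longrightarrow> pmf \<nu> g \<le> C0 / (\<phi> (len g) * vol (len g))"
    using \<nu>_upper by blast
  obtain C1 where C1: "C1 \<ge> 1"
    "\<And>s t. 0 \<le> s \<Longrightarrow> 0 \<le> t \<Longrightarrow> s \<le> 2 * t \<Longrightarrow> t \<le> 2 * s \<Longrightarrow> \<phi> s \<le> C1 * \<phi> t"
    using \<phi>_comparable by blast
  obtain K where K: "K \<ge> 1" "\<And>t. t \<ge> 0 \<Longrightarrow> vol (2 * t) \<le> K * vol t" using vol_doubling by blast
  obtain C3 where C3: "C3 > 0" "\<And>i k. (\<Sum>j<k. 1 / \<phi> (2 ^ (i + j))) \<le> C3 / \<phi> (2 ^ i)"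
    using dyadic_reciprocal_sum by blast
  define A where "A j = {h \<in> carrier G. 2 ^ j \<le> len h \<and> len h < 2 ^ Suc j}" for j :: nat
  have A_sub: "A j \<subseteq> ball_len (2 ^ Suc j)" for j by (auto simp: A_def ball_len_def)
  have finA: "finite (A j)" for j using A_sub ball_finite by (rule finite_subset)
  have shell: "measure_pmf.prob \<nu> (A j) \<le> C0 * C1 * K * (1 / \<phi> (2 ^ j))" for j
  proof -
    have p: "\<phi> (2 ^ j) > 0" "vol (2 ^ j) > 0" using \<phi>_pos vol_pos by auto
    have "measure_pmf.prob \<nu> (A j) = (\<Sum>h\<in>A j. pmf \<nu> h)" by (rule measure_measure_pmf_finite[OF finA])
    also have "\<dots> \<le> (\<Sum>h\<in>A j. C0 * C1 / (\<phi> (2 ^ j) * vol (2 ^ j)))"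
    proof (rule sum_mono)
      fix h assume "h \<in> A j"
      then have h: "h \<in> carrier G" "2 ^ j \<le> len h" "len h < 2 * 2 ^ j" by (auto simp: A_def)
      have ph: "\<phi> (len h) > 0" "vol (len h) > 0" using \<phi>_pos vol_pos by auto
      have "\<phi> (2 ^ j) \<le> C1 * \<phi> (len h)" using h by (intro C1(2)) auto
      moreover have "vol (2 ^ j) \<le> vol (len h)" using h by (intro vol_mono)
      ultimately have "\<phi> (2 ^ j) * vol (2 ^ j) \<le> C1 * \<phi> (len h) * vol (len h)"
        using p ph by (intro mult_mono) auto
      then have "C0 * (\<phi> (2 ^ j) * vol (2 ^ j)) \<le> C0 * (C1 * \<phi> (len h) * vol (len h))"
        using C0(1) by (intro mult_left_mono) auto
      then have "C0 / (\<phi> (len h) * vol (len h)) \<le> C0 * C1 / (\<phi> (2 ^ j) * vol (2 ^ j))"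
        using p ph by (simp add: field_simps)
      then show "pmf \<nu> h \<le> C0 * C1 / (\<phi> (2 ^ j) * vol (2 ^ j))" using C0(2)[OF h(1)] by simp
    qed
    also have "\<dots> = real (card (A j)) * (C0 * C1 / (\<phi> (2 ^ j) * vol (2 ^ j)))" by simp
    also have "\<dots> \<le> (K * vol (2 ^ j)) * (C0 * C1 / (\<phi> (2 ^ j) * vol (2 ^ j)))"
    proof (rule mult_right_mono)
      have "real (card (A j)) \<le> vol (2 ^ Suc j)" unfolding vol_eq using A_sub by (simp add: card_mono)
      also have "\<dots> \<le> K * vol (2 ^ j)" using K(2)[of "2 ^ j"] by simp
      finally show "real (card (A j)) \<le> K * vol (2 ^ j)" .
    qed (use p C0(1) C1(1) in auto)
    also have "\<dots> = C0 * C1 * K * (1 / \<phi> (2 ^ j))" using p by (simp add: field_simps)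
    finally show ?thesis .
  qed
  define D where "D = C0 * C1 * K * C3"
  have "measure_pmf.prob \<nu> {h. 2 ^ i \<le> len h} \<le> D / \<phi> (2 ^ i)" for i
  proof -
    have bnd: "(\<Sum>k<n. measure_pmf.prob \<nu> (A (i + k))) \<le> D / \<phi> (2 ^ i)" for n
    proof -
      have "(\<Sum>k<n. measure_pmf.prob \<nu> (A (i + k))) \<le> (\<Sum>k<n. C0 * C1 * K * (1 / \<phi> (2 ^ (i + k))))"
        by (intro sum_mono shell)
      also have "\<dots> = C0 * C1 * K * (\<Sum>k<n. 1 / \<phi> (2 ^ (i + k)))" by (simp add: sum_distrib_left)
      also have "\<dots> \<le> C0 * C1 * K * (C3 / \<phi> (2 ^ i))" using C0(1) C1(1) K(1) by (intro mult_left_mono C3) auto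
      finally show ?thesis by (simp add: D_def)
    qed
    have summ: "summable (\<lambda>k. measure_pmf.prob \<nu> (A (i + k)))"
      using bnd by (intro summableI_nonneg_bounded) auto
    have "measure_pmf.prob \<nu> {h. 2 ^ i \<le> len h} = measure_pmf.prob \<nu> ({h. 2 ^ i \<le> len h} \<inter> set_pmf \<nu>)"
      by (rule measure_Int_set_pmf[symmetric])
    also have "\<dots> \<le> measure_pmf.prob \<nu> (\<Union>k. A (i + k))"
    proof (rule measure_pmf.finite_measure_mono)
      show "{h. 2 ^ i \<le> len h} \<inter> set_pmf \<nu> \<subseteq> (\<Union>k. A (i + k))"
      proof
        fix h assume "h \<in> {h. 2 ^ i \<le> len h} \<inter> set_pmf \<nu>"
        then have h: "h \<in> carrier G" "2 ^ i \<le> len h" using \<nu>_sym by (auto simp: symmetric_prob_def)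
        have "1 \<le> len h" using h(2) one_le_power[of "2::real" i] by linarith
        then obtain j where j: "2 ^ j \<le> len h" "len h < 2 ^ Suc j" using dyadic_bracket by blast
        have "(2::real) ^ i < 2 ^ Suc j" using h(2) j(2) by linarith
        then have "i < Suc j" by (rule power_less_imp_less_exp[rotated]) simp
        then have "j = i + (j - i)" by simp
        moreover have "h \<in> A j" using h j by (simp add: A_def)
        ultimately show "h \<in> (\<Union>k. A (i + k))" by (metis UNIV_I UN_I)
      qed
    qed simp
    also have "\<dots> \<le> (\<Sum>k. measure_pmf.prob \<nu> (A (i + k)))"
      using summ by (intro measure_pmf.finite_measure_subadditive_countably) auto
    also have "\<dots> \<le> D / \<phi> (2 ^ i)" using summ bnd by (rule suminf_le_const)
    finally show ?thesis .
  qed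
  moreover have "D > 0" using C0(1) C1(1) K(1) C3(1) by (simp add: D_def)
  ultimately show ?thesis by blast
qed

text \<open>By layers, \<open>min 1 (|h|\<^sup>2 / L\<^sup>2)\<close> is at most a multiple of
  \<open>\<Sum> 4\<^sup>j / L\<^sup>2\<close> over the dyadic scales \<open>2\<^sup>j \<le> min |h| L\<close>, so the tail bound suffices.\<close>

lemma truncated_second_moment:
  "\<exists>C>0. \<forall>L\<ge>1. measure_pmf.expectation \<nu> (\<lambda>h. min 1 ((len h)\<^sup>2 / L\<^sup>2)) \<le> C / scaling \<phi> L"
proof -
  obtain D where D: "D > 0" "\<And>i. measure_pmf.prob \<nu> {h. 2 ^ i \<le> len h} \<le> D / \<phi> (2 ^ i)"
    using \<nu>_tail by blast
  obtain C5 where C5: "C5 > 0" "\<And>J. dyadic_sum J \<le> C5 * W (2 ^ J)" using dyadic_sum_le_W by blast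
  have "measure_pmf.expectation \<nu> (\<lambda>h. min 1 ((len h)\<^sup>2 / L\<^sup>2)) \<le> 16 * D * C5 / scaling \<phi> L"
    if L: "L \<ge> 1" for L
  proof -
    obtain J where J2: "2 ^ J \<le> L" and J1: "L < 2 ^ Suc J" using dyadic_bracket[OF L] by blast
    define F where "F h = (\<Sum>j\<le>J. 4 * 4 ^ j / 4 ^ J * indicator {h. 2 ^ j \<le> len h} h :: real)" for h :: 'a
    have F_ge: "4 * 4 ^ j / 4 ^ J \<le> F h" if "j \<le> J" "2 ^ j \<le> len h" for j h
    proof -
      have "4 * 4 ^ j / 4 ^ J * indicator {h. 2 ^ j \<le> len h} h \<le> F h"
        unfolding F_def using that by (intro member_le_sum) auto
      then show ?thesis using that by simp
    qed
    have F0: "F h \<ge> 0" for h unfolding F_def by (intro sum_nonneg) auto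
    have bound: "min 1 ((len h)\<^sup>2 / L\<^sup>2) \<le> F h" if h: "h \<in> carrier G" for h
    proof (cases "len h < 1")
      case True
      then have "h = \<one>" using h len_lt_1 by auto
      then show ?thesis using F0 by simp
    next
      case False
      then obtain i where i2: "2 ^ i \<le> len h" and i1: "len h < 2 ^ Suc i"
        using dyadic_bracket[of "len h"] by force
      show ?thesis
      proof (cases "i \<le> J")
        case True
        have "(len h)\<^sup>2 / L\<^sup>2 \<le> (2 ^ Suc i)\<^sup>2 / (2 ^ J)\<^sup>2"
          using i1 J2 L by (intro frac_le power_mono) auto
        also have "\<dots> = 4 * 4 ^ i / 4 ^ J" unfolding two_power_sq by simp
        also have "\<dots> \<le> F h" using True i2 by (rule F_ge)
        finally show ?thesis by simp
      next
        case False
        then have "(2::real) ^ J \<le> 2 ^ i" by (intro power_increasing) auto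
        then have "2 ^ J \<le> len h" using i2 by linarith
        then have "4 * 4 ^ J / 4 ^ J \<le> F h" by (intro F_ge) auto
        then show ?thesis by simp
      qed
    qed
    have "measure_pmf.expectation \<nu> (\<lambda>h. min 1 ((len h)\<^sup>2 / L\<^sup>2)) \<le> measure_pmf.expectation \<nu> F"
    proof (rule integral_mono_AE)
      show "integrable (measure_pmf \<nu>) (\<lambda>h. min 1 ((len h)\<^sup>2 / L\<^sup>2))"
        by (rule measure_pmf.integrable_const_bound[where B = 1]) auto
      show "integrable (measure_pmf \<nu>) F"
        unfolding F_def
        by (intro Bochner_Integration.integrable_sum integrable_mult_right integrable_indicator_pmf)
      show "AE h in measure_pmf \<nu>. min 1 ((len h)\<^sup>2 / L\<^sup>2) \<le> F h"
        using bound \<nu>_sym by (auto simp: AE_measure_pmf_iff symmetric_prob_def)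
    qed
    also have "\<dots> = (\<Sum>j\<le>J. 4 * 4 ^ j / 4 ^ J * measure_pmf.prob \<nu> {h. 2 ^ j \<le> len h})"
    proof -
      have "measure_pmf.expectation \<nu> F
          = (\<Sum>j\<le>J. measure_pmf.expectation \<nu> (\<lambda>h. 4 * 4 ^ j / 4 ^ J * indicator {h. 2 ^ j \<le> len h} h))"
        unfolding F_def
        by (intro Bochner_Integration.integral_sum integrable_mult_right integrable_indicator_pmf)
      then show ?thesis by simp
    qed
    also have "\<dots> \<le> (\<Sum>j\<le>J. 4 * 4 ^ j / 4 ^ J * (D / \<phi> (2 ^ j)))"
      by (intro sum_mono mult_left_mono D) auto
    also have "\<dots> = 4 * D / 4 ^ J * dyadic_sum J"
      by (simp add: dyadic_sum_def sum_distrib_left mult_ac)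
    also have "\<dots> \<le> 4 * D / 4 ^ J * (C5 * W L)"
    proof -
      have "dyadic_sum J \<le> C5 * W (2 ^ J)" by (rule C5)
      also have "\<dots> \<le> C5 * W L" using C5(1) J2 by (intro mult_left_mono W_mono) auto
      finally show ?thesis using D(1) by (intro mult_left_mono) auto
    qed
    also have "\<dots> \<le> 16 * D * C5 / scaling \<phi> L"
    proof -
      have "L\<^sup>2 \<le> (2 ^ Suc J)\<^sup>2" using J1 L by (intro power_mono) auto
      then have "L\<^sup>2 \<le> 4 * 4 ^ J" unfolding two_power_sq by simp
      then have "4 * D * C5 * W L * L\<^sup>2 \<le> 4 * D * C5 * W L * (4 * 4 ^ J)"
        using D(1) C5(1) W_pos[of L] L by (intro mult_left_mono) auto
      then show ?thesis using W_pos[of L] L by (simp add: scaling_W field_simps)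
    qed
    finally show ?thesis .
  qed
  moreover have "16 * D * C5 > 0" using D(1) C5(1) by simp
  ultimately show ?thesis by blast
qed

end

section \<open>Convolution and collision probabilities\<close>

context group
begin

text \<open>One step of \<open>conv_power\<close> written as a monadic bind, so that associativity and exchange of
  independent samples are instances of the monad laws.\<close>

definition conv :: "'a pmf \<Rightarrow> 'a pmf \<Rightarrow> 'a pmf" where
  "conv p q = bind_pmf p (\<lambda>x. map_pmf (\<lambda>y. x \<otimes> y) q)"

definition translate :: "'a \<Rightarrow> 'a pmf \<Rightarrow> 'a pmf" where
  "translate h p = map_pmf (\<lambda>x. x \<otimes> h) p"

text \<open>The \<open>\<ell>\<^sup>2\<close> inner product of two probability mass functions is the probability that
  independent samples coincide; as a probability it can be computed inside the monad.\<close>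

definition collision :: "'a pmf \<Rightarrow> 'a pmf \<Rightarrow> real" where
  "collision p q = pmf (bind_pmf p (\<lambda>x. map_pmf (\<lambda>y. x = y) q)) True"

definition sq_dist :: "'a pmf \<Rightarrow> 'a pmf \<Rightarrow> real" where
  "sq_dist p q = collision p p - 2 * collision p q + collision q q"

lemma pmf_map_eq_True: "pmf (map_pmf (\<lambda>y. x = y) q) True = pmf q x"
proof -
  have "(\<lambda>y. x = y) -` {True} = {x}" by auto
  then show ?thesis by (simp add: pmf_map measure_pmf_single)
qed

lemma collision_expectation: "collision p q = measure_pmf.expectation p (pmf q)"
  unfolding collision_def pmf_bind pmf_map_eq_True ..

lemma collision_commute: "collision p q = collision q p"
proof -
  have "bind_pmf p (\<lambda>x. map_pmf (\<lambda>y. x = y) q) = bind_pmf q (\<lambda>y. map_pmf (\<lambda>x. y = x) p)"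
    unfolding map_pmf_def by (subst bind_commute_pmf) (simp add: eq_commute)
  then show ?thesis by (simp add: collision_def)
qed

lemma collision_nonneg: "0 \<le> collision p q" and collision_le_1: "collision p q \<le> 1"
  by (simp_all add: collision_def pmf_le_1)

lemma integrable_pmf_mult: "integrable (count_space UNIV) (\<lambda>x. pmf p x * pmf q x)"
  by (rule Bochner_Integration.integrable_bound[OF integrable_pmf[of UNIV p]])
     (auto simp: pmf_le_1 mult_left_le)

lemma collision_sum: "collision p q = (\<integral>x. pmf p x * pmf q x \<partial>count_space UNIV)"
  unfolding collision_expectation measure_pmf_eq_density
  by (subst integral_density) auto

lemma sq_dist_sum: "sq_dist p q = (\<integral>x. (pmf p x - pmf q x)\<^sup>2 \<partial>count_space UNIV)"
proof -
  have eq: "(pmf p x - pmf q x)\<^sup>2 = pmf p x * pmf p x - 2 * (pmf p x * pmf q x) + pmf q x * pmf q x" for x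
    by (simp add: power2_eq_square algebra_simps)
  note i = integrable_pmf_mult
  show ?thesis
    unfolding sq_dist_def collision_sum eq
    by (simp only: i integrable_mult_right Bochner_Integration.integrable_diff
          Bochner_Integration.integral_add Bochner_Integration.integral_diff integral_mult_right_zero)
qed

lemma integrable_sq_diff: "integrable (count_space UNIV) (\<lambda>x. (pmf p x - pmf q x)\<^sup>2)"
proof -
  have eq: "(\<lambda>x. (pmf p x - pmf q x)\<^sup>2) = (\<lambda>x. pmf p x * pmf p x - 2 * (pmf p x * pmf q x) + pmf q x * pmf q x)"
    by (simp add: power2_eq_square algebra_simps)
  show ?thesis unfolding eq
    by (intro integrable_pmf_mult integrable_mult_right Bochner_Integration.integrable_diff Bochner_Integration.integrable_add)
qed

lemma sq_dist_nonneg: "0 \<le> sq_dist p q"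
  unfolding sq_dist_sum by (intro Bochner_Integration.integral_nonneg) auto

lemma sq_dist_triangle: "sqrt (sq_dist p s) \<le> sqrt (sq_dist p q) + sqrt (sq_dist q s)"
proof -
  define a where "a = sqrt (sq_dist p q)"
  define b where "b = sqrt (sq_dist q s)"
  have ab: "a \<ge> 0" "b \<ge> 0" "a\<^sup>2 = sq_dist p q" "b\<^sup>2 = sq_dist q s"
    by (simp_all add: a_def b_def sq_dist_nonneg)
  have weighted: "sq_dist p s \<le> (1 + t) * a\<^sup>2 + (1 + 1 / t) * b\<^sup>2" if t: "t > 0" for t
  proof -
    have pt: "(x - z)\<^sup>2 \<le> (1 + t) * (x - y)\<^sup>2 + (1 + 1 / t) * (y - z)\<^sup>2" for x y z :: real
    proof -
      have "0 \<le> (t * (x - y) - (y - z))\<^sup>2 / t" using t by simp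
      also have "\<dots> = t * (x - y)\<^sup>2 - 2 * (x - y) * (y - z) + (y - z)\<^sup>2 / t"
        using t by (simp add: power2_eq_square field_simps)
      also have "\<dots> = (1 + t) * (x - y)\<^sup>2 + (1 + 1 / t) * (y - z)\<^sup>2 - (x - z)\<^sup>2"
        using t by (simp add: power2_eq_square field_simps)
      finally show ?thesis by simp
    qed
    have "sq_dist p s \<le> (\<integral>x. (1 + t) * (pmf p x - pmf q x)\<^sup>2 + (1 + 1 / t) * (pmf q x - pmf s x)\<^sup>2 \<partial>count_space UNIV)"
      unfolding sq_dist_sum
      by (intro integral_mono integrable_sq_diff Bochner_Integration.integrable_add integrable_mult_right pt)
    also have "\<dots> = (1 + t) * a\<^sup>2 + (1 + 1 / t) * b\<^sup>2"
      unfolding ab sq_dist_sum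
      by (subst Bochner_Integration.integral_add) (auto intro: integrable_sq_diff integrable_mult_right)
    finally show ?thesis .
  qed
  have "sqrt (sq_dist p s) \<le> (a + b) + e" if e: "e > 0" for e
  proof -
    define a' b' where "a' = a + e / 2" and "b' = b + e / 2"
    have p: "a' > 0" "b' > 0" "a \<le> a'" "b \<le> b'" using ab e by (auto simp: a'_def b'_def)
    have "sq_dist p s \<le> (1 + b' / a') * a\<^sup>2 + (1 + 1 / (b' / a')) * b\<^sup>2"
      using p by (intro weighted) auto
    also have "\<dots> \<le> (1 + b' / a') * a'\<^sup>2 + (1 + 1 / (b' / a')) * b'\<^sup>2"
      using p ab by (intro add_mono mult_left_mono power_mono) auto
    also have "\<dots> = (a' + b')\<^sup>2" using p by (simp add: power2_eq_square field_simps)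
    finally have "sqrt (sq_dist p s) \<le> a' + b'" using p by (intro real_le_lsqrt) (auto simp: sq_dist_nonneg)
    then show ?thesis by (simp add: a'_def b'_def)
  qed
  then show ?thesis unfolding a_def b_def by (rule field_le_epsilon)
qed

subsection \<open>The group structure\<close>

definition on_group :: "'a pmf \<Rightarrow> bool" where "on_group p \<longleftrightarrow> set_pmf p \<subseteq> carrier G"

lemma on_group_conv [intro]: "on_group p \<Longrightarrow> on_group q \<Longrightarrow> on_group (conv p q)"
  by (auto simp: on_group_def conv_def)

lemma on_group_translate [intro]: "on_group p \<Longrightarrow> h \<in> carrier G \<Longrightarrow> on_group (translate h p)"
  by (auto simp: on_group_def translate_def)

lemma on_group_return [intro]: "h \<in> carrier G \<Longrightarrow> on_group (return_pmf h)"
  by (auto simp: on_group_def)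

lemma on_groupD: "on_group p \<Longrightarrow> x \<in> set_pmf p \<Longrightarrow> x \<in> carrier G"
  by (auto simp: on_group_def)

lemma conv_eq_bind: "conv p q = bind_pmf q (\<lambda>h. translate h p)"
  unfolding conv_def translate_def map_pmf_def by (rule bind_commute_pmf)

lemma conv_assoc:
  assumes "on_group p" "on_group q" "on_group s"
  shows "conv (conv p q) s = conv p (conv q s)"
  unfolding conv_def map_pmf_def bind_assoc_pmf bind_return_pmf
  by (intro bind_pmf_cong refl) (use assms in \<open>auto simp: on_group_def m_assoc subset_iff\<close>)

lemma conv_one: "on_group p \<Longrightarrow> conv p (return_pmf \<one>) = p"
  unfolding conv_def map_pmf_def bind_return_pmf
  by (subst bind_pmf_cong[OF refl, where g = return_pmf]) (auto simp: on_group_def bind_return_pmf')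

lemma one_conv: "on_group p \<Longrightarrow> conv (return_pmf \<one>) p = p"
  unfolding conv_def map_pmf_def bind_return_pmf
  by (subst bind_pmf_cong[OF refl, where g = return_pmf]) (auto simp: on_group_def bind_return_pmf')

lemma conv_power_Suc: "conv_power G p (Suc n) = conv (conv_power G p n) p"
  by (simp add: conv_def pair_pmf_def map_pmf_def bind_assoc_pmf bind_return_pmf)

lemma on_group_conv_power [intro]: "on_group p \<Longrightarrow> on_group (conv_power G p n)"
  by (induction n) (auto simp: conv_power_Suc simp del: conv_power.simps(2))

lemma conv_power_add:
  assumes "on_group p"
  shows "conv (conv_power G p m) (conv_power G p n) = conv_power G p (m + n)"
proof (induction n)
  case 0
  then show ?case using assms by (simp add: conv_one on_group_conv_power)
next
  case (Suc n)
  then show ?case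
    using assms by (simp add: conv_power_Suc conv_assoc[symmetric] on_group_conv_power del: conv_power.simps(2))
qed

lemma conv_power_1: "on_group p \<Longrightarrow> conv_power G p (Suc 0) = p"
  by (simp add: conv_power_Suc one_conv del: conv_power.simps(2))

lemma pmf_conv_left:
  assumes "on_group p" "on_group q" "g \<in> carrier G"
  shows "pmf (conv p q) g = measure_pmf.expectation p (\<lambda>x. pmf q (inv x \<otimes> g))"
  unfolding conv_def pmf_bind
proof (rule Bochner_Integration.integral_cong_AE)
  show "AE x in measure_pmf p. pmf (map_pmf (\<lambda>y. x \<otimes> y) q) g = pmf q (inv x \<otimes> g)"
  proof (rule AE_pmfI)
    fix x assume "x \<in> set_pmf p"
    then have x: "x \<in> carrier G" using assms(1) by (auto simp: on_group_def)
    have "pmf (map_pmf (\<lambda>y. x \<otimes> y) q) g = measure_pmf.prob q ((\<lambda>y. x \<otimes> y) -` {g})" by (rule pmf_map)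
    also have "\<dots> = measure_pmf.prob q ({inv x \<otimes> g})"
    proof (rule measure_pmf.finite_measure_eq_AE)
      show "AE y in measure_pmf q. (y \<in> (\<lambda>y. x \<otimes> y) -` {g}) = (y \<in> {inv x \<otimes> g})"
      proof (rule AE_pmfI)
        fix y assume "y \<in> set_pmf q"
        then have "y \<in> carrier G" using assms(2) by (auto simp: on_group_def)
        then show "(y \<in> (\<lambda>y. x \<otimes> y) -` {g}) = (y \<in> {inv x \<otimes> g})"
          using x assms(3) by (auto simp: inv_solve_left m_assoc[symmetric])
      qed
    qed auto
    finally show "pmf (map_pmf (\<lambda>y. x \<otimes> y) q) g = pmf q (inv x \<otimes> g)" by (simp add: measure_pmf_single)
  qed
qed auto

lemma pmf_conv_ge_sum:
  assumes "on_group p" "on_group q" "g \<in> carrier G" "finite A" "A \<subseteq> carrier G"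
  shows "(\<Sum>x\<in>A. pmf p x * pmf q (inv x \<otimes> g)) \<le> pmf (conv p q) g"
proof -
  have "(\<Sum>x\<in>A. pmf p x * pmf q (inv x \<otimes> g)) =
      measure_pmf.expectation p (\<lambda>x. pmf q (inv x \<otimes> g) * indicator A x)"
    using assms(4) by (subst integral_measure_pmf_real[where A = A])
      (auto simp: indicator_eq_0_iff mult.commute intro!: sum.cong)
  also have "\<dots> \<le> measure_pmf.expectation p (\<lambda>x. pmf q (inv x \<otimes> g))"
    by (intro integral_mono measure_pmf.integrable_const_bound[where B = 1])
       (auto split: split_indicator simp: pmf_le_1)
  also have "\<dots> = pmf (conv p q) g" using assms by (simp add: pmf_conv_left)
  finally show ?thesis .
qed

lemma translate_mult:
  "on_group p \<Longrightarrow> g \<in> carrier G \<Longrightarrow> h \<in> carrier G \<Longrightarrow> translate h (translate g p) = translate (g \<otimes> h) p"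
  unfolding translate_def map_pmf_comp by (intro map_pmf_cong) (auto simp: on_group_def m_assoc subset_iff)

lemma translate_one: "on_group p \<Longrightarrow> translate \<one> p = p"
  unfolding translate_def by (subst map_pmf_cong[OF refl, where g = id]) (auto simp: on_group_def pmf.map_id)

lemma collision_translate:
  assumes "on_group p" "on_group q" "h \<in> carrier G"
  shows "collision (translate h p) (translate h q) = collision p q"
  unfolding collision_def translate_def bind_map_pmf map_pmf_comp
  by (intro arg_cong[where f = "\<lambda>r. pmf r True"] bind_pmf_cong refl map_pmf_cong)
     (use assms in \<open>auto simp: on_group_def subset_iff\<close>)

lemma sq_dist_translate:
  "on_group p \<Longrightarrow> on_group q \<Longrightarrow> h \<in> carrier G \<Longrightarrow> sq_dist (translate h p) (translate h q) = sq_dist p q"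
  by (simp add: sq_dist_def collision_translate)

lemma collision_conv: "collision q (conv p s) = measure_pmf.expectation s (\<lambda>h. collision q (translate h p))"
proof -
  have "bind_pmf q (\<lambda>x. map_pmf (\<lambda>y. x = y) (conv p s)) =
      bind_pmf s (\<lambda>h. bind_pmf q (\<lambda>x. map_pmf (\<lambda>y. x = y) (translate h p)))"
    unfolding conv_eq_bind map_bind_pmf by (rule bind_commute_pmf)
  then show ?thesis unfolding collision_def by (simp only: pmf_bind)
qed

lemma collision_conv_self_adjoint:
  assumes "on_group p" "on_group q" "on_group s" "map_pmf (m_inv G) s = s"
  shows "collision (conv p s) q = collision p (conv q s)"
proof -
  have "bind_pmf (conv p s) (\<lambda>x. map_pmf (\<lambda>y. x = y) q)
      = bind_pmf s (\<lambda>h. bind_pmf p (\<lambda>x. map_pmf (\<lambda>y. x \<otimes> h = y) q))"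
    by (simp add: conv_eq_bind translate_def bind_assoc_pmf bind_map_pmf)
  also have "\<dots> = bind_pmf (map_pmf (m_inv G) s) (\<lambda>h. bind_pmf p (\<lambda>x. map_pmf (\<lambda>y. x \<otimes> h = y) q))"
    by (simp add: assms(4))
  also have "\<dots> = bind_pmf s (\<lambda>h. bind_pmf p (\<lambda>x. map_pmf (\<lambda>y. x \<otimes> inv h = y) q))"
    by (simp add: bind_map_pmf)
  also have "\<dots> = bind_pmf s (\<lambda>h. bind_pmf p (\<lambda>x. map_pmf (\<lambda>y. x = y \<otimes> h) q))"
  proof (intro bind_pmf_cong refl map_pmf_cong)
    fix h x y assume "h \<in> set_pmf s" "x \<in> set_pmf p" "y \<in> set_pmf q"
    then have "h \<in> carrier G" "x \<in> carrier G" "y \<in> carrier G" using assms by (auto simp: on_group_def)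
    then show "(x \<otimes> inv h = y) = (x = y \<otimes> h)" by (metis inv_closed inv_solve_right m_closed inv_inv)
  qed
  also have "\<dots> = bind_pmf p (\<lambda>x. map_pmf (\<lambda>y. x = y) (conv q s))"
    unfolding conv_eq_bind map_bind_pmf translate_def map_pmf_comp by (rule bind_commute_pmf)
  finally show ?thesis by (simp add: collision_def)
qed

lemma symmetric_map_inv:
  assumes "symmetric_prob G p" shows "map_pmf (m_inv G) p = p"
proof (rule pmf_eqI)
  fix x
  have on: "set_pmf p \<subseteq> carrier G" using assms by (simp add: symmetric_prob_def)
  show "pmf (map_pmf (m_inv G) p) x = pmf p x"
  proof (cases "x \<in> carrier G")
    case True
    have "pmf (map_pmf (m_inv G) p) x = measure_pmf.prob p (m_inv G -` {x})" by (rule pmf_map)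
    also have "\<dots> = measure_pmf.prob p {inv x}"
      by (rule measure_pmf.finite_measure_eq_AE) (use on True in \<open>auto intro!: AE_pmfI\<close>)
    also have "\<dots> = pmf p (inv x)" by (rule measure_pmf_single)
    also have "\<dots> = pmf p x" using assms True unfolding symmetric_prob_def by metis
    finally show ?thesis .
  next
    case False
    then have "x \<notin> set_pmf p" "x \<notin> set_pmf (map_pmf (m_inv G) p)" using on by auto
    then show ?thesis unfolding pmf_eq_0_set_pmf[symmetric] by simp
  qed
qed

lemma map_inv_conv:
  assumes "on_group p" "on_group q"
  shows "map_pmf (m_inv G) (conv p q) = conv (map_pmf (m_inv G) q) (map_pmf (m_inv G) p)"
proof -
  have "map_pmf (m_inv G) (conv p q) = bind_pmf q (\<lambda>y. map_pmf (\<lambda>x. inv (x \<otimes> y)) p)"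
    unfolding conv_eq_bind translate_def map_bind_pmf map_pmf_comp ..
  also have "\<dots> = bind_pmf q (\<lambda>y. map_pmf (\<lambda>x. inv y \<otimes> inv x) p)"
    by (intro bind_pmf_cong refl map_pmf_cong) (use assms in \<open>auto simp: on_group_def subset_iff inv_mult_group\<close>)
  also have "\<dots> = conv (map_pmf (m_inv G) q) (map_pmf (m_inv G) p)"
    unfolding conv_def bind_map_pmf map_pmf_comp ..
  finally show ?thesis .
qed

lemma collision_translate_eq_conv:
  assumes "on_group p" "on_group q" "h \<in> carrier G"
  shows "collision p (translate h q) = pmf (conv (map_pmf (m_inv G) q) p) h"
proof -
  have "map_pmf (\<lambda>z. h = z) (conv (map_pmf (m_inv G) q) p)
      = bind_pmf q (\<lambda>y. map_pmf (\<lambda>x. h = inv y \<otimes> x) p)"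
    unfolding conv_def bind_map_pmf map_bind_pmf map_pmf_comp ..
  also have "\<dots> = bind_pmf q (\<lambda>y. map_pmf (\<lambda>x. x = y \<otimes> h) p)"
  proof (intro bind_pmf_cong refl map_pmf_cong)
    fix x y assume "x \<in> set_pmf p" "y \<in> set_pmf q"
    then have "x \<in> carrier G" "y \<in> carrier G" using assms by (auto simp: on_group_def)
    then show "(h = inv y \<otimes> x) = (x = y \<otimes> h)" using assms(3) by (metis inv_solve_left inv_closed)
  qed
  also have "\<dots> = bind_pmf p (\<lambda>x. map_pmf (\<lambda>y. x = y) (translate h q))"
    unfolding translate_def map_pmf_comp unfolding map_pmf_def by (rule bind_commute_pmf)
  finally show ?thesis by (metis pmf_map_eq_True collision_def)
qed

subsection \<open>Translation seminorm\<close>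

text \<open>\<open>shift_norm m h\<close> is \<open>\<parallel>m - m(\<cdot> h)\<parallel>\<^sub>2\<close>.\<close>

definition shift_norm :: "'a pmf \<Rightarrow> 'a \<Rightarrow> real" where
  "shift_norm m h = sqrt (sq_dist m (translate h m))"

lemma shift_norm_sq:
  assumes "on_group m" "h \<in> carrier G"
  shows "(shift_norm m h)\<^sup>2 = 2 * (collision m m - collision m (translate h m))"
  using assms sq_dist_nonneg[of m "translate h m"]
  by (simp add: shift_norm_def sq_dist_def collision_translate)

lemma collision_translate_le: 
  "on_group m \<Longrightarrow> h \<in> carrier G \<Longrightarrow> collision m (translate h m) \<le> collision m m"
  using shift_norm_sq[of m h] zero_le_power2[of "shift_norm m h"] by simp

lemma shift_norm_nonneg: "0 \<le> shift_norm m h"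
  by (simp add: shift_norm_def sq_dist_nonneg)

lemma shift_norm_one: "on_group m \<Longrightarrow> shift_norm m \<one> = 0"
  by (simp add: shift_norm_def translate_one sq_dist_def)

lemma shift_norm_le_2:
  assumes "on_group m" "h \<in> carrier G" shows "shift_norm m h \<le> 2"
proof (rule power2_le_imp_le)
  show "(shift_norm m h)\<^sup>2 \<le> 2\<^sup>2"
    using shift_norm_sq[OF assms] collision_le_1[of m m] collision_nonneg[of m "translate h m"] by simp
qed simp

lemma shift_norm_mult:
  assumes "on_group m" "g \<in> carrier G" "h \<in> carrier G"
  shows "shift_norm m (g \<otimes> h) \<le> shift_norm m g + shift_norm m h"
proof -
  have "shift_norm m (g \<otimes> h) = sqrt (sq_dist m (translate h (translate g m)))"
    using assms by (simp add: shift_norm_def translate_mult)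
  also have "\<dots> \<le> sqrt (sq_dist m (translate h m)) + sqrt (sq_dist (translate h m) (translate h (translate g m)))"
    by (rule sq_dist_triangle)
  also have "sq_dist (translate h m) (translate h (translate g m)) = sq_dist m (translate g m)"
    using assms by (intro sq_dist_translate) auto
  finally show ?thesis by (simp add: shift_norm_def)
qed

lemma sq_dist_commute: "sq_dist p q = sq_dist q p"
  by (simp add: sq_dist_def collision_commute[of p q])

lemma shift_norm_inv:
  assumes "on_group m" "h \<in> carrier G" shows "shift_norm m (inv h) = shift_norm m h"
proof -
  have "sq_dist m (translate (inv h) m) = sq_dist (translate h m) (translate h (translate (inv h) m))"
    using assms by (intro sq_dist_translate[symmetric]) auto
  also have "translate h (translate (inv h) m) = m"
    using assms by (simp add: translate_mult translate_one)
  finally show ?thesis by (simp add: shift_norm_def sq_dist_commute)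
qed

subsection \<open>Correlations along a symmetric walk\<close>

lemma conv_power_inv:
  assumes "symmetric_prob G p"
  shows "map_pmf (m_inv G) (conv_power G p n) = conv_power G p n"
proof (induction n)
  case 0 then show ?case by simp
next
  case (Suc n)
  have on: "on_group p" using assms unfolding symmetric_prob_def on_group_def by blast
  have "map_pmf (m_inv G) (conv_power G p (Suc n)) = conv p (conv_power G p n)"
    unfolding conv_power_Suc using on by (subst map_inv_conv) (auto simp: Suc symmetric_map_inv[OF assms])
  also have "\<dots> = conv (conv_power G p (Suc 0)) (conv_power G p n)" using on by (simp only: conv_power_1)
  also have "\<dots> = conv_power G p (Suc n)" using on by (subst conv_power_add) auto
  finally show ?case .
qed

text \<open>The sequence \<open>k \<mapsto> \<langle>m, m \<star> \<mu>\<^sup>k\<rangle>\<close> behaves like the moments of a measure on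
  \<open>[-1, 1]\<close>.  This is made elementary by \<open>autocorr_convex\<close> below, which expresses that
  \<open>\<parallel>m \<star> \<mu>\<^sup>j - m \<star> \<mu>\<^sup>k\<parallel>\<^sub>2\<^sup>2\<close> is nonnegative.\<close>

definition autocorr :: "'a pmf \<Rightarrow> 'a pmf \<Rightarrow> nat \<Rightarrow> real" where
  "autocorr p m k = collision m (conv m (conv_power G p k))"

lemma collision_conv_powers:
  assumes p: "symmetric_prob G p" and m: "on_group m"
  shows "collision (conv m (conv_power G p j)) (conv m (conv_power G p k)) = autocorr p m (j + k)"
proof -
  have on: "on_group p" using p unfolding symmetric_prob_def on_group_def by blast
  have "collision (conv m (conv_power G p j)) (conv m (conv_power G p k))
      = collision m (conv (conv m (conv_power G p k)) (conv_power G p j))"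
    using on m by (intro collision_conv_self_adjoint conv_power_inv[OF p]) auto
  also have "conv (conv m (conv_power G p k)) (conv_power G p j) = conv m (conv_power G p (k + j))"
    using on m by (subst conv_assoc) (auto simp: conv_power_add)
  finally show ?thesis by (simp add: autocorr_def add.commute)
qed

lemma autocorr_convex:
  assumes p: "symmetric_prob G p" and m: "on_group m"
  shows "2 * autocorr p m (j + k) \<le> autocorr p m (j + j) + autocorr p m (k + k)"
  using sq_dist_nonneg[of "conv m (conv_power G p j)" "conv m (conv_power G p k)"]
  by (simp add: sq_dist_def collision_conv_powers[OF assms])

lemma autocorr_0: "on_group m \<Longrightarrow> autocorr p m 0 = collision m m"
  by (simp add: autocorr_def conv_one)

text \<open>Moments on \<open>[-1, 1]\<close> satisfy \<open>1 - x\<^sup>2\<^sup>n \<le> 2 n (1 - x)\<close>: the even sequence is convex, so its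
  first decrement is the largest.\<close>

lemma autocorr_loss_linear:
  assumes p: "symmetric_prob G p" and m: "on_group m"
  shows "autocorr p m 0 - autocorr p m (2 * n) \<le> 2 * real n * (autocorr p m 0 - autocorr p m 1)"
proof -
  define b where "b = autocorr p m"
  have step: "b (2 * k) - b (2 * k + 2) \<le> b 0 - b 2" for k
  proof (induction k)
    case (Suc k)
    have "2 * b (2 * k + 2) \<le> b (2 * k) + b (2 * k + 4)"
    proof -
      have e: "k + (k + 2) = 2 * k + 2" "k + k = 2 * k" "(k + 2) + (k + 2) = 2 * k + 4" by simp_all
      show ?thesis using autocorr_convex[OF assms, of k "k + 2"] unfolding b_def e .
    qed
    moreover have "2 * Suc k = 2 * k + 2" "2 * Suc k + 2 = 2 * k + 4" by simp_all
    ultimately show ?case using Suc by (simp only:)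
  qed (simp add: numeral_2_eq_2)
  have "b 0 - b (2 * n) \<le> real n * (b 0 - b 2)"
  proof (induction n)
    case (Suc n)
    have "2 * Suc n = 2 * n + 2" by simp
    then show ?case using step[of n] Suc by (simp add: algebra_simps)
  qed simp
  also have "real n * (b 0 - b 2) \<le> real n * (2 * (b 0 - b 1))"
    using autocorr_convex[OF assms, of 0 1] unfolding b_def one_add_one add_0
    by (intro mult_left_mono) simp_all
  finally show ?thesis by (simp add: b_def algebra_simps)
qed

lemma autocorr_decreasing:
  assumes p: "symmetric_prob G p" and m: "on_group m"
  shows "autocorr p m (2 * k + 2) \<le> autocorr p m (2 * k)"
proof -
  have on: "on_group p" using p unfolding symmetric_prob_def on_group_def by blast
  define f where "f = conv m (conv_power G p k)"
  have f: "on_group f" using on m by (auto simp: f_def)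
  have "autocorr p m (2 * k + 2) = collision f (conv m (conv_power G p (k + 2)))"
    unfolding f_def collision_conv_powers[OF assms] by (simp add: mult_2)
  also have "conv m (conv_power G p (k + 2)) = conv f (conv_power G p 2)"
    unfolding f_def using on m by (subst conv_assoc) (auto simp: conv_power_add)
  also have "collision f (conv f (conv_power G p 2))
      = measure_pmf.expectation (conv_power G p 2) (\<lambda>h. collision f (translate h f))"
    by (rule collision_conv)
  also have "\<dots> \<le> measure_pmf.expectation (conv_power G p 2) (\<lambda>h. collision f f)"
  proof (rule integral_mono_AE)
    show "AE h in measure_pmf (conv_power G p 2). collision f (translate h f) \<le> collision f f"
      using on f by (intro AE_pmfI collision_translate_le) (auto dest: on_groupD[OF on_group_conv_power])
  qed (auto intro!: measure_pmf.integrable_const_bound[where B = 1] simp: collision_nonneg collision_le_1)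
  also have "\<dots> = autocorr p m (2 * k)"
    unfolding f_def collision_conv_powers[OF assms] by (simp add: mult_2)
  finally show ?thesis .
qed

lemma expectation_shift_norm_sq:
  assumes on: "on_group p" and m: "on_group m"
  shows "measure_pmf.expectation (conv_power G p k) (\<lambda>h. (shift_norm m h)\<^sup>2)
    = 2 * (autocorr p m 0 - autocorr p m k)"
proof -
  have "measure_pmf.expectation (conv_power G p k) (\<lambda>h. (shift_norm m h)\<^sup>2)
      = measure_pmf.expectation (conv_power G p k) (\<lambda>h. 2 * (collision m m - collision m (translate h m)))"
    using shift_norm_sq[OF m] on_groupD[OF on_group_conv_power[OF on]]
    by (intro integral_cong_AE AE_pmfI) auto
  also have "\<dots> = 2 * (collision m m - measure_pmf.expectation (conv_power G p k) (\<lambda>h. collision m (translate h m)))"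
    by (subst integral_mult_right_zero, subst Bochner_Integration.integral_diff)
       (auto intro!: measure_pmf.integrable_const_bound[where B = 1] simp: collision_nonneg collision_le_1)
  also have "measure_pmf.expectation (conv_power G p k) (\<lambda>h. collision m (translate h m)) = autocorr p m k"
    by (simp add: autocorr_def collision_conv)
  finally show ?thesis using m by (simp add: autocorr_0)
qed

text \<open>For the law of the walk itself the correlations are return probabilities.\<close>

lemma collision_walk_translate:
  assumes p: "symmetric_prob G p" and h: "h \<in> carrier G"
  shows "collision (conv_power G p j) (translate h (conv_power G p k)) = pmf (conv_power G p (k + j)) h"
proof -
  have on: "on_group p" using p unfolding symmetric_prob_def on_group_def by blast
  then show ?thesis using h
    by (subst collision_translate_eq_conv) (auto simp: conv_power_inv[OF p] conv_power_add)
qed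

lemma collision_walk:
  assumes p: "symmetric_prob G p"
  shows "collision (conv_power G p j) (conv_power G p k) = pmf (conv_power G p (k + j)) \<one>"
proof -
  have "on_group p" using p unfolding symmetric_prob_def on_group_def by blast
  then have "on_group (conv_power G p k)" by (rule on_group_conv_power)
  then show ?thesis using collision_walk_translate[OF p one_closed, of j k] by (simp add: translate_one)
qed

lemma autocorr_walk:
  assumes p: "symmetric_prob G p"
  shows "autocorr p (conv_power G p n) k = pmf (conv_power G p (2 * n + k)) \<one>"
proof -
  have on: "on_group p" using p unfolding symmetric_prob_def on_group_def by blast
  then show ?thesis
    by (simp add: autocorr_def conv_power_add collision_walk[OF p]) (simp add: mult_2 add_ac)
qed

end

section \<open>Return probabilities and displacement of the walk\<close>

lemma integral_bind_pmf_bounded: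
  fixes f :: "'b \<Rightarrow> real"
  assumes nn: "\<And>x. 0 \<le> f x" and B: "\<And>x. f x \<le> B"
  shows "measure_pmf.expectation (bind_pmf p k) f = measure_pmf.expectation p (\<lambda>x. measure_pmf.expectation (k x) f)"
proof -
  have int: "integrable (measure_pmf q) f" for q :: "'b pmf"
    by (rule measure_pmf.integrable_const_bound[where B = B]) (use nn B in auto)
  have le: "measure_pmf.expectation q f \<le> B" for q :: "'b pmf"
    using B by (intro measure_pmf.integral_le_const int) auto
  have nn': "0 \<le> measure_pmf.expectation q f" for q :: "'b pmf"
    using nn by (intro Bochner_Integration.integral_nonneg) auto
  have int': "integrable (measure_pmf p) (\<lambda>x. measure_pmf.expectation (k x) f)"
    by (rule measure_pmf.integrable_const_bound[where B = B]) (use nn' le in auto)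
  have "ennreal (measure_pmf.expectation (bind_pmf p k) f) = (\<integral>\<^sup>+x. f x \<partial>bind_pmf p k)"
    using nn int by (intro nn_integral_eq_integral[symmetric]) auto
  also have "\<dots> = (\<integral>\<^sup>+x. (\<integral>\<^sup>+y. f y \<partial>k x) \<partial>p)" by simp
  also have "\<dots> = (\<integral>\<^sup>+x. ennreal (measure_pmf.expectation (k x) f) \<partial>p)"
    using nn int by (intro nn_integral_cong nn_integral_eq_integral) auto
  also have "\<dots> = ennreal (measure_pmf.expectation p (\<lambda>x. measure_pmf.expectation (k x) f))"
    using nn' int' by (intro nn_integral_eq_integral) auto
  finally show ?thesis using nn' by (simp add: Bochner_Integration.integral_nonneg)
qed

lemma expectation_ge_atom:
  fixes f :: "'b \<Rightarrow> real"
  assumes nn: "\<And>x. 0 \<le> f x" and B: "\<And>x. f x \<le> B"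
  shows "pmf p a * f a \<le> measure_pmf.expectation p f"
proof -
  have "pmf p a * f a = measure_pmf.expectation p (\<lambda>x. f a * indicator {a} x)"
    by (simp add: measure_pmf_single)
  also have "\<dots> \<le> measure_pmf.expectation p f"
  proof (rule integral_mono)
    show "integrable (measure_pmf p) f"
      by (rule measure_pmf.integrable_const_bound[where B = B]) (use nn B in auto)
  qed (auto split: split_indicator intro: nn integrable_indicator_pmf)
  finally show ?thesis .
qed

context group
begin

declare conv_power.simps(2) [simp del]

lemma expectation_conv:
  fixes f :: "'a \<Rightarrow> real"
  assumes nn: "\<And>x. 0 \<le> f x" and B: "\<And>x. f x \<le> B"
  shows "measure_pmf.expectation (conv p q) f
    = measure_pmf.expectation p (\<lambda>x. measure_pmf.expectation q (\<lambda>y. f (x \<otimes> y)))"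
  unfolding conv_def by (subst integral_bind_pmf_bounded[OF nn B]) simp

lemma prob_conv_ge_left:
  assumes "on_group p"
  shows "pmf q \<one> * measure_pmf.prob p A \<le> measure_pmf.prob (conv p q) A"
proof -
  have "pmf q \<one> * measure_pmf.expectation (translate \<one> p) (indicator A)
      \<le> measure_pmf.expectation q (\<lambda>h. measure_pmf.expectation (translate h p) (indicator A))"
    by (rule expectation_ge_atom[where B = 1]) (simp_all add: measure_pmf.prob_le_1)
  also have "\<dots> = measure_pmf.expectation (conv p q) (indicator A)"
    unfolding conv_eq_bind by (rule integral_bind_pmf_bounded[symmetric, where B = 1]) (auto split: split_indicator)
  finally show ?thesis using assms by (simp add: translate_one)
qed

lemma pmf_translate:
  assumes "on_group p" "x \<in> carrier G" "h \<in> carrier G"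
  shows "pmf (translate h p) x = pmf p (x \<otimes> inv h)"
proof -
  have "pmf (translate h p) x = measure_pmf.prob p ((\<lambda>y. y \<otimes> h) -` {x})"
    unfolding translate_def by (rule pmf_map)
  also have "\<dots> = measure_pmf.prob p {x \<otimes> inv h}"
  proof (rule measure_pmf.finite_measure_eq_AE)
    show "AE y in measure_pmf p. (y \<in> (\<lambda>y. y \<otimes> h) -` {x}) = (y \<in> {x \<otimes> inv h})"
      using assms by (intro AE_pmfI) (auto simp: on_group_def m_assoc subset_iff)
  qed auto
  finally show ?thesis by (simp add: measure_pmf_single)
qed

end

context jump_law
begin

abbreviation \<mu> :: "nat \<Rightarrow> 'a pmf" where "\<mu> \<equiv> conv_power G \<nu>"

lemma on_\<nu>: "on_group \<nu>"
  using \<nu>_sym unfolding symmetric_prob_def on_group_def by blast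

lemma on_\<mu>: "on_group (\<mu> n)"
  by (rule on_group_conv_power[OF on_\<nu>])

lemma \<mu>_Suc: "\<mu> (Suc n) = conv (\<mu> n) \<nu>"
  by (rule conv_power_Suc)

lemma \<mu>_add: "\<mu> (m + n) = conv (\<mu> m) (\<mu> n)"
  by (rule conv_power_add[OF on_\<nu>, symmetric])

lemma \<mu>_1: "\<mu> (Suc 0) = \<nu>"
  by (rule conv_power_1[OF on_\<nu>])

lemma \<mu>_Suc_left: "\<mu> (Suc n) = conv \<nu> (\<mu> n)"
  using \<mu>_add[of "Suc 0" n] unfolding \<mu>_1 by simp

definition \<delta> :: real where "\<delta> = pmf \<nu> \<one>"

lemma \<delta>_pos: "0 < \<delta>" and \<delta>_le_1: "\<delta> \<le> 1"
  using \<nu>_pos[OF one_closed] by (simp_all add: \<delta>_def pmf_le_1)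

text \<open>Return probabilities at even times, which are the squared \<open>\<ell>\<^sup>2\<close> norms of the laws \<open>\<mu> n\<close>.\<close>

definition ret :: "nat \<Rightarrow> real" where "ret n = pmf (\<mu> (2 * n)) \<one>"

lemma ret_nonneg: "0 \<le> ret n" and ret_le_1: "ret n \<le> 1"
  by (simp_all add: ret_def pmf_le_1)

lemma autocorr_start: "autocorr \<nu> (\<mu> 0) k = pmf (\<mu> k) \<one>"
  using autocorr_walk[OF \<nu>_sym, of 0 k] by simp

lemma ret_Suc_le: "ret (Suc n) \<le> ret n"
proof -
  have "2 * Suc n = 2 * n + 2" by simp
  then show ?thesis
    using autocorr_decreasing[OF \<nu>_sym on_\<mu>, of 0 n] unfolding autocorr_start ret_def by metis
qed

lemma ret_convex: "ret (Suc n) - ret (Suc (Suc n)) \<le> ret n - ret (Suc n)"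
proof -
  have e: "n + Suc (Suc n) = 2 * Suc n" "n + n = 2 * n" "Suc (Suc n) + Suc (Suc n) = 2 * Suc (Suc n)"
    by simp_all
  have "autocorr \<nu> (\<mu> 0) (n + n) - 2 * autocorr \<nu> (\<mu> 0) (n + Suc (Suc n))
      + autocorr \<nu> (\<mu> 0) (Suc (Suc n) + Suc (Suc n)) \<ge> 0"
    using autocorr_convex[OF \<nu>_sym on_\<mu>, of 0 n "Suc (Suc n)"] by linarith
  then show ?thesis unfolding e autocorr_start ret_def by linarith
qed

text \<open>Convexity turns a bound on the return probability at time \<open>m\<close> into a bound on its
  decrement at time \<open>m + k\<close>.\<close>

lemma ret_decrement: "real k * (ret (m + k) - ret (Suc (m + k))) \<le> ret m - ret (m + k)"
proof (induction k)
  case (Suc k)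
  have "real (Suc k) * (ret (m + Suc k) - ret (Suc (m + Suc k)))
      \<le> real (Suc k) * (ret (m + k) - ret (Suc (m + k)))"
    using ret_convex[of "m + k"] by (intro mult_left_mono) auto
  also have "\<dots> = real k * (ret (m + k) - ret (Suc (m + k))) + (ret (m + k) - ret (Suc (m + k)))"
    by (simp add: algebra_simps)
  finally show ?case using Suc by simp
qed simp

lemma walk_shift_norm_sq:
  assumes "g \<in> carrier G" shows "(shift_norm (\<mu> n) g)\<^sup>2 = 2 * (ret n - pmf (\<mu> (2 * n)) g)"
proof -
  have e: "n + n = 2 * n" by simp
  show ?thesis
    unfolding shift_norm_sq[OF on_\<mu> assms] collision_walk_translate[OF \<nu>_sym assms]
      collision_walk[OF \<nu>_sym] e ret_def ..
qed

lemma \<mu>_even_le_ret: "g \<in> carrier G \<Longrightarrow> pmf (\<mu> (2 * n)) g \<le> ret n"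
  using walk_shift_norm_sq[of g n] zero_le_power2[of "shift_norm (\<mu> n) g"] by simp

lemma energy: "measure_pmf.expectation \<nu> (\<lambda>h. (shift_norm (\<mu> n) h)\<^sup>2)
    = 2 * (ret n - pmf (\<mu> (Suc (2 * n))) \<one>)"
  using expectation_shift_norm_sq[OF on_\<nu> on_\<mu>, where k = "Suc 0" and n1 = n]
  unfolding \<mu>_1 autocorr_walk[OF \<nu>_sym] by (simp add: ret_def)

lemma shift_norm_sq_le_4: "(shift_norm m h)\<^sup>2 \<le> 4" 
proof -
  have "sq_dist m (translate h m) \<le> 4"
    using collision_le_1[of m m] collision_nonneg[of m "translate h m"] collision_le_1[of "translate h m" "translate h m"]
    by (simp add: sq_dist_def)
  then show ?thesis by (simp add: shift_norm_def sq_dist_nonneg)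
qed

text \<open>Since the walk is lazy, one-step energy is controlled by two-step energy.\<close>

lemma energy_le_decrement: "\<delta> * (ret n - pmf (\<mu> (Suc (2 * n))) \<one>) \<le> ret n - ret (Suc n)"
proof -
  define f where "f h = (shift_norm (\<mu> n) h)\<^sup>2" for h
  have f: "0 \<le> f h" "f h \<le> 4" for h by (simp_all add: f_def shift_norm_sq_le_4)
  have eq: "measure_pmf.expectation \<nu> (\<lambda>y. f (\<one> \<otimes> y)) = measure_pmf.expectation \<nu> f"
    using on_groupD[OF on_\<nu>] by (intro integral_cong_AE AE_pmfI) auto
  have "\<delta> * measure_pmf.expectation \<nu> (\<lambda>y. f (\<one> \<otimes> y))
      \<le> measure_pmf.expectation \<nu> (\<lambda>x. measure_pmf.expectation \<nu> (\<lambda>y. f (x \<otimes> y)))"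
    unfolding \<delta>_def
  proof (rule expectation_ge_atom[where B = 4])
    fix x
    show "0 \<le> measure_pmf.expectation \<nu> (\<lambda>y. f (x \<otimes> y))"
      using f by (intro Bochner_Integration.integral_nonneg) auto
    show "measure_pmf.expectation \<nu> (\<lambda>y. f (x \<otimes> y)) \<le> 4"
      using f by (intro measure_pmf.integral_le_const measure_pmf.integrable_const_bound[where B = 4]) auto
  qed
  also have "\<dots> = measure_pmf.expectation (conv \<nu> \<nu>) f"
    using f by (intro expectation_conv[symmetric])
  also have "conv \<nu> \<nu> = \<mu> 2"
    using \<mu>_Suc[of "Suc 0"] unfolding \<mu>_1 numeral_2_eq_2 by simp
  also have "measure_pmf.expectation (\<mu> 2) f = 2 * (ret n - ret (Suc n))"
    unfolding f_def expectation_shift_norm_sq[OF on_\<nu> on_\<mu>] autocorr_walk[OF \<nu>_sym]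
    by (simp add: ret_def)
  finally show ?thesis unfolding eq unfolding f_def energy by (simp add: algebra_simps)
qed

lemma near_diagonal_oscillation:
  "\<exists>C>0. \<forall>n. \<forall>R>0. \<forall>g\<in>carrier G. len g \<le> R \<longrightarrow>
     ret n - pmf (\<mu> (2 * n)) g \<le> C * scaling \<phi> R * (ret n - ret (Suc n))"
proof -
  obtain C where C: "C > 0" "\<And>N :: 'a \<Rightarrow> real.
     N \<one> = 0 \<and> (\<forall>g\<in>carrier G. 0 \<le> N g \<and> N g \<le> 2 \<and> N (inv g) = N g) \<and>
      (\<forall>g\<in>carrier G. \<forall>h\<in>carrier G. N (g \<otimes> h) \<le> N g + N h) \<Longrightarrow>
     (\<forall>R>0. \<forall>g\<in>carrier G. len g \<le> R \<longrightarrow>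
        (N g)\<^sup>2 \<le> C * scaling \<phi> R * measure_pmf.expectation \<nu> (\<lambda>h. (N h)\<^sup>2))"
    using pseudo_poincare[of 2] by blast
  have "ret n - pmf (\<mu> (2 * n)) g \<le> C / \<delta> * scaling \<phi> R * (ret n - ret (Suc n))"
    if "R > 0" "g \<in> carrier G" "len g \<le> R" for n R g
  proof -
    have "(shift_norm (\<mu> n) g)\<^sup>2
        \<le> C * scaling \<phi> R * measure_pmf.expectation \<nu> (\<lambda>h. (shift_norm (\<mu> n) h)\<^sup>2)"
      using C(2)[of "shift_norm (\<mu> n)"] that
      by (simp add: shift_norm_one shift_norm_nonneg shift_norm_le_2 shift_norm_inv shift_norm_mult on_\<mu>)
    then have "ret n - pmf (\<mu> (2 * n)) g \<le> C * scaling \<phi> R * (ret n - pmf (\<mu> (Suc (2 * n))) \<one>)"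
      unfolding energy walk_shift_norm_sq[OF that(2)] by (simp add: algebra_simps)
    also have "\<dots> \<le> C * scaling \<phi> R * ((ret n - ret (Suc n)) / \<delta>)"
      using energy_le_decrement[of n] \<delta>_pos C(1) scaling_pos[OF that(1)]
      by (intro mult_left_mono) (simp_all add: field_simps)
    finally show ?thesis by (simp add: field_simps)
  qed
  moreover have "C / \<delta> > 0" using C(1) \<delta>_pos by simp
  ultimately show ?thesis by blast
qed

subsection \<open>Displacement\<close>

text \<open>The displacement is tested against the tent of height \<open>L\<close> over a ball, translated on the
  right.  Translates by elements longer than \<open>2 L\<close> are orthogonal to it, whereas translation by
  \<open>h\<close> moves it in \<open>\<ell>\<^sup>2\<close> by at most a multiple of \<open>|h| / L\<close> relative to its norm.  As the
  squared \<open>\<ell>\<^sup>2\<close> displacement grows at most linearly in time, one gets a tail bound for the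
  walk with no truncation of the jumps.\<close>

lemma tent_pmf:
  assumes L: "0 < L"
  shows "\<exists>m. on_group m \<and> 0 < collision m m \<and>
    (\<forall>h\<in>carrier G. 2 * L \<le> len h \<longrightarrow> collision m (translate h m) = 0) \<and>
    (\<forall>h\<in>carrier G. (shift_norm m h)\<^sup>2 \<le> 8 * (vol L / vol (L / 2)) * collision m m * ((len h)\<^sup>2 / L\<^sup>2))"
proof -
  define t where "t x = (if x \<in> carrier G then max 0 (L - len x) else 0)" for x
  define Z where "Z = (\<Sum>x\<in>ball_len L. t x)"
  have t0: "t x \<ge> 0" for x by (simp add: t_def)
  have t_supp: "t x \<noteq> 0 \<Longrightarrow> x \<in> ball_len L" for x by (auto simp: t_def ball_len_def split: if_splits)
  have "t \<one> = L" using L by (simp add: t_def)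
  moreover have "t \<one> \<le> Z"
    unfolding Z_def using L t0 by (intro member_le_sum) (auto intro: one_in_ball)
  ultimately have Z: "Z > 0" using L by simp
  define m where "m = embed_pmf (\<lambda>x. t x / Z)"
  have "(\<integral>\<^sup>+x. ennreal (t x / Z) \<partial>count_space UNIV) = (\<Sum>x\<in>ball_len L. ennreal (t x / Z))"
    by (rule nn_integral_count_space'[OF ball_finite]) (use t_supp in \<open>metis div_0 ennreal_0\<close>, simp)
  also have "\<dots> = ennreal (\<Sum>x\<in>ball_len L. t x / Z)"
    using t0 Z by (intro sum_ennreal) auto
  also have "(\<Sum>x\<in>ball_len L. t x / Z) = 1"
    using Z by (simp add: Z_def sum_divide_distrib[symmetric])
  finally have "pmf m x = t x / Z" for x
    unfolding m_def using t0 Z by (intro pmf_embed_pmf) auto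
  note pm = this
  have set_m: "x \<in> carrier G \<and> len x < L" if "x \<in> set_pmf m" for x
    using that Z by (auto simp: set_pmf_iff pm t_def split: if_splits)
  have on: "on_group m" using set_m by (auto simp: on_group_def)
  define c where "c = collision m m"
  have c_ge: "(L / 2)\<^sup>2 * vol (L / 2) / Z\<^sup>2 \<le> c"
  proof -
    have "(L / 2)\<^sup>2 * vol (L / 2) / Z\<^sup>2 = (\<Sum>x\<in>ball_len (L / 2). (L / 2)\<^sup>2 / Z\<^sup>2)"
      by (simp add: vol_eq)
    also have "\<dots> \<le> (\<Sum>x\<in>ball_len (L / 2). pmf m x * pmf m x)"
    proof (rule sum_mono)
      fix x assume "x \<in> ball_len (L / 2)"
      then have "x \<in> carrier G" "len x \<le> L / 2" by (simp_all add: ball_len_def)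
      then have "t x \<ge> L / 2" by (simp add: t_def max_def)
      then have "(L / 2)\<^sup>2 \<le> (t x)\<^sup>2" using L by (intro power_mono) auto
      then have "(L / 2)\<^sup>2 / Z\<^sup>2 \<le> (t x)\<^sup>2 / Z\<^sup>2" by (intro divide_right_mono) auto
      also have "\<dots> = pmf m x * pmf m x" by (simp add: pm power2_eq_square)
      finally show "(L / 2)\<^sup>2 / Z\<^sup>2 \<le> pmf m x * pmf m x" .
    qed
    also have "\<dots> \<le> (\<Sum>x\<in>ball_len L. pmf m x * pmf m x)"
      using L by (intro sum_mono2 ball_mono) auto
    also have "\<dots> = c"
      unfolding c_def collision_expectation
    proof (rule integral_measure_pmf_real[symmetric])
      show "a \<in> ball_len L" if "a \<in> set_pmf m" for a using set_m[OF that] by (simp add: ball_len_def)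
    qed simp
    finally show ?thesis .
  qed
  have pv: "vol (L / 2) > 0" using L vol_pos by simp
  have c_pos: "c > 0"
    using c_ge L Z pv by (smt (verit) divide_pos_pos mult_pos_pos zero_less_power half_gt_zero)
  have far: "collision m (translate h m) = 0" if h: "h \<in> carrier G" "2 * L \<le> len h" for h
  proof -
    have "collision m (translate h m) = measure_pmf.expectation m (\<lambda>x. 0)"
      unfolding collision_expectation
    proof (intro integral_cong_AE AE_pmfI)
      fix x assume "x \<in> set_pmf m"
      then have x: "x \<in> carrier G" "len x < L" using set_m by auto
      have "len h = len (inv (x \<otimes> inv h) \<otimes> x)"
        using x h by (simp add: inv_mult_group m_assoc)
      also have "\<dots> \<le> len (x \<otimes> inv h) + len x" using x h len_mult[of "inv (x \<otimes> inv h)" x] by simp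
      finally have "t (x \<otimes> inv h) = 0" using h x by (simp add: t_def)
      then show "pmf (translate h m) x = 0" using x h on by (simp add: pmf_translate pm)
    qed auto
    then show ?thesis by simp
  qed
  have near: "(shift_norm m h)\<^sup>2 \<le> 8 * (vol L / vol (L / 2)) * c * ((len h)\<^sup>2 / L\<^sup>2)" if h: "h \<in> carrier G" for h
  proof -
    define A where "A = ball_len L \<union> (\<lambda>x. x \<otimes> h) ` ball_len L"
    have finA: "finite A" by (simp add: A_def)
    have "card A \<le> card (ball_len L) + card ((\<lambda>x. x \<otimes> h) ` ball_len L)"
      unfolding A_def by (rule card_Un_le)
    also have "\<dots> \<le> card (ball_len L) + card (ball_len L)"
      by (intro add_left_mono card_image_le) simp
    finally have cardA: "real (card A) \<le> 2 * vol L" unfolding vol_eq by linarith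
    have pt: "(pmf m x - pmf (translate h m) x)\<^sup>2 \<le> (len h)\<^sup>2 / Z\<^sup>2 * indicator A x" for x
    proof (cases "x \<in> carrier G")
      case False
      then have "x \<notin> set_pmf m" "x \<notin> set_pmf (translate h m)"
        using on on_group_translate[OF on h] by (auto dest: on_groupD)
      then have "pmf m x = 0" "pmf (translate h m) x = 0" by (simp_all add: set_pmf_iff)
      then show ?thesis by simp
    next
      case True
      have eq: "pmf (translate h m) x = t (x \<otimes> inv h) / Z" using True h on by (simp add: pmf_translate pm)
      show ?thesis
      proof (cases "x \<in> A")
        case False
        have "t x = 0" using False t_supp[of x] by (auto simp: A_def)
        moreover have "t (x \<otimes> inv h) = 0"
        proof (rule ccontr)
          assume "t (x \<otimes> inv h) \<noteq> 0"
          then have "x \<otimes> inv h \<in> ball_len L" by (rule t_supp)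
          moreover have "x = (x \<otimes> inv h) \<otimes> h" using True h by (simp add: m_assoc)
          ultimately show False using False unfolding A_def by blast
        qed
        ultimately show ?thesis by (simp add: eq pm)
      next
        case inA: True
        have "len x \<le> len (x \<otimes> inv h) + len h"
          using len_mult[of "x \<otimes> inv h" h] True h by (simp add: m_assoc)
        moreover have "len (x \<otimes> inv h) \<le> len x + len h" using len_mult[of x "inv h"] True h by simp
        ultimately have "\<bar>t x - t (x \<otimes> inv h)\<bar> \<le> len h" using True h by (simp add: t_def)
        then have "(t x - t (x \<otimes> inv h))\<^sup>2 \<le> (len h)\<^sup>2" by (simp add: abs_le_square_iff[symmetric])
        then have "(t x - t (x \<otimes> inv h))\<^sup>2 / Z\<^sup>2 \<le> (len h)\<^sup>2 / Z\<^sup>2" by (intro divide_right_mono) auto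
        then show ?thesis using inA
          by (simp add: eq pm diff_divide_distrib[symmetric] power_divide)
      qed
    qed
    have "(shift_norm m h)\<^sup>2 = sq_dist m (translate h m)"
      by (simp add: shift_norm_def sq_dist_nonneg)
    also have "\<dots> \<le> (\<integral>x. (len h)\<^sup>2 / Z\<^sup>2 * indicator A x \<partial>count_space UNIV)"
      unfolding sq_dist_sum using finA pt
      by (intro integral_mono integrable_sq_diff integrable_mult_right)
         (auto simp: integrable_indicator_iff emeasure_count_space less_top[symmetric])
    also have "\<dots> = (len h)\<^sup>2 / Z\<^sup>2 * real (card A)"
      using finA by (simp add: measure_count_space)
    also have "\<dots> \<le> (len h)\<^sup>2 / Z\<^sup>2 * (2 * vol L)" using cardA by (intro mult_left_mono) auto
    also have "\<dots> = 8 * (vol L / vol (L / 2)) * ((L / 2)\<^sup>2 * vol (L / 2) / Z\<^sup>2) * ((len h)\<^sup>2 / L\<^sup>2)"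
      using L pv Z by (simp add: field_simps power2_eq_square)
    also have "\<dots> \<le> 8 * (vol L / vol (L / 2)) * c * ((len h)\<^sup>2 / L\<^sup>2)"
      using c_ge pv vol_pos[of L] L by (intro mult_right_mono mult_left_mono) auto
    finally show ?thesis .
  qed
  show ?thesis using on c_pos far near unfolding c_def by blast
qed

lemma displacement_tail_scaling:
  "\<exists>C>0. \<forall>L\<ge>1. \<forall>n. measure_pmf.prob (\<mu> n) {g. 2 * L \<le> len g} \<le> C * real n / scaling \<phi> L"
proof -
  obtain K where K: "K \<ge> 1" "\<And>t. t \<ge> 0 \<Longrightarrow> vol (2 * t) \<le> K * vol t" using vol_doubling by blast
  obtain C where C: "C > 0" "\<And>L. L \<ge> 1 \<Longrightarrow>
      measure_pmf.expectation \<nu> (\<lambda>h. min 1 ((len h)\<^sup>2 / L\<^sup>2)) \<le> C / scaling \<phi> L"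
    using truncated_second_moment by blast
  have even: "measure_pmf.prob (\<mu> (2 * k)) {g. 2 * L \<le> len g} \<le> 8 * K * C * real k / scaling \<phi> L"
    if L: "L \<ge> 1" for L k
  proof -
    have "L > 0" using L by simp
    from tent_pmf[OF this] obtain m where m: "on_group m" and cm: "0 < collision m m"
      and far': "\<forall>h\<in>carrier G. 2 * L \<le> len h \<longrightarrow> collision m (translate h m) = 0"
      and near': "\<forall>h\<in>carrier G.
        (shift_norm m h)\<^sup>2 \<le> 8 * (vol L / vol (L / 2)) * collision m m * ((len h)\<^sup>2 / L\<^sup>2)"
      by (elim exE conjE)
    note far = far'[rule_format] and near = near'[rule_format]
    define c where "c = collision m m"
    have c: "c = collision m m" "c > 0" using cm by (simp_all add: c_def)
    have int: "integrable (measure_pmf p) (\<lambda>h. (shift_norm m h)\<^sup>2)" for p :: "'a pmf"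
      by (rule measure_pmf.integrable_const_bound[where B = 4]) (auto simp: shift_norm_sq_le_4)
    have one_step: "measure_pmf.expectation \<nu> (\<lambda>h. (shift_norm m h)\<^sup>2) \<le> 8 * K * c * (C / scaling \<phi> L)"
    proof -
      have "measure_pmf.expectation \<nu> (\<lambda>h. (shift_norm m h)\<^sup>2)
          \<le> measure_pmf.expectation \<nu> (\<lambda>h. 8 * K * c * min 1 ((len h)\<^sup>2 / L\<^sup>2))"
      proof (rule integral_mono_AE)
        show "integrable (measure_pmf \<nu>) (\<lambda>h. 8 * K * c * min 1 ((len h)\<^sup>2 / L\<^sup>2))"
          by (intro integrable_mult_right measure_pmf.integrable_const_bound[where B = 1]) auto
        show "AE h in measure_pmf \<nu>. (shift_norm m h)\<^sup>2 \<le> 8 * K * c * min 1 ((len h)\<^sup>2 / L\<^sup>2)"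
        proof (rule AE_pmfI)
          fix h assume "h \<in> set_pmf \<nu>"
          then have h: "h \<in> carrier G" by (rule on_groupD[OF on_\<nu>])
          have "(shift_norm m h)\<^sup>2 \<le> 2 * c"
            using shift_norm_sq[OF m h] collision_nonneg[of m "translate h m"] c(1) by simp
          also have "2 * c \<le> 8 * K * c" using K(1) c(2) by simp
          finally have 1: "(shift_norm m h)\<^sup>2 \<le> 8 * K * c" .
          have "vol L \<le> K * vol (L / 2)" using K(2)[of "L / 2"] L by simp
          then have "vol L / vol (L / 2) \<le> K" using vol_pos[of "L / 2"] L by (simp add: field_simps)
          then have "8 * (vol L / vol (L / 2)) * c * ((len h)\<^sup>2 / L\<^sup>2) \<le> 8 * K * c * ((len h)\<^sup>2 / L\<^sup>2)"
            using c(2) by (intro mult_right_mono mult_left_mono) auto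
          then have 2: "(shift_norm m h)\<^sup>2 \<le> 8 * K * c * ((len h)\<^sup>2 / L\<^sup>2)" using near[OF h] unfolding c(1) by linarith
          from 1 2 show "(shift_norm m h)\<^sup>2 \<le> 8 * K * c * min 1 ((len h)\<^sup>2 / L\<^sup>2)"
            by (simp add: min_def)
        qed
      qed (rule int)
      also have "\<dots> = 8 * K * c * measure_pmf.expectation \<nu> (\<lambda>h. min 1 ((len h)\<^sup>2 / L\<^sup>2))" by simp
      also have "\<dots> \<le> 8 * K * c * (C / scaling \<phi> L)" using K(1) c(2) by (intro mult_left_mono C(2) L) auto
      finally show ?thesis .
    qed
    have "2 * c * measure_pmf.prob (\<mu> (2 * k)) {g. 2 * L \<le> len g}
        = measure_pmf.expectation (\<mu> (2 * k)) (\<lambda>h. 2 * c * indicator {g. 2 * L \<le> len g} h)" by simp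
    also have "\<dots> \<le> measure_pmf.expectation (\<mu> (2 * k)) (\<lambda>h. (shift_norm m h)\<^sup>2)"
    proof (rule integral_mono_AE)
      show "AE h in measure_pmf (\<mu> (2 * k)). 2 * c * indicator {g. 2 * L \<le> len g} h \<le> (shift_norm m h)\<^sup>2"
      proof (rule AE_pmfI)
        fix h assume "h \<in> set_pmf (\<mu> (2 * k))"
        then have h: "h \<in> carrier G" by (rule on_groupD[OF on_\<mu>])
        show "2 * c * indicator {g. 2 * L \<le> len g} h \<le> (shift_norm m h)\<^sup>2"
        proof (cases "2 * L \<le> len h")
          case True
          then show ?thesis using shift_norm_sq[OF m h] far[OF h True] c(1) by simp
        qed simp
      qed
    qed (auto intro: int integrable_indicator_pmf)
    also have "\<dots> = 2 * (autocorr \<nu> m 0 - autocorr \<nu> m (2 * k))"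
      by (rule expectation_shift_norm_sq[OF on_\<nu> m])
    also have "\<dots> \<le> 2 * (2 * real k * (autocorr \<nu> m 0 - autocorr \<nu> m 1))"
      by (intro mult_left_mono autocorr_loss_linear[OF \<nu>_sym m]) auto
    also have "\<dots> = 2 * real k * measure_pmf.expectation \<nu> (\<lambda>h. (shift_norm m h)\<^sup>2)"
      using expectation_shift_norm_sq[OF on_\<nu> m, of "Suc 0"] unfolding \<mu>_1 by simp
    also have "\<dots> \<le> 2 * real k * (8 * K * c * (C / scaling \<phi> L))"
      using one_step by (intro mult_left_mono) auto
    also have "\<dots> = 2 * c * (8 * K * C * real k / scaling \<phi> L)" by simp
    finally have fin: "2 * c * measure_pmf.prob (\<mu> (2 * k)) {g. 2 * L \<le> len g}
        \<le> 2 * c * (8 * K * C * real k / scaling \<phi> L)" .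
    show ?thesis by (rule mult_left_le_imp_le[OF fin]) (use c(2) in simp)
  qed
  define D where "D = 8 * K * C / \<delta>"
  have D: "D > 0" "8 * K * C \<le> D"
    using K(1) C(1) \<delta>_pos \<delta>_le_1 by (simp_all add: D_def field_simps mult_left_le)
  have "measure_pmf.prob (\<mu> n) {g. 2 * L \<le> len g} \<le> D * real n / scaling \<phi> L" if L: "L \<ge> 1" for L n
  proof -
    have s: "scaling \<phi> L > 0" using L scaling_pos by simp
    obtain k where "n = 2 * k \<or> n = Suc (2 * k)" by (metis oddE evenE Suc_eq_plus1)
    then show ?thesis
    proof
      assume n: "n = 2 * k"
      have "8 * K * C * real k / scaling \<phi> L \<le> D * real n / scaling \<phi> L"
        using D s n by (intro divide_right_mono mult_mono) auto
      then show ?thesis using even[OF L, of k] n by simp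
    next
      assume n: "n = Suc (2 * k)"
      \<comment> \<open>One more step, which rests with probability \<open>\<delta>\<close>, leads to an even time.\<close>
      have "\<delta> * measure_pmf.prob (\<mu> n) {g. 2 * L \<le> len g} \<le> measure_pmf.prob (\<mu> (2 * Suc k)) {g. 2 * L \<le> len g}"
        using prob_conv_ge_left[OF on_\<mu>, of \<nu> n] unfolding \<mu>_Suc[symmetric] \<delta>_def n by simp
      also have "\<dots> \<le> 8 * K * C * real (Suc k) / scaling \<phi> L" by (rule even[OF L])
      also have "\<dots> \<le> 8 * K * C * real n / scaling \<phi> L"
        using K(1) C(1) s n by (intro divide_right_mono mult_left_mono) auto
      finally show ?thesis using \<delta>_pos s by (simp add: D_def field_simps)
    qed
  qed
  then show ?thesis using D(1) by blast
qed

end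

section \<open>Time scale\<close>

locale jump_walk = jump_law G S \<phi> \<alpha> \<nu>
  for G (structure) and S :: "'a set" and \<phi> :: "real \<Rightarrow> real" and \<alpha> and \<nu> :: "'a pmf" +
  fixes r :: "real \<Rightarrow> real"
  assumes r_inverse: "inverse_near_infinity r (scaling \<phi>)"
begin

definition \<rho> :: "real \<Rightarrow> real" where "\<rho> = the_inv_into {0<..} r"

lemma r_bij: "bij_betw r {0<..} {0<..}" and r_strict: "strict_mono_on {0<..} r"
  using r_inverse by (auto simp: inverse_near_infinity_def increasing_bijection_def)

lemma r_pos: "0 < x \<Longrightarrow> 0 < r x"
  using r_bij by (auto simp: bij_betw_def)

lemma r_less: "0 < x \<Longrightarrow> x < y \<Longrightarrow> r x < r y"
  using r_strict by (auto simp: strict_mono_on_def)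

lemma r_mono: "0 < x \<Longrightarrow> x \<le> y \<Longrightarrow> r x \<le> r y"
  using r_less[of x y] by (cases "x = y") auto

lemma r_le_iff: "0 < x \<Longrightarrow> 0 < y \<Longrightarrow> r x \<le> r y \<longleftrightarrow> x \<le> y"
  using r_less[of y x] r_mono[of x y] by (meson not_le)

lemma \<rho>_pos: "0 < t \<Longrightarrow> 0 < \<rho> t" and r_\<rho>: "0 < t \<Longrightarrow> r (\<rho> t) = t"
proof -
  assume t: "0 < t"
  have inj: "inj_on r {0<..}" and im: "r ` {0<..} = {0<..}" using r_bij by (auto simp: bij_betw_def)
  show "0 < \<rho> t" using the_inv_into_into[OF inj, of t "{0<..}"] t im by (auto simp: \<rho>_def)
  show "r (\<rho> t) = t" unfolding \<rho>_def using t im by (intro f_the_inv_into_f[OF inj]) auto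
qed

lemma r_scaling: "\<exists>T>0. \<forall>t\<ge>T. r (scaling \<phi> t) = t"
proof -
  obtain T where "\<And>t. t \<ge> T \<Longrightarrow> r (scaling \<phi> t) = t"
    using r_inverse by (auto simp: inverse_near_infinity_def eventually_at_top_linorder)
  then show ?thesis by (intro exI[of _ "max T 1"]) auto
qed

lemma r_unbounded: "\<exists>X>0. \<forall>x\<ge>X. t \<le> r x"
proof (cases "t > 0")
  case True
  then show ?thesis using \<rho>_pos[OF True] r_\<rho>[OF True] by (metis r_mono)
next
  case False
  have "t \<le> r x" if "x \<ge> 1" for x using r_pos[of x] that False by linarith
  then show ?thesis by (intro exI[of _ 1]) auto
qed

lemma scaling_r: "\<exists>X>0. \<forall>x\<ge>X. scaling \<phi> (r x) = x"
proof -
  obtain T where T: "T > 0" "\<And>t. t \<ge> T \<Longrightarrow> r (scaling \<phi> t) = t" using r_scaling by blast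
  obtain X where X: "X > 0" "\<And>x. x \<ge> X \<Longrightarrow> T \<le> r x" using r_unbounded by blast
  have "scaling \<phi> (r x) = x" if "x \<ge> X" for x
  proof -
    have "x > 0" using that X(1) by simp
    moreover have "r (scaling \<phi> (r x)) = r x" using that X by (intro T) auto
    moreover have "scaling \<phi> (r x) > 0" using \<open>x > 0\<close> r_pos scaling_pos by simp
    ultimately show ?thesis using r_le_iff by (metis order_antisym order_refl)
  qed
  then show ?thesis using X(1) by blast
qed

text \<open>The growth of \<open>scaling \<phi>\<close>, which is at least that of a positive power and at most
  quadratic, transfers to its inverse \<open>r\<close>: dilating the time changes \<open>r\<close> by a bounded factor,
  and a large dilation changes it by a large factor.\<close>

lemma r_ratio_bounded:
  assumes c: "0 < c" shows "\<exists>K\<ge>1. \<forall>x\<ge>1. r x \<le> K * r (c * x)"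
proof -
  obtain A T1 where A: "A \<ge> 1" "T1 > 0" "\<And>t. t \<ge> T1 \<Longrightarrow> (1 / c) * scaling \<phi> t \<le> scaling \<phi> (A * t)"
    using scaling_reverse_doubling[of "1 / c"] by blast
  obtain T where T: "T > 0" "\<And>t. t \<ge> T \<Longrightarrow> r (scaling \<phi> t) = t" using r_scaling by blast
  obtain X0 where X0: "X0 > 0" "\<And>x. x \<ge> X0 \<Longrightarrow> scaling \<phi> (r x) = x" using scaling_r by blast
  obtain X1 where X1: "X1 > 0" "\<And>x. x \<ge> X1 \<Longrightarrow> max T T1 \<le> r x" using r_unbounded by blast
  define X where "X = max 1 (max X0 X1 / c)"
  have large: "r x \<le> A * r (c * x)" if x: "x \<ge> X" for x
  proof -
    have "max X0 X1 / c \<le> x" using x by (simp add: X_def)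
    then have "max X0 X1 \<le> c * x" using c by (simp add: pos_divide_le_eq mult.commute)
    then have cx: "c * x \<ge> X0" "c * x \<ge> X1" by auto
    define t where "t = r (c * x)"
    have t: "t \<ge> T" "t \<ge> T1" "scaling \<phi> t = c * x" using X0(2)[OF cx(1)] X1(2)[OF cx(2)] by (auto simp: t_def)
    have "x \<le> scaling \<phi> (A * t)" using A(3)[OF t(2)] t(3) c by simp
    moreover have "x > 0" using x by (simp add: X_def)
    ultimately have "r x \<le> r (scaling \<phi> (A * t))" by (intro r_mono)
    also have "t \<le> A * t" using A(1) T(1) t(1) by simp
    then have "r (scaling \<phi> (A * t)) = A * t" using t(1) by (intro T(2)) auto
    finally show ?thesis by (simp add: t_def)
  qed
  define K where "K = max A (r X / r c)"
  have "r x \<le> K * r (c * x)" if x: "x \<ge> 1" for x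
  proof -
    have p: "r (c * x) > 0" "r c > 0" using c x r_pos by auto
    show ?thesis
    proof (cases "x \<ge> X")
      case True
      then have "r x \<le> A * r (c * x)" by (rule large)
      also have "\<dots> \<le> K * r (c * x)" using p by (intro mult_right_mono) (auto simp: K_def)
      finally show ?thesis .
    next
      case False
      have "r x \<le> r X" using x False by (intro r_mono) auto
      also have "\<dots> = (r X / r c) * r c" using p by simp
      also have "\<dots> \<le> K * r (c * x)"
      proof (rule mult_mono)
        show "r c \<le> r (c * x)" using c x by (intro r_mono) auto
        show "r X / r c \<le> K" by (simp add: K_def)
        show "0 \<le> K" using A(1) by (simp add: K_def le_max_iff_disj)
      qed (use p in simp)
      finally show ?thesis .
    qed
  qed
  moreover have "K \<ge> 1" using A(1) by (simp add: K_def)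
  ultimately show ?thesis by blast
qed

lemma r_contraction:
  assumes \<kappa>: "0 < \<kappa>" shows "\<exists>c>0. c \<le> 1 \<and> (\<forall>x\<ge>1. \<kappa> * r (c * x) \<le> r x)"
proof -
  define k where "k = max \<kappa> 1"
  have k: "k \<ge> 1" "k \<ge> \<kappa>" by (auto simp: k_def)
  obtain T where T: "T > 0" "\<And>t. t \<ge> T \<Longrightarrow> r (scaling \<phi> t) = t" using r_scaling by blast
  obtain X0 where X0: "X0 > 0" "\<And>x. x \<ge> X0 \<Longrightarrow> scaling \<phi> (r x) = x" using scaling_r by blast
  obtain X1 where X1: "X1 > 0" "\<And>x. x \<ge> X1 \<Longrightarrow> T \<le> r x" using r_unbounded by blast
  define c1 where "c1 = 1 / k\<^sup>2"
  have c1: "c1 > 0" "c1 \<le> 1" using k by (simp_all add: c1_def)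
  define X where "X = max 1 (max X0 X1 / c1)"
  have large: "k * r (c1 * x) \<le> r x" if x: "x \<ge> X" for x
  proof -
    have "max X0 X1 / c1 \<le> x" using x by (simp add: X_def)
    then have "max X0 X1 \<le> c1 * x" using c1 by (simp add: pos_divide_le_eq mult.commute)
    then have cx: "c1 * x \<ge> X0" "c1 * x \<ge> X1" by auto
    define t where "t = r (c1 * x)"
    have t: "t \<ge> T" "scaling \<phi> t = c1 * x" using X0(2)[OF cx(1)] X1(2)[OF cx(2)] by (auto simp: t_def)
    have tp: "t > 0" using t(1) T(1) by simp
    have "scaling \<phi> (k * t) \<le> k\<^sup>2 * scaling \<phi> t" using k tp by (intro scaling_upper_growth) auto
    also have "\<dots> = x" using t(2) k by (simp add: c1_def)
    finally have le: "scaling \<phi> (k * t) \<le> x" .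
    have "t \<le> k * t" using k tp by simp
    then have "k * t = r (scaling \<phi> (k * t))" using t(1) by (intro T(2)[symmetric]) auto
    also have "\<dots> \<le> r x" using le k tp by (intro r_mono scaling_pos) auto
    finally show ?thesis by (simp add: t_def)
  qed
  have Xp: "X \<ge> 1" by (simp add: X_def)
  have r1: "r 1 / k > 0" using r_pos[of 1] k by simp
  define c2 where "c2 = \<rho> (r 1 / k) / X"
  have c2: "c2 > 0" using \<rho>_pos[OF r1] Xp by (simp add: c2_def)
  define c where "c = min c1 c2"
  have c: "c > 0" "c \<le> 1" "c \<le> c1" "c \<le> c2" using c1 c2 by (auto simp: c_def)
  have "\<kappa> * r (c * x) \<le> r x" if x: "x \<ge> 1" for x
  proof -
    have p: "r (c * x) > 0" using c x r_pos by simp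
    have "\<kappa> * r (c * x) \<le> k * r (c * x)" using k p by (intro mult_right_mono) auto
    also have "\<dots> \<le> r x"
    proof (cases "x \<ge> X")
      case True
      have "c * x \<le> c1 * x" using c(3) x by (intro mult_right_mono) auto
      then have "k * r (c * x) \<le> k * r (c1 * x)" using c x k by (intro mult_left_mono r_mono) auto
      then show ?thesis using large[OF True] by simp
    next
      case False
      have "c * x \<le> c2 * X" using c False x c2 by (intro mult_mono) auto
      also have "\<dots> = \<rho> (r 1 / k)" using Xp by (simp add: c2_def)
      finally have "r (c * x) \<le> r (\<rho> (r 1 / k))" using c x by (intro r_mono) auto
      then have "k * r (c * x) \<le> r 1" using r_\<rho>[OF r1] k by (simp add: field_simps)
      also have "\<dots> \<le> r x" using x by (intro r_mono) auto
      finally show ?thesis .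
    qed
    finally show ?thesis .
  qed
  then show ?thesis using c by blast
qed

lemma r_expansion:
  assumes "0 < \<kappa>" shows "\<exists>C\<ge>1. \<forall>x\<ge>1. \<kappa> * r x \<le> r (C * x)"
proof -
  obtain c where c: "c > 0" "c \<le> 1" "\<And>x. x \<ge> 1 \<Longrightarrow> \<kappa> * r (c * x) \<le> r x"
    using r_contraction[OF assms] by blast
  have "\<kappa> * r x \<le> r (1 / c * x)" if "x \<ge> 1" for x
  proof -
    have "1 * 1 \<le> 1 / c * x" using c that by (intro mult_mono) auto
    then show ?thesis using c(3)[of "1 / c * x"] c(1) by simp
  qed
  then show ?thesis using c by (intro exI[of _ "1 / c"]) auto
qed

lemma vol_r_ratio:
  assumes "0 < c" shows "\<exists>K\<ge>1. \<forall>x\<ge>1. vol (r x) \<le> K * vol (r (c * x))"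
proof -
  obtain A where A: "A \<ge> 1" "\<And>x. x \<ge> 1 \<Longrightarrow> r x \<le> A * r (c * x)" using r_ratio_bounded[OF assms] by blast
  obtain K where K: "K \<ge> 1" "\<And>t. t \<ge> 0 \<Longrightarrow> vol (A * t) \<le> K * vol t" using vol_scale[of A] by blast
  have "vol (r x) \<le> K * vol (r (c * x))" if "x \<ge> 1" for x
  proof -
    have "vol (r x) \<le> vol (A * r (c * x))" using that by (intro vol_mono A)
    also have "\<dots> \<le> K * vol (r (c * x))" using that assms by (intro K less_imp_le r_pos) auto
    finally show ?thesis .
  qed
  then show ?thesis using K(1) by blast
qed

lemma vol_r_pos: "0 < x \<Longrightarrow> 0 < vol (r x)" and vol_r_ge_1: "0 < x \<Longrightarrow> 1 \<le> vol (r x)"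
  using r_pos[of x] vol_pos[of "r x"] vol_ge_1[of "r x"] by simp_all

lemma vol_r_mono: "0 < x \<Longrightarrow> x \<le> y \<Longrightarrow> vol (r x) \<le> vol (r y)"
  by (intro vol_mono r_mono)

section \<open>Return probabilities in terms of the time scale\<close>

text \<open>The radius of \<open>near_diagonal_oscillation\<close> is expressed through a time \<open>x\<close>, and the bound
  extended to all \<open>x\<close>: for small \<open>x\<close> the ball of radius \<open>r x\<close> is trivial, for bounded \<open>x\<close> the estimate at
  a fixed large scale is used.\<close>

lemma oscillation:
  "\<exists>C>0. \<forall>x>0. \<forall>n. \<forall>g\<in>carrier G. len g \<le> r x \<longrightarrow>
     ret n - pmf (\<mu> (2 * n)) g \<le> C * x * (ret n - ret (Suc n))"
proof -
  obtain C where C: "C > 0" "\<And>n R g. R > 0 \<Longrightarrow> g \<in> carrier G \<Longrightarrow> len g \<le> R \<Longrightarrow>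
     ret n - pmf (\<mu> (2 * n)) g \<le> C * scaling \<phi> R * (ret n - ret (Suc n))"
    using near_diagonal_oscillation by blast
  obtain X0 where X0: "X0 > 0" "\<And>x. x \<ge> X0 \<Longrightarrow> scaling \<phi> (r x) = x" using scaling_r by blast
  define x1 where "x1 = \<rho> (1 / 2)"
  have x1: "x1 > 0" "r x1 = 1 / 2" using \<rho>_pos[of "1 / 2"] r_\<rho>[of "1 / 2"] by (auto simp: x1_def)
  define D where "D = C * max 1 (X0 / x1)"
  have "C * 1 \<le> D" "C * (X0 / x1) \<le> D"
    using C(1) unfolding D_def by (intro mult_left_mono; simp)+
  then have D: "D > 0" "D \<ge> C" "D \<ge> C * (X0 / x1)" using C(1) by auto
  have "ret n - pmf (\<mu> (2 * n)) g \<le> D * x * (ret n - ret (Suc n))"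
    if x: "x > 0" and g: "g \<in> carrier G" "len g \<le> r x" for x n g
  proof -
    have d: "ret n - ret (Suc n) \<ge> 0" using ret_Suc_le[of n] by simp
    consider "x \<ge> X0" | "x1 \<le> x" "x < X0" | "x < x1" by linarith
    then show ?thesis
    proof cases
      case 1
      have "ret n - pmf (\<mu> (2 * n)) g \<le> C * scaling \<phi> (r x) * (ret n - ret (Suc n))"
        using x g by (intro C(2) r_pos)
      also have "\<dots> = C * (x * (ret n - ret (Suc n)))" using X0(2)[OF 1] by simp
      also have "\<dots> \<le> D * (x * (ret n - ret (Suc n)))"
        using D(2) x d by (intro mult_right_mono) auto
      finally show ?thesis by (simp add: mult.assoc)
    next
      case 2
      have "len g \<le> r X0" using g(2) r_mono[of x X0] x 2 by simp
      then have "ret n - pmf (\<mu> (2 * n)) g \<le> C * scaling \<phi> (r X0) * (ret n - ret (Suc n))"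
        using X0(1) g by (intro C(2) r_pos)
      also have "\<dots> = (C * (X0 / x1)) * x1 * (ret n - ret (Suc n))" using X0(2)[of X0] x1 by simp
      also have "\<dots> \<le> D * x * (ret n - ret (Suc n))"
        using D x1 2 d C(1) X0(1) by (intro mult_right_mono mult_mono) auto
      finally show ?thesis .
    next
      case 3
      then have "len g < 1" using g(2) r_less[of x x1] x x1 by simp
      then have "g = \<one>" using g len_lt_1 by simp
      then show ?thesis using D(1) x d by (simp add: ret_def)
    qed
  qed
  then show ?thesis using D(1) by blast
qed

lemma displacement_tail:
  "\<exists>C\<ge>1. \<forall>x>0. \<forall>n. measure_pmf.prob (\<mu> n) {g. 2 * r x \<le> len g} \<le> C * real n / x"
proof -
  obtain C where C: "C > 0" "\<And>L n. L \<ge> 1 \<Longrightarrow>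
      measure_pmf.prob (\<mu> n) {g. 2 * L \<le> len g} \<le> C * real n / scaling \<phi> L"
    using displacement_tail_scaling by blast
  obtain X0 where X0: "X0 > 0" "\<And>x. x \<ge> X0 \<Longrightarrow> scaling \<phi> (r x) = x" using scaling_r by blast
  obtain X1 where X1: "X1 > 0" "\<And>x. x \<ge> X1 \<Longrightarrow> 1 \<le> r x" using r_unbounded by blast
  define D where "D = max 1 (max C (max X0 X1))"
  have D: "D \<ge> 1" "D \<ge> C" "D \<ge> X0" "D \<ge> X1" by (auto simp: D_def)
  have "measure_pmf.prob (\<mu> n) {g. 2 * r x \<le> len g} \<le> D * real n / x" if x: "x > 0" for x n
  proof (cases "x \<ge> max X0 X1")
    case True
    then have "measure_pmf.prob (\<mu> n) {g. 2 * r x \<le> len g} \<le> C * real n / x"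
      using C(2)[of "r x" n] X0(2)[of x] X1(2)[of x] by simp
    also have "\<dots> \<le> D * real n / x" using D x by (intro divide_right_mono mult_right_mono) auto
    finally show ?thesis .
  next
    case False
    show ?thesis
    proof (cases "n = 0")
      case True
      then show ?thesis using r_pos[OF x] by (simp add: measure_return_pmf)
    next
      case n: False
      have "1 * x \<le> real n * D" using False D n x by (intro mult_mono) auto
      then have "1 \<le> D * real n / x" using x by (simp add: field_simps)
      then show ?thesis using measure_pmf.prob_le_1[of "\<mu> n" "{g. 2 * r x \<le> len g}"] by linarith
    qed
  qed
  then show ?thesis using D(1) by blast
qed

text \<open>Averaging the oscillation bound over a ball gives a Nash inequality for the return
  probabilities.\<close>

lemma nash_bound:
  "\<exists>C>0. \<forall>x>0. \<forall>n. ret n \<le> 1 / vol (r x) + C * x * (ret n - ret (Suc n))"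
proof -
  obtain C where C: "C > 0" "\<And>x n g. x > 0 \<Longrightarrow> g \<in> carrier G \<Longrightarrow> len g \<le> r x \<Longrightarrow>
     ret n - pmf (\<mu> (2 * n)) g \<le> C * x * (ret n - ret (Suc n))"
    using oscillation by blast
  have "ret n \<le> 1 / vol (r x) + C * x * (ret n - ret (Suc n))" if x: "x > 0" for x n
  proof -
    have "vol (r x) * ret n - measure_pmf.prob (\<mu> (2 * n)) (ball_len (r x))
        = (\<Sum>g\<in>ball_len (r x). ret n - pmf (\<mu> (2 * n)) g)"
      by (simp add: measure_measure_pmf_finite sum_subtractf vol_eq)
    also have "\<dots> \<le> (\<Sum>g\<in>ball_len (r x). C * x * (ret n - ret (Suc n)))"
      using x by (intro sum_mono C(2)) (auto dest: ball_carrier ball_len_le)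
    also have "\<dots> = vol (r x) * (C * x * (ret n - ret (Suc n)))" by (simp add: vol_eq)
    finally have "vol (r x) * ret n \<le> 1 + vol (r x) * (C * x * (ret n - ret (Suc n)))"
      using measure_pmf.prob_le_1[of "\<mu> (2 * n)" "ball_len (r x)"] by linarith
    then have "vol (r x) * ret n \<le> vol (r x) * (1 / vol (r x) + C * x * (ret n - ret (Suc n)))"
      using vol_r_pos[OF x] by (simp add: distrib_left)
    then show ?thesis using vol_r_pos[OF x] by simp
  qed
  then show ?thesis using C(1) by blast
qed

lemma half_time:
  assumes "2 \<le> n"
  obtains m where "1 \<le> m" "m < n" "real n / 3 \<le> real m"
    "ret n - ret (Suc n) \<le> 2 * ret m / real n"
proof
  define m where "m = n div 2"
  define k where "k = n - m"
  have n: "n = m + k" by (simp add: k_def m_def)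
  have k: "real n / 2 \<le> real k" "real n / 3 \<le> real m" "1 \<le> m" "m < n"
  proof -
    have "n \<le> 3 * m" "n \<le> 2 * k" "1 \<le> m" "m < n" using assms unfolding k_def m_def by presburger+
    then show "real n / 2 \<le> real k" "real n / 3 \<le> real m" "1 \<le> m" "m < n" by linarith+
  qed
  show "1 \<le> m" "m < n" "real n / 3 \<le> real m" by (rule k)+
  have "real n / 2 * (ret n - ret (Suc n)) \<le> real k * (ret n - ret (Suc n))"
    using k(1) ret_Suc_le[of n] by (intro mult_right_mono) auto
  also have "\<dots> \<le> ret m - ret n" using ret_decrement[of k m] n by simp
  also have "\<dots> \<le> ret m" using ret_nonneg[of n] by simp
  finally show "ret n - ret (Suc n) \<le> 2 * ret m / real n" using assms by (simp add: field_simps)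
qed

text \<open>With \<open>x\<close> a small multiple of \<open>n\<close>, the Nash inequality and the bound on decrements give
  \<open>ret n \<le> const / V (r n) + \<epsilon> ret (n / 2)\<close>, which can be iterated.\<close>

lemma ret_upper: "\<exists>B>0. \<forall>n\<ge>1. ret n \<le> B / vol (r (real n))"
proof -
  obtain C where C: "C > 0" "\<And>x n. x > 0 \<Longrightarrow> ret n \<le> 1 / vol (r x) + C * x * (ret n - ret (Suc n))"
    using nash_bound by blast
  obtain K where K: "K \<ge> 1" "\<And>x. x \<ge> 1 \<Longrightarrow> vol (r x) \<le> K * vol (r (1 / 3 * x))"
    using vol_r_ratio[of "1 / 3"] by auto
  define e where "e = 1 / (4 * C * K)"
  have e: "e > 0" using C K(1) by (simp add: e_def)
  obtain K2 where K2: "K2 \<ge> 1" "\<And>x. x \<ge> 1 \<Longrightarrow> vol (r x) \<le> K2 * vol (r (e * x))"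
    using vol_r_ratio[OF e] by blast
  define B where "B = max (2 * K2) (vol (r 1))"
  have B: "B \<ge> 2 * K2" "B \<ge> vol (r 1)" "B > 0" using K2(1) by (auto simp: B_def less_max_iff_disj)
  have "n \<ge> 1 \<longrightarrow> ret n \<le> B / vol (r (real n))" for n
  proof (induction n rule: less_induct)
    case (less n)
    show ?case
    proof (intro impI)
      assume n: "n \<ge> 1"
      have v: "vol (r (real n)) > 0" using n by (intro vol_r_pos) auto
      show "ret n \<le> B / vol (r (real n))"
      proof (cases "n = 1")
        case True
        have "1 \<le> B / vol (r 1)" using B(2) vol_r_pos[of 1] by simp
        then show ?thesis using ret_le_1[of n] True by simp
      next
        case False
        with n have "2 \<le> n" by simp
        then obtain m where m: "1 \<le> m" "m < n" "real n / 3 \<le> real m"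
          "ret n - ret (Suc n) \<le> 2 * ret m / real n" by (rule half_time)
        have vm: "vol (r (real m)) > 0" using m by (intro vol_r_pos) auto
        have "vol (r (real n)) \<le> K * vol (r (1 / 3 * real n))" using n by (intro K(2)) auto
        also have "\<dots> \<le> K * vol (r (real m))"
          using K(1) m n by (intro mult_left_mono vol_r_mono) auto
        finally have volm: "vol (r (real n)) \<le> K * vol (r (real m))" .
        have "ret m \<le> B / vol (r (real m))" using less.IH m by blast
        also have "\<dots> \<le> B * K / vol (r (real n))"
          using volm v vm B(3) by (simp add: field_simps)
        finally have rm: "ret m \<le> B * K / vol (r (real n))" .
        have en: "e * real n > 0" using e n by simp
        have first: "1 / vol (r (e * real n)) \<le> K2 / vol (r (real n))"
          using K2(2)[of "real n"] n v vol_r_pos[OF en] by (simp add: field_simps)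
        have "C * (e * real n) * (ret n - ret (Suc n)) \<le> C * (e * real n) * (2 * ret m / real n)"
          using m(4) C(1) en by (intro mult_left_mono) auto
        also have "\<dots> = 2 * C * e * ret m" using n by simp
        also have "\<dots> \<le> 2 * C * e * (B * K / vol (r (real n)))"
          using rm C(1) e by (intro mult_left_mono) auto
        also have "\<dots> = B / 2 / vol (r (real n))" using C(1) K(1) by (simp add: e_def)
        finally have second: "C * (e * real n) * (ret n - ret (Suc n)) \<le> B / 2 / vol (r (real n))" .
        have "ret n \<le> K2 / vol (r (real n)) + B / 2 / vol (r (real n))"
          using C(2)[OF en, of n] first second by linarith
        also have "\<dots> = (K2 + B / 2) / vol (r (real n))" by (simp add: add_divide_distrib)
        also have "\<dots> \<le> B / vol (r (real n))" using B(1) v by (intro divide_right_mono) auto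
        finally show ?thesis .
      qed
    qed
  qed
  then show ?thesis using B(3) by blast
qed

lemma decrement_upper: "\<exists>D>0. \<forall>n\<ge>1. ret n - ret (Suc n) \<le> D / (real n * vol (r (real n)))"
proof -
  obtain B where B: "B > 0" "\<And>n. n \<ge> 1 \<Longrightarrow> ret n \<le> B / vol (r (real n))" using ret_upper by blast
  obtain K where K: "K \<ge> 1" "\<And>x. x \<ge> 1 \<Longrightarrow> vol (r x) \<le> K * vol (r (1 / 3 * x))"
    using vol_r_ratio[of "1 / 3"] by auto
  define D where "D = max (2 * B * K) (vol (r 1))"
  have D: "D \<ge> 2 * B * K" "D \<ge> vol (r 1)" "D > 0" using B(1) K(1) by (auto simp: D_def less_max_iff_disj)
  have "ret n - ret (Suc n) \<le> D / (real n * vol (r (real n)))" if n: "n \<ge> 1" for n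
  proof (cases "n = 1")
    case True
    have "1 \<le> D / (1 * vol (r 1))" using D(2) vol_r_pos[of 1] by simp
    then show ?thesis using ret_le_1[of n] ret_nonneg[of "Suc n"] unfolding True by simp
  next
    case False
    with n have "2 \<le> n" by simp
    then obtain m where m: "1 \<le> m" "m < n" "real n / 3 \<le> real m"
      "ret n - ret (Suc n) \<le> 2 * ret m / real n" by (rule half_time)
    have v: "vol (r (real n)) > 0" "vol (r (real m)) > 0" using m n by (auto intro!: vol_r_pos)
    have "vol (r (real n)) \<le> K * vol (r (1 / 3 * real n))" using n by (intro K(2)) auto
    also have "\<dots> \<le> K * vol (r (real m))"
      using K(1) m n by (intro mult_left_mono vol_r_mono) auto
    finally have volm: "vol (r (real n)) \<le> K * vol (r (real m))" .
    have "ret m \<le> B / vol (r (real m))" using B(2) m by blast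
    also have "\<dots> \<le> B * K / vol (r (real n))" using volm v B(1) by (simp add: field_simps)
    finally have "2 * ret m / real n \<le> 2 * (B * K / vol (r (real n))) / real n"
      by (intro divide_right_mono mult_left_mono) auto
    also have "\<dots> = 2 * B * K / (real n * vol (r (real n)))" by (simp add: mult_ac)
    also have "\<dots> \<le> D / (real n * vol (r (real n)))" using D(1) n v by (intro divide_right_mono) auto
    finally show ?thesis using m(4) by simp
  qed
  then show ?thesis using D(3) by blast
qed

text \<open>Most of the mass of \<open>\<mu> n\<close> sits in a ball of radius comparable to \<open>r n\<close>, so Cauchy-Schwarz
  bounds its \<open>\<ell>\<^sup>2\<close> norm, the return probability at time \<open>2 n\<close>, from below.\<close>

lemma ret_lower: "\<exists>b>0. \<forall>n\<ge>1. b / vol (r (real n)) \<le> ret n"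
proof -
  obtain C where C: "C \<ge> 1" "\<And>x n. x > 0 \<Longrightarrow> measure_pmf.prob (\<mu> n) {g. 2 * r x \<le> len g} \<le> C * real n / x"
    using displacement_tail by blast
  have "1 / (2 * C) > 0" using C(1) by simp
  then obtain A where A: "A \<ge> 1" "\<And>x. x \<ge> 1 \<Longrightarrow> r x \<le> A * r (1 / (2 * C) * x)"
    using r_ratio_bounded by blast
  obtain K where K: "K \<ge> 1" "\<And>t. t \<ge> 0 \<Longrightarrow> vol (2 * A * t) \<le> K * vol t" using vol_scale[of "2 * A"] by blast
  have "1 / (4 * K) / vol (r (real n)) \<le> ret n" if n: "n \<ge> 1" for n
  proof -
    define x where "x = 2 * C * real n"
    have "1 * 1 \<le> 2 * C * real n" using C(1) n by (intro mult_mono) auto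
    then have x: "x \<ge> 1" "x > 0" by (auto simp: x_def)
    define F where "F = ball_len (2 * r x)"
    have "measure_pmf.prob (\<mu> n) {g. 2 * r x \<le> len g} \<le> 1 / 2"
      using C(2)[OF x(2), of n] C(1) n by (simp add: x_def)
    moreover have "1 - measure_pmf.prob (\<mu> n) {g. 2 * r x \<le> len g} = measure_pmf.prob (\<mu> n) (- {g. 2 * r x \<le> len g})"
      using measure_pmf.prob_compl[of "{g. 2 * r x \<le> len g}" "\<mu> n"] by (simp add: Compl_eq_Diff_UNIV)
    moreover have "measure_pmf.prob (\<mu> n) (- {g. 2 * r x \<le> len g}) \<le> measure_pmf.prob (\<mu> n) F"
    proof (rule measure_pmf.finite_measure_mono_AE)
      show "AE g in measure_pmf (\<mu> n). g \<in> - {g. 2 * r x \<le> len g} \<longrightarrow> g \<in> F"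
        using on_groupD[OF on_\<mu>] by (intro AE_pmfI) (auto simp: F_def ball_len_def)
    qed simp
    ultimately have half: "1 / 2 \<le> (\<Sum>g\<in>F. pmf (\<mu> n) g)"
      by (simp add: F_def measure_measure_pmf_finite)
    have "(1 / 2)\<^sup>2 \<le> (\<Sum>g\<in>F. pmf (\<mu> n) g)\<^sup>2" using half by (intro power_mono) auto
    also have "\<dots> \<le> (\<Sum>g\<in>F. (pmf (\<mu> n) g)\<^sup>2) * real (card F)"
      by (rule sum_squared_le_sum_of_squares)
    also have "\<dots> \<le> ret n * (K * vol (r (real n)))"
    proof (rule mult_mono)
      have "(\<Sum>g\<in>F. (pmf (\<mu> n) g)\<^sup>2) = measure_pmf.expectation (\<mu> n) (\<lambda>g. pmf (\<mu> n) g * indicator F g)"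
        by (subst integral_measure_pmf_real[where A = F])
           (auto simp: F_def indicator_eq_0_iff power2_eq_square intro!: sum.cong)
      also have "\<dots> \<le> measure_pmf.expectation (\<mu> n) (pmf (\<mu> n))"
        by (intro integral_mono measure_pmf.integrable_const_bound[where B = 1])
           (auto split: split_indicator simp: pmf_le_1)
      also have "\<dots> = ret n"
        using collision_walk[OF \<nu>_sym, of n n] by (simp add: collision_expectation ret_def mult_2)
      finally show "(\<Sum>g\<in>F. (pmf (\<mu> n) g)\<^sup>2) \<le> ret n" .
      have "r x \<le> A * r (1 / (2 * C) * x)" using x by (intro A)
      also have "1 / (2 * C) * x = real n" using C(1) by (simp add: x_def)
      finally have "2 * r x \<le> 2 * A * r (real n)" by simp
      then have "real (card F) \<le> vol (2 * A * r (real n))"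
        unfolding F_def vol_eq[symmetric] by (rule vol_mono)
      also have "\<dots> \<le> K * vol (r (real n))" using n by (intro K less_imp_le r_pos) auto
      finally show "real (card F) \<le> K * vol (r (real n))" .
    qed (auto simp: ret_nonneg)
    finally show ?thesis using K(1) vol_r_pos[of "real n"] n by (simp add: field_simps power2_eq_square)
  qed
  moreover have "1 / (4 * K) > 0" using K(1) by simp
  ultimately show ?thesis by blast
qed

text \<open>At distances below \<open>r (e n)\<close> the oscillation is of order \<open>e / V (r n)\<close>, for small \<open>e\<close> at most
  half the return probability.\<close>

lemma near_diagonal_even:
  "\<exists>\<eta>>0. \<exists>c>0. \<forall>n\<ge>1. \<forall>g\<in>carrier G. len g \<le> \<eta> * r (real n) \<longrightarrow>
     c / vol (r (real n)) \<le> pmf (\<mu> (2 * n)) g"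
proof -
  obtain b where b: "b > 0" "\<And>n. n \<ge> 1 \<Longrightarrow> b / vol (r (real n)) \<le> ret n" using ret_lower by blast
  obtain D where D: "D > 0" "\<And>n. n \<ge> 1 \<Longrightarrow> ret n - ret (Suc n) \<le> D / (real n * vol (r (real n)))"
    using decrement_upper by blast
  obtain C where C: "C > 0" "\<And>x n g. x > 0 \<Longrightarrow> g \<in> carrier G \<Longrightarrow> len g \<le> r x \<Longrightarrow>
     ret n - pmf (\<mu> (2 * n)) g \<le> C * x * (ret n - ret (Suc n))"
    using oscillation by blast
  define e where "e = b / (2 * C * D)"
  have e: "e > 0" using b(1) C(1) D(1) by (simp add: e_def)
  obtain A where A: "A \<ge> 1" "\<And>x. x \<ge> 1 \<Longrightarrow> r x \<le> A * r (e * x)" using r_ratio_bounded[OF e] by blast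
  have "b / 2 / vol (r (real n)) \<le> pmf (\<mu> (2 * n)) g"
    if n: "n \<ge> 1" and g: "g \<in> carrier G" "len g \<le> 1 / A * r (real n)" for n g
  proof -
    have v: "vol (r (real n)) > 0" using n by (intro vol_r_pos) auto
    have en: "e * real n > 0" using e n by simp
    have "1 / A * r (real n) \<le> r (e * real n)" using A(2)[of "real n"] A(1) n by (simp add: field_simps)
    then have "ret n - pmf (\<mu> (2 * n)) g \<le> C * (e * real n) * (ret n - ret (Suc n))"
      using g en by (intro C(2)) auto
    also have "\<dots> \<le> C * (e * real n) * (D / (real n * vol (r (real n))))"
      using D(2)[OF n] C(1) en by (intro mult_left_mono) auto
    also have "\<dots> = b / 2 / vol (r (real n))" using C(1) D(1) n by (simp add: e_def)
    finally have "ret n - b / 2 / vol (r (real n)) \<le> pmf (\<mu> (2 * n)) g" by simp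
    moreover have "b / vol (r (real n)) = b / 2 / vol (r (real n)) + b / 2 / vol (r (real n))" by simp
    ultimately show ?thesis using b(2)[OF n] by linarith
  qed
  moreover have "1 / A > 0" "b / 2 > 0" using A(1) b(1) by simp_all
  ultimately show ?thesis by blast
qed

end

section \<open>Lower bounds off the diagonal\<close>

context jump_walk
begin

text \<open>The content of this property lies in large \<open>n\<close>: small times are covered by the positivity of
  \<open>\<nu>\<close> on the finitely many elements concerned (\<open>small_times\<close>).\<close>

definition lower_bound_at :: "real \<Rightarrow> bool" where
  "lower_bound_at \<kappa> \<longleftrightarrow> (\<exists>c>0. \<forall>n\<ge>1. \<forall>g\<in>carrier G. len g \<le> \<kappa> * r (real n) \<longrightarrow>
     c / vol (r (real n)) \<le> pmf (\<mu> n) g)"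

lemma pmf_\<mu>_Suc_ge: "\<delta> * pmf (\<mu> n) g \<le> pmf (\<mu> (Suc n)) g"
  using prob_conv_ge_left[OF on_\<mu>, of \<nu> n "{g}"]
  unfolding \<mu>_Suc[symmetric] \<delta>_def by (simp add: measure_pmf_single)

lemma small_times:
  assumes \<kappa>: "0 < \<kappa>"
  shows "\<exists>c>0. \<forall>n. 1 \<le> n \<and> n \<le> n0 \<longrightarrow> (\<forall>g\<in>carrier G. len g \<le> \<kappa> * r (real n) \<longrightarrow>
     c / vol (r (real n)) \<le> pmf (\<mu> n) g)"
proof -
  define F where "F = ball_len (\<kappa> * r (real (Suc n0)))"
  have "\<one> \<in> F" unfolding F_def using \<kappa> r_pos[of "real (Suc n0)"] by (intro one_in_ball) auto
  then have F: "finite (pmf \<nu> ` F)" "pmf \<nu> ` F \<noteq> {}" by (auto simp: F_def)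
  define a where "a = Min (pmf \<nu> ` F)"
  have "a \<in> pmf \<nu> ` F" unfolding a_def using F by (rule Min_in)
  then have a: "a > 0" using \<nu>_pos ball_carrier by (auto simp: F_def)
  have pw: "\<delta> ^ k * pmf \<nu> g \<le> pmf (\<mu> (Suc k)) g" for k g
  proof (induction k)
    case 0 then show ?case by (simp add: \<mu>_1)
  next
    case (Suc k)
    have "\<delta> * (\<delta> ^ k * pmf \<nu> g) \<le> \<delta> * pmf (\<mu> (Suc k)) g"
      using Suc \<delta>_pos by (intro mult_left_mono) auto
    also have "\<dots> \<le> pmf (\<mu> (Suc (Suc k))) g" by (rule pmf_\<mu>_Suc_ge)
    finally show ?case by (simp add: mult.assoc)
  qed
  have "\<delta> ^ n0 * a / vol (r (real n)) \<le> pmf (\<mu> n) g"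
    if n: "1 \<le> n" "n \<le> n0" and g: "g \<in> carrier G" "len g \<le> \<kappa> * r (real n)" for n g
  proof -
    obtain k where k: "n = Suc k" using n by (cases n) auto
    have "\<kappa> * r (real n) \<le> \<kappa> * r (real (Suc n0))" using \<kappa> n by (intro mult_left_mono r_mono) auto
    then have "g \<in> F" using g by (simp add: F_def ball_len_def)
    then have "a \<le> pmf \<nu> g" unfolding a_def using F by (intro Min_le) auto
    have "\<delta> ^ n0 \<le> \<delta> ^ k" using \<delta>_pos \<delta>_le_1 k n by (intro power_decreasing) auto
    then have "\<delta> ^ n0 * a \<le> \<delta> ^ k * pmf \<nu> g"
      using \<open>a \<le> pmf \<nu> g\<close> a \<delta>_pos by (intro mult_mono) auto
    then have "\<delta> ^ n0 * a \<le> pmf (\<mu> n) g" using pw[of k g] k by simp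
    moreover have "\<delta> ^ n0 * a / vol (r (real n)) \<le> \<delta> ^ n0 * a / 1"
      using n a \<delta>_pos vol_r_ge_1[of "real n"] by (intro divide_left_mono) auto
    ultimately show ?thesis by simp
  qed
  moreover have "\<delta> ^ n0 * a > 0" using a \<delta>_pos by simp
  ultimately show ?thesis by blast
qed

lemma lower_bound_atI:
  assumes "0 < \<kappa>" "0 < c" and
    "\<And>n g. n0 \<le> n \<Longrightarrow> 1 \<le> n \<Longrightarrow> g \<in> carrier G \<Longrightarrow> len g \<le> \<kappa> * r (real n) \<Longrightarrow> c / vol (r (real n)) \<le> pmf (\<mu> n) g"
  shows "lower_bound_at \<kappa>"
proof -
  obtain c' where c': "c' > 0" "\<And>n g. 1 \<le> n \<Longrightarrow> n \<le> n0 \<Longrightarrow> g \<in> carrier G \<Longrightarrow> len g \<le> \<kappa> * r (real n) \<Longrightarrow>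
     c' / vol (r (real n)) \<le> pmf (\<mu> n) g"
    using small_times[OF assms(1), of n0] by blast
  have "min c c' / vol (r (real n)) \<le> pmf (\<mu> n) g"
    if n: "n \<ge> 1" and g: "g \<in> carrier G" "len g \<le> \<kappa> * r (real n)" for n g
  proof -
    have v: "vol (r (real n)) > 0" using n by (intro vol_r_pos) auto
    show ?thesis
    proof (cases "n0 \<le> n")
      case True
      have "min c c' / vol (r (real n)) \<le> c / vol (r (real n))" using v by (intro divide_right_mono) auto
      then show ?thesis using assms(3)[OF True n g] by linarith
    next
      case False
      have "min c c' / vol (r (real n)) \<le> c' / vol (r (real n))" using v by (intro divide_right_mono) auto
      then show ?thesis using c'(2)[OF n _ g] False by simp
    qed
  qed
  moreover have "min c c' > 0" using assms(2) c'(1) by simp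
  ultimately show ?thesis unfolding lower_bound_at_def by blast
qed

lemma lower_bound_at_mono:
  assumes "lower_bound_at \<kappa>" "\<kappa>' \<le> \<kappa>" shows "lower_bound_at \<kappa>'"
proof -
  have "len g \<le> \<kappa> * r (real n)" if "n \<ge> 1" "len g \<le> \<kappa>' * r (real n)" for n g
  proof -
    have "\<kappa>' * r (real n) \<le> \<kappa> * r (real n)"
      using assms(2) r_pos[of "real n"] that(1) by (intro mult_right_mono) auto
    with that(2) show ?thesis by linarith
  qed
  then show ?thesis using assms(1) unfolding lower_bound_at_def by blast
qed

lemma near_diagonal: "\<exists>\<eta>>0. lower_bound_at \<eta>"
proof -
  obtain \<eta> c where \<eta>: "\<eta> > 0" and c: "c > 0" "\<And>n g. n \<ge> 1 \<Longrightarrow> g \<in> carrier G \<Longrightarrow> len g \<le> \<eta> * r (real n) \<Longrightarrow>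
     c / vol (r (real n)) \<le> pmf (\<mu> (2 * n)) g"
    using near_diagonal_even by blast
  obtain A where A: "A \<ge> 1" "\<And>x. x \<ge> 1 \<Longrightarrow> r x \<le> A * r (1 / 3 * x)"
    using r_ratio_bounded[of "1 / 3"] by auto
  have "lower_bound_at (\<eta> / A)"
  proof (rule lower_bound_atI)
    show "0 < \<eta> / A" "0 < \<delta> * c" using \<eta> A(1) c(1) \<delta>_pos by auto
    fix n g assume n: "2 \<le> n" "1 \<le> n" and g: "g \<in> carrier G" "len g \<le> \<eta> / A * r (real n)"
    define k where "k = n div 2"
    have k: "1 \<le> k" "real n / 3 \<le> real k" "k \<le> n" "n = 2 * k \<or> n = Suc (2 * k)"
    proof -
      have "1 \<le> k" "n \<le> 3 * k" "k \<le> n" "n = 2 * k \<or> n = Suc (2 * k)" using n unfolding k_def by presburger+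
      then show "1 \<le> k" "real n / 3 \<le> real k" "k \<le> n" "n = 2 * k \<or> n = Suc (2 * k)" by (auto simp: field_simps)
    qed
    have "r (real n) \<le> A * r (1 / 3 * real n)" using n by (intro A(2)) auto
    also have "\<dots> \<le> A * r (real k)" using A(1) k n by (intro mult_left_mono r_mono) auto
    finally have "\<eta> / A * r (real n) \<le> \<eta> / A * (A * r (real k))"
      using \<eta> A(1) by (intro mult_left_mono) auto
    also have "\<dots> = \<eta> * r (real k)" using A(1) by simp
    finally have "len g \<le> \<eta> * r (real k)" using g by simp
    then have 1: "c / vol (r (real k)) \<le> pmf (\<mu> (2 * k)) g" using k g by (intro c(2))
    have v: "0 < vol (r (real k))" "vol (r (real k)) \<le> vol (r (real n))" using k by (auto intro!: vol_r_pos vol_r_mono)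
    have 2: "c / vol (r (real n)) \<le> c / vol (r (real k))" using c(1) v by (intro divide_left_mono) auto
    have "\<delta> * (c / vol (r (real n))) \<le> \<delta> * pmf (\<mu> (2 * k)) g" using 1 2 \<delta>_pos by (intro mult_left_mono) auto
    also have "\<dots> \<le> pmf (\<mu> n) g"
      using k(4)
    proof
      assume "n = 2 * k"
      then show ?thesis using \<delta>_le_1 \<delta>_pos by (simp add: mult_left_le_one_le)
    next
      assume "n = Suc (2 * k)" then show ?thesis using pmf_\<mu>_Suc_ge by simp
    qed
    finally show "\<delta> * c / vol (r (real n)) \<le> pmf (\<mu> n) g" by simp
  qed
  then show ?thesis using \<eta> A(1) by (intro exI[of _ "\<eta> / A"]) auto
qed

subsection \<open>Chaining, for index above one\<close>

text \<open>When halving the time divides the space scale by less than two, an element at distance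
  slightly larger than \<open>\<kappa> r n\<close> is the product of two halves that are within reach in half the
  time; the intermediate point may vary in a ball of volume comparable to \<open>V (r n)\<close>.\<close>

lemma lower_bound_chain_step:
  assumes l: "0 < l" "l < 2" and X: "\<And>n m. n0 \<le> n \<Longrightarrow> n div 2 \<le> m \<Longrightarrow> r (real n) \<le> l * r (real m)"
    and \<kappa>: "0 < \<kappa>" and LB: "lower_bound_at \<kappa>"
  shows "lower_bound_at ((1 + 2 / l) / 2 * \<kappa>)"
proof -
  define \<theta> where "\<theta> = (1 + 2 / l) / 2"
  define \<sigma> where "\<sigma> = \<kappa> * (1 / l - \<theta> / 2) / 2"
  have \<theta>: "\<theta> > 0" using l by (simp add: \<theta>_def add_pos_pos)
  have "1 / l - \<theta> / 2 = (2 - l) / (4 * l)" using l by (simp add: \<theta>_def field_simps)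
  then have \<sigma>: "\<sigma> > 0" using l \<kappa> by (simp add: \<sigma>_def)
  have \<sigma>2: "\<theta> * \<kappa> / 2 + 2 * \<sigma> = \<kappa> / l" by (simp add: \<sigma>_def field_simps)
  obtain c where c: "c > 0" "\<And>n g. n \<ge> 1 \<Longrightarrow> g \<in> carrier G \<Longrightarrow> len g \<le> \<kappa> * r (real n) \<Longrightarrow> c / vol (r (real n)) \<le> pmf (\<mu> n) g"
    using LB unfolding lower_bound_at_def by blast
  obtain K where K: "K \<ge> 1" "\<And>t. t \<ge> 0 \<Longrightarrow> vol (1 / \<sigma> * t) \<le> K * vol t" using vol_scale[of "1 / \<sigma>"] by blast
  obtain X1 where X1: "X1 > 0" "\<And>x. x \<ge> X1 \<Longrightarrow> 1 / \<sigma> \<le> r x" using r_unbounded by blast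
  define N where "N = max 2 (max n0 (nat \<lceil>X1\<rceil>))"
  have "lower_bound_at (\<theta> * \<kappa>)"
  proof (rule lower_bound_atI)
    show "0 < \<theta> * \<kappa>" "0 < c\<^sup>2 / K" using \<theta> \<kappa> c(1) K(1) by auto
    fix n g assume n: "N \<le> n" "1 \<le> n" and g: "g \<in> carrier G" "len g \<le> \<theta> * \<kappa> * r (real n)"
    have n': "2 \<le> n" "n0 \<le> n" "X1 \<le> real n" using n by (auto simp: N_def nat_le_iff ceiling_le_iff)
    define m where "m = n div 2"
    define k where "k = n - m"
    have mk: "1 \<le> m" "1 \<le> k" "n div 2 \<le> m" "n div 2 \<le> k" "m \<le> n" "k \<le> n" "n = m + k"
      using n' unfolding m_def k_def by presburger+
    define s where "s = \<sigma> * r (real n)"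
    have s: "s \<ge> 1" using X1(2)[OF n'(3)] \<sigma> by (simp add: s_def field_simps)
    have rm: "r (real n) \<le> l * r (real m)" "r (real n) \<le> l * r (real k)" using X[OF n'(2) mk(3)] X[OF n'(2) mk(4)] by blast+
    have reach: "\<theta> * \<kappa> / 2 * r (real n) + 2 * s \<le> \<kappa> * r (real i)" if "r (real n) \<le> l * r (real i)" for i
    proof -
      have "\<theta> * \<kappa> / 2 * r (real n) + 2 * s = (\<theta> * \<kappa> / 2 + 2 * \<sigma>) * r (real n)" by (simp add: s_def algebra_simps)
      also have "\<dots> = \<kappa> / l * r (real n)" by (simp only: \<sigma>2)
      also have "\<dots> \<le> \<kappa> / l * (l * r (real i))" using that l \<kappa> by (intro mult_left_mono) auto
      finally show ?thesis using l by simp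
    qed
    define i where "i = nat \<lceil>len g / 2\<rceil>"
    have i: "len g / 2 \<le> real i" "real i \<le> len g / 2 + 1" unfolding i_def by (auto simp: of_nat_nat)
    obtain a b where ab: "a \<in> carrier G" "b \<in> carrier G" "g = a \<otimes> b" "len a \<le> real i" "len b \<le> max 0 (len g - real i)"
      using g(1) by (rule geodesic_split)
    have la: "len a \<le> \<theta> * \<kappa> / 2 * r (real n) + s" using ab(4) i(2) g(2) s by (simp add: field_simps)
    have "0 \<le> \<theta> * \<kappa> / 2 * r (real n)" using \<theta> \<kappa> n r_pos[of "real n"] by simp
    then have lb: "len b \<le> \<theta> * \<kappa> / 2 * r (real n) + s" using ab(5) i(1) g(2) s by (simp add: max_def field_simps split: if_splits)
    define v where "v = vol (r (real n))"
    have v: "v > 0" using n by (auto simp: v_def intro!: vol_r_pos)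
    have vm: "0 < vol (r (real m))" "vol (r (real m)) \<le> v" "0 < vol (r (real k))" "vol (r (real k)) \<le> v"
      unfolding v_def using mk by (auto intro!: vol_r_pos vol_r_mono)
    define A where "A = (\<otimes>) a ` ball_len s"
    have inj: "inj_on ((\<otimes>) a) (ball_len s)" using ab by (auto simp: inj_on_def ball_len_def)
    have A: "finite A" "A \<subseteq> carrier G" "real (card A) = vol s"
      using ab by (auto simp: A_def vol_eq card_image[OF inj] dest: ball_carrier)
    have each: "(c / v) * (c / v) \<le> pmf (\<mu> m) x * pmf (\<mu> k) (inv x \<otimes> g)" if xA: "x \<in> A" for x
    proof -
      obtain z where z: "z \<in> carrier G" "len z \<le> s" "x = a \<otimes> z"
        using xA by (auto simp: A_def ball_len_def)
      have "len x \<le> len a + len z" using z ab len_mult by simp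
      then have "len x \<le> \<kappa> * r (real m)" using la z reach[OF rm(1)] by simp
      then have 1: "c / vol (r (real m)) \<le> pmf (\<mu> m) x" using mk z ab by (intro c(2)) auto
      have "inv a \<otimes> (a \<otimes> b) = b" using ab by (simp add: m_assoc[symmetric])
      then have "inv x \<otimes> g = inv z \<otimes> b" using z ab by (simp add: inv_mult_group m_assoc)
      moreover have "len (inv z \<otimes> b) \<le> len z + len b" using z ab len_mult[of "inv z" b] by simp
      ultimately have "len (inv x \<otimes> g) \<le> \<kappa> * r (real k)" using lb z reach[OF rm(2)] by simp
      then have 2: "c / vol (r (real k)) \<le> pmf (\<mu> k) (inv x \<otimes> g)" using mk z ab by (intro c(2)) auto
      have "c / v \<le> c / vol (r (real m))" "c / v \<le> c / vol (r (real k))"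
        using vm v c(1) by (auto intro!: divide_left_mono)
      then show ?thesis using 1 2 c(1) v by (intro mult_mono) auto
    qed
    have "v \<le> K * vol s" using K(2)[of s] s \<sigma> by (simp add: v_def s_def)
    then have "c\<^sup>2 / K / v \<le> vol s * ((c / v) * (c / v))"
      using v K(1) c(1) by (simp add: field_simps power2_eq_square)
    also have "\<dots> = (\<Sum>x\<in>A. (c / v) * (c / v))" using A by simp
    also have "\<dots> \<le> (\<Sum>x\<in>A. pmf (\<mu> m) x * pmf (\<mu> k) (inv x \<otimes> g))" by (intro sum_mono each)
    also have "\<dots> \<le> pmf (conv (\<mu> m) (\<mu> k)) g" by (intro pmf_conv_ge_sum on_\<mu> g A)
    also have "conv (\<mu> m) (\<mu> k) = \<mu> n" using \<mu>_add[of m k] mk by simp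
    finally show "c\<^sup>2 / K / vol (r (real n)) \<le> pmf (\<mu> n) g" by (simp add: v_def)
  qed
  then show ?thesis by (simp add: \<theta>_def)
qed

lemma r_halving_gt_linear:
  assumes "1 < \<alpha>"
  shows "\<exists>l n0. 0 < l \<and> l < 2 \<and> (\<forall>n m. n0 \<le> n \<and> n div 2 \<le> m \<longrightarrow> r (real n) \<le> l * r (real m))"
proof -
  obtain l Q T1 where l: "1 < l" "l < 2" "2 < Q" "0 < T1"
    "\<And>t. t \<ge> T1 \<Longrightarrow> Q * scaling \<phi> t \<le> scaling \<phi> (l * t)"
    using scaling_growth_gt_linear[OF assms] by blast
  obtain T where T: "T > 0" "\<And>t. t \<ge> T \<Longrightarrow> r (scaling \<phi> t) = t" using r_scaling by blast
  obtain X0 where X0: "X0 > 0" "\<And>x. x \<ge> X0 \<Longrightarrow> scaling \<phi> (r x) = x" using scaling_r by blast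
  obtain X1 where X1: "X1 > 0" "\<And>x. x \<ge> X1 \<Longrightarrow> max T T1 \<le> r x" using r_unbounded by blast
  \<comment> \<open>\<open>Q > 2\<close> leaves room for the rounding in \<open>n div 2\<close>.\<close>
  define M where "M = max (Q * max X0 X1) (Q / (Q - 2))"
  have "r (real n) \<le> l * r (real m)" if n: "nat \<lceil>M\<rceil> + 1 \<le> n" and m: "n div 2 \<le> m" for n m
  proof -
    have nM: "M \<le> real n" "n \<ge> 1" using n by linarith+
    have "Q / (Q - 2) \<le> real n" "Q * max X0 X1 \<le> real n" using nM by (auto simp: M_def)
    then have q: "Q \<le> real n * (Q - 2)" and "max X0 X1 * Q \<le> real n"
      using l(3) by (simp_all only: pos_divide_le_eq mult.commute diff_gt_0_iff_gt)
    then have q2: "max X0 X1 \<le> real n / Q" using l(3) by (subst pos_le_divide_eq) linarith+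
    define t where "t = r (real n / Q)"
    have t: "t \<ge> T" "t \<ge> T1" "scaling \<phi> t = real n / Q" using q2 X0(2)[of "real n / Q"] X1(2)[of "real n / Q"] by (auto simp: t_def)
    have "real n \<le> scaling \<phi> (l * t)" using l(5)[OF t(2)] t(3) l(3) by simp
    then have "r (real n) \<le> r (scaling \<phi> (l * t))" using nM by (intro r_mono) auto
    also have "t \<le> l * t" using l(1) t(1) T(1) by simp
    then have "r (scaling \<phi> (l * t)) = l * t" using t(1) by (intro T(2)) auto
    also have "\<dots> \<le> l * r (real m)"
    proof -
      have "n \<le> 2 * m + 1" using m by presburger
      then have "real n \<le> 2 * real m + 1" by linarith
      then have "real n * Q \<le> (2 * real m + 1) * Q" using l(3) by (intro mult_right_mono) auto
      then have "real n / Q \<le> real m" using q l(3) by (simp add: field_simps)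
      moreover have "0 < real n / Q" using nM l(3) by simp
      ultimately show ?thesis unfolding t_def using l(1) by (intro mult_left_mono r_mono) auto
    qed
    finally show ?thesis .
  qed
  then show ?thesis using l(1,2) by (intro exI[of _ l] exI[of _ "nat \<lceil>M\<rceil> + 1"]) auto
qed

lemma lower_bound_chain:
  assumes "1 < \<alpha>" shows "lower_bound_at \<kappa>"
proof -
  obtain l n0 where l: "0 < l" "l < 2" "\<And>n m. n0 \<le> n \<Longrightarrow> n div 2 \<le> m \<Longrightarrow> r (real n) \<le> l * r (real m)"
    using r_halving_gt_linear[OF assms] by blast
  obtain \<eta> where \<eta>: "\<eta> > 0" "lower_bound_at \<eta>" using near_diagonal by blast
  define \<theta> where "\<theta> = (1 + 2 / l) / 2"
  have \<theta>: "\<theta> > 1" using l(1,2) by (simp add: \<theta>_def field_simps)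
  have "lower_bound_at (\<theta> ^ k * \<eta>)" for k
  proof (induction k)
    case (Suc k)
    have "lower_bound_at ((1 + 2 / l) / 2 * (\<theta> ^ k * \<eta>))"
    proof (rule lower_bound_chain_step[OF l(1,2) l(3) _ Suc])
      show "0 < \<theta> ^ k * \<eta>" using \<eta>(1) \<theta> by simp
    qed
    then have "lower_bound_at (\<theta> * (\<theta> ^ k * \<eta>))" unfolding \<theta>_def .
    then show ?case by (simp add: mult.assoc)
  qed (simp add: \<eta>)
  moreover obtain k where "\<kappa> / \<eta> < \<theta> ^ k" using real_arch_pow[OF \<theta>] by blast
  ultimately show ?thesis using \<eta>(1) lower_bound_at_mono[of "\<theta> ^ k * \<eta>" \<kappa>] by (simp add: field_simps)
qed

end

section \<open>Exit probabilities\<close>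

lemma integrable_bounded_pmf:
  fixes f :: "'b \<Rightarrow> real"
  assumes "\<And>x. 0 \<le> f x" "\<And>x. f x \<le> B" shows "integrable (measure_pmf p) f"
  by (rule measure_pmf.integrable_const_bound[where B = B]) (use assms in auto)

context jump_law
begin

text \<open>The probability that the walk from \<open>x\<close> leaves the ball of radius \<open>b\<close> by time \<open>n\<close>, defined
  by decomposition at the first step so that bounds follow by induction on time without the path
  space.\<close>

primrec exit_prob :: "real \<Rightarrow> nat \<Rightarrow> 'a \<Rightarrow> real" where
  "exit_prob b 0 x = (if b < len x then 1 else 0)"
| "exit_prob b (Suc n) x =
    (if b < len x then 1 else measure_pmf.expectation \<nu> (\<lambda>h. exit_prob b n (x \<otimes> h)))"

lemma exit_prob_bounds: "0 \<le> exit_prob b n x \<and> exit_prob b n x \<le> 1"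
proof (induction n arbitrary: x)
  case (Suc n)
  have "integrable (measure_pmf \<nu>) (\<lambda>h. exit_prob b n (x \<otimes> h))"
    using Suc by (intro integrable_bounded_pmf[where B = 1]) auto
  then have "measure_pmf.expectation \<nu> (\<lambda>h. exit_prob b n (x \<otimes> h)) \<le> 1"
    using Suc by (intro measure_pmf.integral_le_const) auto
  then show ?case using Suc by (auto intro!: Bochner_Integration.integral_nonneg)
qed auto

lemma exit_prob_outside: "b < len x \<Longrightarrow> exit_prob b n x = 1"
  by (cases n) auto

lemma prob_\<mu>_Suc:
  assumes "x \<in> carrier G"
  shows "measure_pmf.prob (\<mu> (Suc n)) {h. P (x \<otimes> h)}
    = measure_pmf.expectation \<nu> (\<lambda>y. measure_pmf.prob (\<mu> n) {h. P ((x \<otimes> y) \<otimes> h)})"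
proof -
  have "measure_pmf.prob (\<mu> (Suc n)) {h. P (x \<otimes> h)}
      = measure_pmf.expectation (conv \<nu> (\<mu> n)) (indicator {h. P (x \<otimes> h)})"
    unfolding \<mu>_Suc_left by simp
  also have "\<dots> = measure_pmf.expectation \<nu> (\<lambda>y. measure_pmf.expectation (\<mu> n) (\<lambda>h. indicator {h. P (x \<otimes> h)} (y \<otimes> h)))"
    by (rule expectation_conv[where B = 1]) (auto split: split_indicator)
  also have "\<dots> = measure_pmf.expectation \<nu> (\<lambda>y. measure_pmf.expectation (\<mu> n) (indicator {h. P ((x \<otimes> y) \<otimes> h)}))"
    using assms on_groupD[OF on_\<nu>] on_groupD[OF on_\<mu>]
    by (intro integral_cong_AE AE_pmfI) (auto simp: m_assoc indicator_def intro!: integral_cong_AE AE_pmfI)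
  finally show ?thesis by simp
qed

text \<open>Ottaviani's inequality: a walk that has left the large ball is unlikely to come back to the
  small one.\<close>

lemma ottaviani:
  assumes d: "\<And>j. j \<le> n \<Longrightarrow> measure_pmf.prob (\<mu> j) {h. b - a \<le> len h} \<le> d"
  shows "j \<le> n \<Longrightarrow> x \<in> carrier G \<Longrightarrow> (1 - d) * exit_prob b j x \<le> measure_pmf.prob (\<mu> j) {h. a \<le> len (x \<otimes> h)}"
proof (induction j arbitrary: x)
  case (0 x)
  then show ?case
  proof (cases "b < len x")
    case True
    have d0: "0 \<le> d" using d[of 0] measure_nonneg order_trans by blast
    have "(b - a \<le> 0) \<or> a \<le> len x" using True by linarith
    then show ?thesis using d0 d[of 0] True 0(2) by (auto simp: measure_return_pmf indicator_def split: if_splits)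
  qed (simp add: measure_return_pmf)
next
  case (Suc j x)
  show ?case
  proof (cases "b < len x")
    case True
    have "1 - d \<le> 1 - measure_pmf.prob (\<mu> (Suc j)) {h. b - a \<le> len h}" using d[OF Suc.prems(1)] by simp
    also have "\<dots> = measure_pmf.prob (\<mu> (Suc j)) (- {h. b - a \<le> len h})"
      using measure_pmf.prob_compl[of "{h. b - a \<le> len h}" "\<mu> (Suc j)"] by (simp add: Compl_eq_Diff_UNIV)
    also have "\<dots> \<le> measure_pmf.prob (\<mu> (Suc j)) {h. a \<le> len (x \<otimes> h)}"
    proof (rule measure_pmf.finite_measure_mono_AE)
      show "AE h in measure_pmf (\<mu> (Suc j)). h \<in> - {h. b - a \<le> len h} \<longrightarrow> h \<in> {h. a \<le> len (x \<otimes> h)}"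
      proof (rule AE_pmfI)
        fix h assume "h \<in> set_pmf (\<mu> (Suc j))"
        then have h: "h \<in> carrier G" by (rule on_groupD[OF on_\<mu>])
        have "len x = len ((x \<otimes> h) \<otimes> inv h)" using h Suc.prems by (simp add: m_assoc)
        also have "\<dots> \<le> len (x \<otimes> h) + len h" using h Suc.prems len_mult[of "x \<otimes> h" "inv h"] by simp
        finally show "h \<in> - {h. b - a \<le> len h} \<longrightarrow> h \<in> {h. a \<le> len (x \<otimes> h)}" using True by auto
      qed
    qed simp
    finally show ?thesis using True by simp
  next
    case False
    have "(1 - d) * exit_prob b (Suc j) x = measure_pmf.expectation \<nu> (\<lambda>y. (1 - d) * exit_prob b j (x \<otimes> y))"
      using False by simp
    also have "\<dots> \<le> measure_pmf.expectation \<nu> (\<lambda>y. measure_pmf.prob (\<mu> j) {h. a \<le> len ((x \<otimes> y) \<otimes> h)})"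
    proof (rule integral_mono_AE)
      show "AE y in measure_pmf \<nu>. (1 - d) * exit_prob b j (x \<otimes> y) \<le> measure_pmf.prob (\<mu> j) {h. a \<le> len ((x \<otimes> y) \<otimes> h)}"
        using Suc.IH Suc.prems on_groupD[OF on_\<nu>] by (intro AE_pmfI) auto
    qed (auto intro!: integrable_mult_right integrable_bounded_pmf[where B = 1] simp: exit_prob_bounds)
    also have "\<dots> = measure_pmf.prob (\<mu> (Suc j)) {h. a \<le> len (x \<otimes> h)}"
      by (rule prob_\<mu>_Suc[symmetric]) (rule Suc.prems)
    finally show ?thesis .
  qed
qed

subsection \<open>One large jump\<close>

text \<open>To reach a neighbourhood of a far element \<open>g\<close>, the walk may stay near its start for some
  time, jump near \<open>g\<close>, and stay there.  The exit time from the first ball makes the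
  contributions of different jump times disjoint, so they add up; in the recursion this appears
  as the sum of the non-exit probabilities.\<close>

lemma one_jump_lower_bound:
  assumes g: "g \<in> carrier G" "2 * s < len g"
    and stay: "\<And>j. j \<le> m \<Longrightarrow> measure_pmf.prob (\<mu> j) {h. s < len h} \<le> 1 / 2"
    and jump: "\<And>x. x \<in> carrier G \<Longrightarrow> len x \<le> s \<Longrightarrow> p \<le> measure_pmf.prob \<nu> {h. len (inv g \<otimes> (x \<otimes> h)) \<le> s}"
    and p: "0 \<le> p"
  shows "j \<le> m \<Longrightarrow> x \<in> carrier G \<Longrightarrow>
    p / 2 * (\<Sum>i<j. 1 - exit_prob s i x) \<le> measure_pmf.prob (\<mu> j) {h. len (inv g \<otimes> (x \<otimes> h)) \<le> 2 * s}"
proof (induction j arbitrary: x)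
  case 0 then show ?case by simp
next
  case (Suc j x)
  show ?case
  proof (cases "s < len x")
    case True
    then show ?thesis by (simp add: exit_prob_outside del: exit_prob.simps)
  next
    case False
    define F where "F y = (\<Sum>i<j. 1 - exit_prob s i y)" for y
    have F: "0 \<le> F y" "F y \<le> real j" for y
    proof -
      show "0 \<le> F y" unfolding F_def using exit_prob_bounds by (intro sum_nonneg) auto
      have "F y \<le> (\<Sum>i<j. 1)" unfolding F_def using exit_prob_bounds by (intro sum_mono) auto
      then show "F y \<le> real j" by simp
    qed
    define T where "T = {h. len (inv g \<otimes> (x \<otimes> h)) \<le> s}"
    have EF: "measure_pmf.expectation \<nu> (\<lambda>y. F (x \<otimes> y)) = (\<Sum>i<j. 1 - exit_prob s (Suc i) x)"
    proof -
      have i: "integrable (measure_pmf \<nu>) (\<lambda>y. exit_prob s i (x \<otimes> y))" for i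
        by (rule integrable_bounded_pmf[where B = 1]) (simp_all add: exit_prob_bounds)
      have "measure_pmf.expectation \<nu> (\<lambda>y. F (x \<otimes> y))
          = (\<Sum>i<j. measure_pmf.expectation \<nu> (\<lambda>y. 1 - exit_prob s i (x \<otimes> y)))"
        unfolding F_def by (rule Bochner_Integration.integral_sum) (intro Bochner_Integration.integrable_diff i; simp)
      also have "\<dots> = (\<Sum>i<j. 1 - exit_prob s (Suc i) x)"
        using False i by (intro sum.cong refl) (simp add: Bochner_Integration.integral_diff)
      finally show ?thesis .
    qed
    have split: "p / 2 * (\<Sum>i<Suc j. 1 - exit_prob s i x) = p / 2 + p / 2 * measure_pmf.expectation \<nu> (\<lambda>y. F (x \<otimes> y))"
      using False unfolding EF sum.lessThan_Suc_shift by (simp add: distrib_left del: exit_prob.simps(2))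
    have "p / 2 \<le> 1 / 2 * measure_pmf.prob \<nu> T"
      using jump[OF Suc.prems(2)] False by (simp add: T_def)
    with split have "p / 2 * (\<Sum>i<Suc j. 1 - exit_prob s i x)
        \<le> 1 / 2 * measure_pmf.prob \<nu> T + p / 2 * measure_pmf.expectation \<nu> (\<lambda>y. F (x \<otimes> y))"
      by linarith
    also have "1 / 2 * measure_pmf.prob \<nu> T + p / 2 * measure_pmf.expectation \<nu> (\<lambda>y. F (x \<otimes> y))
        = measure_pmf.expectation \<nu> (\<lambda>y. 1 / 2 * indicator T y + p / 2 * F (x \<otimes> y))"
    proof -
      have "integrable (measure_pmf \<nu>) (\<lambda>y. F (x \<otimes> y))"
        by (rule integrable_bounded_pmf[where B = "real j"]) (rule F)+
      then show ?thesis
        by (subst Bochner_Integration.integral_add)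
           (auto intro!: integrable_mult_right integrable_indicator_pmf)
    qed
    also have "\<dots> \<le> measure_pmf.expectation \<nu> (\<lambda>y. measure_pmf.prob (\<mu> j) {h. len (inv g \<otimes> ((x \<otimes> y) \<otimes> h)) \<le> 2 * s})"
    proof (rule integral_mono_AE)
      have "integrable (measure_pmf \<nu>) (\<lambda>y. F (x \<otimes> y))"
        by (rule integrable_bounded_pmf[where B = "real j"]) (rule F)+
      then show "integrable (measure_pmf \<nu>) (\<lambda>y. 1 / 2 * indicator T y + p / 2 * F (x \<otimes> y))"
        by (intro Bochner_Integration.integrable_add integrable_mult_right integrable_indicator_pmf)
      show "integrable (measure_pmf \<nu>) (\<lambda>y. measure_pmf.prob (\<mu> j) {h. len (inv g \<otimes> ((x \<otimes> y) \<otimes> h)) \<le> 2 * s})"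
        by (rule integrable_bounded_pmf[where B = 1]) auto
      show "AE y in measure_pmf \<nu>. 1 / 2 * indicator T y + p / 2 * F (x \<otimes> y)
          \<le> measure_pmf.prob (\<mu> j) {h. len (inv g \<otimes> ((x \<otimes> y) \<otimes> h)) \<le> 2 * s}"
      proof (rule AE_pmfI)
        fix y assume "y \<in> set_pmf \<nu>"
        then have y: "y \<in> carrier G" by (rule on_groupD[OF on_\<nu>])
        define z where "z = x \<otimes> y"
        have z: "z \<in> carrier G" using Suc.prems y by (simp add: z_def)
        show "1 / 2 * indicator T y + p / 2 * F (x \<otimes> y)
            \<le> measure_pmf.prob (\<mu> j) {h. len (inv g \<otimes> ((x \<otimes> y) \<otimes> h)) \<le> 2 * s}"
        proof (cases "y \<in> T")
          case False
          then show ?thesis using Suc.IH[OF _ z] Suc.prems by (simp add: F_def z_def)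
        next
          case True
          then have zT: "len (inv g \<otimes> z) \<le> s" by (simp add: T_def z_def)
          \<comment> \<open>The two neighbourhoods are disjoint, so \<open>z\<close> has left the first one.\<close>
          have "g = z \<otimes> inv (inv g \<otimes> z)" using g z by (simp add: inv_mult_group m_assoc[symmetric])
          then have "len g \<le> len z + len (inv g \<otimes> z)"
            using len_mult[of z "inv (inv g \<otimes> z)"] g z by simp
          then have "s < len z" using zT g(2) by simp
          then have F0: "F z = 0" by (simp add: F_def exit_prob_outside)
          have "1 / 2 \<le> 1 - measure_pmf.prob (\<mu> j) {h. s < len h}" using stay[of j] Suc.prems by simp
          also have "\<dots> = measure_pmf.prob (\<mu> j) (- {h. s < len h})"
            using measure_pmf.prob_compl[of "{h. s < len h}" "\<mu> j"] by (simp add: Compl_eq_Diff_UNIV)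
          also have "\<dots> \<le> measure_pmf.prob (\<mu> j) {h. len (inv g \<otimes> (z \<otimes> h)) \<le> 2 * s}"
          proof (rule measure_pmf.finite_measure_mono_AE)
            show "AE h in measure_pmf (\<mu> j). h \<in> - {h. s < len h} \<longrightarrow> h \<in> {h. len (inv g \<otimes> (z \<otimes> h)) \<le> 2 * s}"
            proof (rule AE_pmfI)
              fix h assume "h \<in> set_pmf (\<mu> j)"
              then have h: "h \<in> carrier G" by (rule on_groupD[OF on_\<mu>])
              have "inv g \<otimes> (z \<otimes> h) = (inv g \<otimes> z) \<otimes> h" using g z h by (simp add: m_assoc)
              then have "len (inv g \<otimes> (z \<otimes> h)) \<le> len (inv g \<otimes> z) + len h" using len_mult[of "inv g \<otimes> z" h] g z h by simp
              then show "h \<in> - {h. s < len h} \<longrightarrow> h \<in> {h. len (inv g \<otimes> (z \<otimes> h)) \<le> 2 * s}" using zT by auto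
            qed
          qed simp
          finally show ?thesis using True F0 by (simp add: z_def)
        qed
      qed
    qed
    also have "\<dots> = measure_pmf.prob (\<mu> (Suc j)) {h. len (inv g \<otimes> (x \<otimes> h)) \<le> 2 * s}"
      using prob_\<mu>_Suc[OF Suc.prems(2), of j "\<lambda>w. len (inv g \<otimes> w) \<le> 2 * s"] by simp
    finally show ?thesis .
  qed
qed

end

context jump_walk
begin

text \<open>Where \<open>\<phi>\<close> is at most a multiple of \<open>scaling \<phi>\<close>, the scale \<open>r x\<close> has \<open>\<phi> (r x)\<close> at most of
  order \<open>x\<close>, so a single jump hits a given ball of radius comparable to \<open>r x\<close> with probability at
  least of order \<open>1 / x\<close>.\<close>

lemma \<nu>_lower_time_scale:
  assumes "\<alpha> \<le> 1" "0 < \<kappa>"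
  shows "\<exists>c>0. \<forall>x\<ge>1. \<forall>h\<in>carrier G. len h \<le> \<kappa> * r x \<longrightarrow> c / (x * vol (r x)) \<le> pmf \<nu> h"
proof -
  obtain c0 where c0: "c0 > 0" "\<And>g. g \<in> carrier G \<Longrightarrow> c0 / (\<phi> (len g) * vol (len g)) \<le> pmf \<nu> g"
    using \<nu>_lower by blast
  obtain C T1 where C: "C > 0" "T1 > 0" "\<And>t. t \<ge> T1 \<Longrightarrow> \<phi> t \<le> C * scaling \<phi> t"
    using gauge_le_scaling[OF assms(1)] by blast
  obtain T where T: "T > 0" "\<And>t. t \<ge> T \<Longrightarrow> r (scaling \<phi> t) = t" using r_scaling by blast
  obtain C' where C': "C' \<ge> 1" "\<And>x. x \<ge> 1 \<Longrightarrow> \<kappa> * r x \<le> r (C' * x)" using r_expansion[OF assms(2)] by blast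
  obtain B where B: "B \<ge> 1" "\<And>t. 0 \<le> t \<Longrightarrow> t \<le> max T T1 \<Longrightarrow> \<phi> t \<le> B" using \<phi>_bounded by blast
  obtain K where K: "K \<ge> 1" "\<And>t. t \<ge> 0 \<Longrightarrow> vol (\<kappa> * t) \<le> K * vol t" using vol_scale[of \<kappa>] by blast
  define D where "D = max B (C * C')"
  have D: "D \<ge> B" "D \<ge> C * C'" "D > 0" using B(1) by (auto simp: D_def)
  have "c0 / (D * K) / (x * vol (r x)) \<le> pmf \<nu> h"
    if x: "x \<ge> 1" and h: "h \<in> carrier G" "len h \<le> \<kappa> * r x" for x h
  proof -
    have "\<phi> (len h) \<le> D * x"
    proof (cases "len h \<ge> max T T1")
      case True
      then have p: "0 < scaling \<phi> (len h)" using T(1) by (intro scaling_pos) auto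
      have "r (scaling \<phi> (len h)) = len h" using True by (intro T(2)) auto
      also have "\<dots> \<le> r (C' * x)" using h(2) C'(2)[OF x] by linarith
      finally have "scaling \<phi> (len h) \<le> C' * x" using p C'(1) x r_le_iff[OF p, of "C' * x"] by simp
      then have "C * scaling \<phi> (len h) \<le> C * (C' * x)" using C(1) by (intro mult_left_mono) auto
      moreover have "\<phi> (len h) \<le> C * scaling \<phi> (len h)" using True by (intro C(3)) auto
      moreover have "(C * C') * x \<le> D * x" using D(2) x by (intro mult_right_mono) auto
      ultimately show ?thesis by (simp add: mult.assoc)
    next
      case False
      then have "\<phi> (len h) \<le> B" by (intro B(2)) auto
      also have "B * 1 \<le> D * x" using D x by (intro mult_mono) auto
      finally show ?thesis by simp
    qed
    moreover have "vol (len h) \<le> K * vol (r x)"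
      using vol_mono[OF h(2)] K(2)[of "r x"] r_pos[of x] x by simp
    ultimately have le: "\<phi> (len h) * vol (len h) \<le> (D * x) * (K * vol (r x))"
      using D(3) x vol_pos[of "len h"] \<phi>_pos[of "len h"] by (intro mult_mono) auto
    have "c0 / ((D * x) * (K * vol (r x))) \<le> c0 / (\<phi> (len h) * vol (len h))"
      using le c0(1) vol_pos[of "len h"] \<phi>_pos[of "len h"] by (intro divide_left_mono mult_pos_pos)
        (use D(3) K(1) x vol_r_pos[of x] in auto)
    then show ?thesis using c0(2)[OF h(1)] by (simp add: mult_ac)
  qed
  moreover have "c0 / (D * K) > 0" using c0(1) D(3) K(1) by simp
  ultimately show ?thesis by blast
qed

text \<open>For index at most one, a jump of length comparable to \<open>r n\<close> occurs within time \<open>n\<close> with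
  probability bounded below.\<close>

lemma lower_bound_jump:
  assumes \<alpha>: "\<alpha> \<le> 1" and \<kappa>: "0 < \<kappa>" shows "lower_bound_at \<kappa>"
proof -
  obtain \<eta> where \<eta>: "\<eta> > 0" "lower_bound_at \<eta>" using near_diagonal by blast
  obtain c where c: "c > 0" "\<And>n g. n \<ge> 1 \<Longrightarrow> g \<in> carrier G \<Longrightarrow> len g \<le> \<eta> * r (real n) \<Longrightarrow> c / vol (r (real n)) \<le> pmf (\<mu> n) g"
    using \<eta>(2) unfolding lower_bound_at_def by blast
  obtain A where A: "A \<ge> 1" "\<And>x. x \<ge> 1 \<Longrightarrow> r x \<le> A * r (1 / 2 * x)"
    using r_ratio_bounded[of "1 / 2"] by auto
  define \<sigma> where "\<sigma> = \<eta> / (2 * A)"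
  have \<sigma>: "\<sigma> > 0" using \<eta>(1) A(1) by (simp add: \<sigma>_def)
  obtain c1 where c1: "c1 > 0" "\<And>x h. x \<ge> 1 \<Longrightarrow> h \<in> carrier G \<Longrightarrow> len h \<le> (\<kappa> + 2 * \<sigma>) * r x \<Longrightarrow> c1 / (x * vol (r x)) \<le> pmf \<nu> h"
    using \<nu>_lower_time_scale[OF \<alpha>, of "\<kappa> + 2 * \<sigma>"] \<kappa> \<sigma> by auto
  obtain K where K: "K \<ge> 1" "\<And>t. t \<ge> 0 \<Longrightarrow> vol (1 / \<sigma> * t) \<le> K * vol t" using vol_scale[of "1 / \<sigma>"] by blast
  have "4 / \<sigma> > 0" using \<sigma> by simp
  then obtain c' where c': "c' > 0" "\<And>x. x \<ge> 1 \<Longrightarrow> 4 / \<sigma> * r (c' * x) \<le> r x"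
    using r_contraction by blast
  obtain C where C: "C \<ge> 1" "\<And>x n. x > 0 \<Longrightarrow> measure_pmf.prob (\<mu> n) {g. 2 * r x \<le> len g} \<le> C * real n / x"
    using displacement_tail by blast
  \<comment> \<open>The jump has to occur before time \<open>e n\<close>, a time in which the walk usually stays within the small ball.\<close>
  define e where "e = min (c' / (3 * C)) (1 / 2)"
  have e: "e > 0" "e \<le> 1 / 2" "C * e \<le> c' / 3"
  proof -
    show "e > 0" "e \<le> 1 / 2" using c'(1) C(1) by (auto simp: e_def)
    have "C * e \<le> C * (c' / (3 * C))" using C(1) by (intro mult_left_mono) (auto simp: e_def)
    then show "C * e \<le> c' / 3" using C(1) by simp
  qed
  define c2 where "c2 = min c (c1 * e * c / (8 * K))"
  have c2: "c2 > 0" "c2 \<le> c" "c2 \<le> c1 * e * c / (8 * K)" using c(1) c1(1) e(1) K(1) by (auto simp: c2_def)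
  show ?thesis
  proof (rule lower_bound_atI[OF \<kappa> c2(1)])
    fix n g assume n: "nat \<lceil>2 / e\<rceil> \<le> n" "1 \<le> n" and g: "g \<in> carrier G" "len g \<le> \<kappa> * r (real n)"
    have en: "2 \<le> e * real n" using n(1) e(1) by (simp add: nat_le_iff ceiling_le_iff field_simps)
    define v where "v = vol (r (real n))"
    have v: "v > 0" using n by (auto simp: v_def intro!: vol_r_pos)
    define s where "s = \<sigma> * r (real n)"
    have s: "s > 0" using \<sigma> n r_pos[of "real n"] by (simp add: s_def)
    have two_s: "2 * s = \<eta> / A * r (real n)" using A(1) by (simp add: s_def \<sigma>_def)
    show "c2 / vol (r (real n)) \<le> pmf (\<mu> n) g"
    proof (cases "len g \<le> 2 * s")
      case True
      have "\<eta> / A \<le> \<eta> / 1" using \<eta>(1) A(1) by (intro divide_left_mono) auto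
      then have "\<eta> / A * r (real n) \<le> \<eta> * r (real n)" using r_pos[of "real n"] n by (intro mult_right_mono) auto
      then have "len g \<le> \<eta> * r (real n)" using True two_s by simp
      then have "c / v \<le> pmf (\<mu> n) g" using n g c(2) by (simp add: v_def)
      moreover have "c2 / v \<le> c / v" using c2 v by (intro divide_right_mono) auto
      ultimately show ?thesis by (simp add: v_def)
    next
      case False
      define m where "m = nat \<lfloor>e * real n\<rfloor>"
      have m: "real m \<le> e * real n" "e * real n / 2 \<le> real m" "real n / 2 \<le> real (n - m)" "m \<le> n" "1 \<le> n - m"
      proof -
        have 1: "real m \<le> e * real n" "e * real n - 1 \<le> real m" using en by (auto simp: m_def)
        then show "real m \<le> e * real n" "e * real n / 2 \<le> real m" using en by linarith+
        have "e * real n \<le> 1 / 2 * real n" using e(2) by (intro mult_right_mono) auto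
        then have 2: "real m \<le> real n / 2" using 1 by linarith
        then show "m \<le> n" by linarith
        then show "real n / 2 \<le> real (n - m)" using 2 by (simp add: of_nat_diff)
        then have "0 < real (n - m)" using n(2) by linarith
        then show "1 \<le> n - m" by simp
      qed
      have small: "measure_pmf.prob (\<mu> j) {h. s / 2 \<le> len h} \<le> 1 / 3" if "j \<le> m" for j
      proof -
        have "4 / \<sigma> * r (c' * real n) \<le> r (real n)" using n(2) by (intro c'(2)) auto
        then have "2 * r (c' * real n) \<le> s / 2" using \<sigma> by (simp add: s_def field_simps)
        then have "measure_pmf.prob (\<mu> j) {h. s / 2 \<le> len h} \<le> measure_pmf.prob (\<mu> j) {h. 2 * r (c' * real n) \<le> len h}"
          by (intro measure_pmf.finite_measure_mono) auto
        also have "\<dots> \<le> C * real j / (c' * real n)" using c'(1) n(2) by (intro C(2)) auto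
        also have "\<dots> \<le> C * (e * real n) / (c' * real n)"
          using that m(1) C(1) c'(1) by (intro divide_right_mono mult_left_mono) auto
        also have "\<dots> = C * e / c'" using n(2) by simp
        also have "\<dots> \<le> 1 / 3" using e(3) c'(1) by (simp add: field_simps)
        finally show ?thesis .
      qed
      have stay: "measure_pmf.prob (\<mu> j) {h. s < len h} \<le> 1 / 2" if "j \<le> m" for j
      proof -
        have "measure_pmf.prob (\<mu> j) {h. s < len h} \<le> measure_pmf.prob (\<mu> j) {h. s / 2 \<le> len h}"
          using s by (intro measure_pmf.finite_measure_mono) auto
        then show ?thesis using small[OF that] by linarith
      qed
      have exit: "exit_prob s j \<one> \<le> 1 / 2" if "j \<le> m" for j
      proof -
        have "(1 - 1 / 3) * exit_prob s j \<one> \<le> measure_pmf.prob (\<mu> j) {h. s / 2 \<le> len (\<one> \<otimes> h)}"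
          using small that by (intro ottaviani[where n = m]) auto
        also have "\<dots> = measure_pmf.prob (\<mu> j) {h. s / 2 \<le> len h}"
          using on_groupD[OF on_\<mu>] by (intro measure_pmf.finite_measure_eq_AE AE_pmfI) auto
        also have "\<dots> \<le> 1 / 3" using that by (rule small)
        finally show ?thesis by simp
      qed
      define p where "p = c1 / (K * real n)"
      have p: "p > 0" using c1(1) K(1) n(2) by (simp add: p_def)
      have jump: "p \<le> measure_pmf.prob \<nu> {h. len (inv g \<otimes> (x \<otimes> h)) \<le> s}" if x: "x \<in> carrier G" "len x \<le> s" for x
      proof -
        define F where "F = (\<lambda>z. inv x \<otimes> (g \<otimes> z)) ` ball_len s"
        have inj: "inj_on (\<lambda>z. inv x \<otimes> (g \<otimes> z)) (ball_len s)" using x g by (auto simp: inj_on_def ball_len_def)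
        have F: "finite F" "real (card F) = vol s" by (simp_all add: F_def vol_eq card_image[OF inj])
        have "v \<le> K * vol s" using K(2)[of s] s \<sigma> by (simp add: v_def s_def)
        then have "p \<le> vol s * (c1 / (real n * v))" using v K(1) c1(1) n(2) by (simp add: p_def field_simps)
        also have "\<dots> = (\<Sum>h\<in>F. c1 / (real n * v))" using F by simp
        also have "\<dots> \<le> (\<Sum>h\<in>F. pmf \<nu> h)"
        proof (rule sum_mono)
          fix h assume "h \<in> F"
          then obtain z where z: "z \<in> carrier G" "len z \<le> s" "h = inv x \<otimes> (g \<otimes> z)" by (auto simp: F_def ball_len_def)
          have "len h \<le> len (inv x) + len (g \<otimes> z)" unfolding z(3) using x z g by (intro len_mult) auto
          also have "\<dots> \<le> len x + (len g + len z)" using x z g len_mult[of g z] by simp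
          also have "\<dots> \<le> (\<kappa> + 2 * \<sigma>) * r (real n)" using x z g by (simp add: s_def algebra_simps)
          finally show "c1 / (real n * v) \<le> pmf \<nu> h" unfolding v_def using z x g n by (intro c1(2)) auto
        qed
        also have "\<dots> = measure_pmf.prob \<nu> F" using F by (simp add: measure_measure_pmf_finite)
        also have "\<dots> \<le> measure_pmf.prob \<nu> {h. len (inv g \<otimes> (x \<otimes> h)) \<le> s}"
        proof (rule measure_pmf.finite_measure_mono)
          show "F \<subseteq> {h. len (inv g \<otimes> (x \<otimes> h)) \<le> s}"
          proof
            fix h assume "h \<in> F"
            then obtain z where z: "z \<in> carrier G" "len z \<le> s" "h = inv x \<otimes> (g \<otimes> z)" by (auto simp: F_def ball_len_def)
            have "inv g \<otimes> (x \<otimes> h) = z" using z x g by (simp add: m_assoc[symmetric])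
            then show "h \<in> {h. len (inv g \<otimes> (x \<otimes> h)) \<le> s}" using z by simp
          qed
        qed simp
        finally show ?thesis .
      qed
      have far: "2 * s < len g" using False by simp
      have "p / 2 * (\<Sum>i<m. 1 - exit_prob s i \<one>) \<le> measure_pmf.prob (\<mu> m) {h. len (inv g \<otimes> (\<one> \<otimes> h)) \<le> 2 * s}"
        using p by (intro one_jump_lower_bound[OF g(1) far stay jump, where m = m]) auto
      moreover have "real m * (1 / 2) \<le> (\<Sum>i<m. 1 - exit_prob s i \<one>)"
      proof -
        have "(\<Sum>i<m. 1 / 2) \<le> (\<Sum>i<m. 1 - exit_prob s i \<one>)"
        proof (rule sum_mono)
          fix i assume "i \<in> {..<m}"
          then show "1 / 2 \<le> 1 - exit_prob s i \<one>" using exit[of i] by simp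
        qed
        then show ?thesis by simp
      qed
      ultimately have "p / 2 * (real m * (1 / 2)) \<le> measure_pmf.prob (\<mu> m) {h. len (inv g \<otimes> (\<one> \<otimes> h)) \<le> 2 * s}"
        using p mult_left_mono[of "real m * (1 / 2)" "\<Sum>i<m. 1 - exit_prob s i \<one>" "p / 2"] by linarith
      moreover have "p / 2 * (e * real n / 2 * (1 / 2)) \<le> p / 2 * (real m * (1 / 2))"
        using m(2) p by (intro mult_left_mono mult_right_mono) auto
      moreover have "p / 2 * (e * real n / 2 * (1 / 2)) = c1 * e / (8 * K)" using n(2) by (simp add: p_def)
      ultimately have reach: "c1 * e / (8 * K) \<le> measure_pmf.prob (\<mu> m) {h. len (inv g \<otimes> (\<one> \<otimes> h)) \<le> 2 * s}"
        by linarith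
      define F where "F = (\<otimes>) g ` ball_len (2 * s)"
      have F: "finite F" "F \<subseteq> carrier G" using g by (auto simp: F_def dest: ball_carrier)
      have lenF: "len (inv y \<otimes> g) \<le> 2 * s" if "y \<in> F" for y
      proof -
        obtain z where z: "z \<in> carrier G" "len z \<le> 2 * s" "y = g \<otimes> z" using \<open>y \<in> F\<close> by (auto simp: F_def ball_len_def)
        have "inv y \<otimes> g = inv z" using z g by (simp add: inv_mult_group m_assoc)
        then show ?thesis using z by simp
      qed
      have "measure_pmf.prob (\<mu> m) {h. len (inv g \<otimes> (\<one> \<otimes> h)) \<le> 2 * s} \<le> measure_pmf.prob (\<mu> m) F"
      proof (rule measure_pmf.finite_measure_mono_AE)
        show "AE h in measure_pmf (\<mu> m). h \<in> {h. len (inv g \<otimes> (\<one> \<otimes> h)) \<le> 2 * s} \<longrightarrow> h \<in> F"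
        proof (intro AE_pmfI impI)
          fix h assume "h \<in> set_pmf (\<mu> m)" and l: "h \<in> {h. len (inv g \<otimes> (\<one> \<otimes> h)) \<le> 2 * s}"
          then have h: "h \<in> carrier G" by (metis on_groupD[OF on_\<mu>])
          have "h = g \<otimes> (inv g \<otimes> h)" using g h by (simp add: m_assoc[symmetric])
          moreover have "inv g \<otimes> h \<in> ball_len (2 * s)" using l g h by (simp add: ball_len_def)
          ultimately show "h \<in> F" unfolding F_def by blast
        qed
      qed simp
      then have mass: "c1 * e / (8 * K) \<le> (\<Sum>y\<in>F. pmf (\<mu> m) y)"
        using reach F by (simp add: measure_measure_pmf_finite)
      have end_lower: "c / v \<le> pmf (\<mu> (n - m)) (inv y \<otimes> g)" if "y \<in> F" for y
      proof -
        have "r (real n) \<le> A * r (1 / 2 * real n)" using n(2) by (intro A(2)) auto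
        also have "\<dots> \<le> A * r (real (n - m))" using A(1) m(3) n(2) by (intro mult_left_mono r_mono) auto
        finally have "\<eta> / A * r (real n) \<le> \<eta> / A * (A * r (real (n - m)))"
          using \<eta>(1) A(1) by (intro mult_left_mono) auto
        then have "2 * s \<le> \<eta> * r (real (n - m))" using A(1) by (simp add: two_s)
        then have 1: "c / vol (r (real (n - m))) \<le> pmf (\<mu> (n - m)) (inv y \<otimes> g)"
          using lenF[OF \<open>y \<in> F\<close>] m(5) \<open>y \<in> F\<close> F(2) g by (intro c(2)) auto
        have "vol (r (real (n - m))) \<le> v" "0 < vol (r (real (n - m)))"
          unfolding v_def using m(5) by (auto intro!: vol_r_mono vol_r_pos)
        then have "c / v \<le> c / vol (r (real (n - m)))" using c(1) v by (intro divide_left_mono) auto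
        then show ?thesis using 1 by simp
      qed
      have "c2 / v \<le> c1 * e * c / (8 * K) / v" using c2(3) v by (intro divide_right_mono) auto
      also have "\<dots> = c1 * e / (8 * K) * (c / v)" by simp
      also have "\<dots> \<le> (\<Sum>y\<in>F. pmf (\<mu> m) y) * (c / v)" using mass c(1) v by (intro mult_right_mono) auto
      also have "\<dots> = (\<Sum>y\<in>F. pmf (\<mu> m) y * (c / v))" by (rule sum_distrib_right)
      also have "\<dots> \<le> (\<Sum>y\<in>F. pmf (\<mu> m) y * pmf (\<mu> (n - m)) (inv y \<otimes> g))"
        using end_lower by (intro sum_mono mult_left_mono) auto
      also have "\<dots> \<le> pmf (conv (\<mu> m) (\<mu> (n - m))) g" by (intro pmf_conv_ge_sum on_\<mu> g F)
      also have "conv (\<mu> m) (\<mu> (n - m)) = \<mu> n" using \<mu>_add[of m "n - m"] m(4) by simp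
      finally show ?thesis by (simp add: v_def)
    qed
  qed
qed

lemma lower_bound: "0 < \<kappa> \<Longrightarrow> lower_bound_at \<kappa>"
  using lower_bound_chain[of \<kappa>] lower_bound_jump[of \<kappa>] by linarith

lemma heat_kernel_bounds:
  "\<exists>C>0. \<forall>\<kappa>>0. \<exists>c>0. \<forall>n\<ge>1. \<forall>g\<in>carrier G. len g \<le> \<kappa> * r (real n) \<longrightarrow>
     c * inverse (vol (r (real n))) \<le> pmf (\<mu> (2 * n)) g \<and>
     pmf (\<mu> (2 * n)) g \<le> C * inverse (vol (r (real n)))"
proof -
  obtain B where B: "B > 0" "\<And>n. n \<ge> 1 \<Longrightarrow> ret n \<le> B / vol (r (real n))" using ret_upper by blast
  have "\<exists>c>0. \<forall>n\<ge>1. \<forall>g\<in>carrier G. len g \<le> \<kappa> * r (real n) \<longrightarrow>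
     c * inverse (vol (r (real n))) \<le> pmf (\<mu> (2 * n)) g \<and>
     pmf (\<mu> (2 * n)) g \<le> B * inverse (vol (r (real n)))" if \<kappa>: "\<kappa> > 0" for \<kappa>
  proof -
    obtain c where c: "c > 0" "\<And>n g. n \<ge> 1 \<Longrightarrow> g \<in> carrier G \<Longrightarrow> len g \<le> \<kappa> * r (real n) \<Longrightarrow> c / vol (r (real n)) \<le> pmf (\<mu> n) g"
      using lower_bound[OF \<kappa>] unfolding lower_bound_at_def by blast
    obtain K where K: "K \<ge> 1" "\<And>x. x \<ge> 1 \<Longrightarrow> vol (r x) \<le> K * vol (r (1 / 2 * x))"
      using vol_r_ratio[of "1 / 2"] by auto
    have "c / K * inverse (vol (r (real n))) \<le> pmf (\<mu> (2 * n)) g \<and>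
     pmf (\<mu> (2 * n)) g \<le> B * inverse (vol (r (real n)))"
      if n: "n \<ge> 1" and g: "g \<in> carrier G" "len g \<le> \<kappa> * r (real n)" for n g
    proof
      have v: "0 < vol (r (real n))" "0 < vol (r (real (2 * n)))" using n by (auto intro!: vol_r_pos)
      have "vol (r (real (2 * n))) \<le> K * vol (r (real n))" using K(2)[of "real (2 * n)"] n by simp
      then have "c / K * inverse (vol (r (real n))) \<le> c / vol (r (real (2 * n)))"
        using v K(1) c(1) by (simp add: field_simps)
      also have "\<kappa> * r (real n) \<le> \<kappa> * r (real (2 * n))" using \<kappa> n by (intro mult_left_mono r_mono) auto
      then have "c / vol (r (real (2 * n))) \<le> pmf (\<mu> (2 * n)) g" using n g by (intro c(2)) auto
      finally show "c / K * inverse (vol (r (real n))) \<le> pmf (\<mu> (2 * n)) g" .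
      show "pmf (\<mu> (2 * n)) g \<le> B * inverse (vol (r (real n)))"
        using \<mu>_even_le_ret[OF g(1), of n] B(2)[OF n] by (simp add: divide_inverse)
    qed
    moreover have "c / K > 0" using c(1) K(1) by simp
    ultimately show ?thesis by blast
  qed
  then show ?thesis using B(1) by blast
qed

end

section \<open>The walk on the space of increments\<close>

lemma (in sequence_space) emeasure_first_step:
  assumes E: "E \<in> sets S"
  shows "emeasure S E = (\<integral>\<^sup>+y. emeasure S {\<omega> \<in> space S. case_nat y \<omega> \<in> E} \<partial>M)"
proof -
  let ?f = "\<lambda>(s, \<omega>). case_nat s \<omega> :: nat \<Rightarrow> 'a"
  have f: "?f \<in> M \<Otimes>\<^sub>M S \<rightarrow>\<^sub>M S" by measurable
  have "emeasure S E = emeasure (distr (M \<Otimes>\<^sub>M S) S ?f) E" by (simp only: PiM_iter)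
  also have "\<dots> = emeasure (M \<Otimes>\<^sub>M S) (?f -` E \<inter> space (M \<Otimes>\<^sub>M S))" by (rule emeasure_distr[OF f E])
  also have "\<dots> = (\<integral>\<^sup>+y. emeasure S (Pair y -` (?f -` E \<inter> space (M \<Otimes>\<^sub>M S))) \<partial>M)"
    by (rule P.emeasure_pair_measure_alt) (rule measurable_sets[OF f E])
  also have "\<dots> = (\<integral>\<^sup>+y. emeasure S {\<omega> \<in> space S. case_nat y \<omega> \<in> E} \<partial>M)"
    by (intro nn_integral_cong arg_cong[where f = "emeasure S"]) (auto simp: space_pair_measure)
  finally show ?thesis .
qed

lemma walk_case_nat: "walk G x (case_nat y \<omega>) (Suc k) = walk G (x \<otimes>\<^bsub>G\<^esub> y) \<omega> k"
  by (induction k) simp_all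

context jump_law
begin

abbreviation incr_law :: "'a measure" where
  "incr_law \<equiv> restrict_space (measure_pmf \<nu>) (carrier G)"

lemma space_incr_law [simp]: "space incr_law = carrier G"
  by (simp add: space_restrict_space)

lemma sets_incr_law: "sets incr_law = sets (count_space (carrier G))"
  by (auto simp: sets_restrict_space image_def)

lemma prob_space_incr_law: "prob_space incr_law"
proof (rule prob_space_restrict_space)
  have "emeasure (measure_pmf \<nu>) (carrier G) = 1"
    using on_groupD[OF on_\<nu>] by (intro measure_pmf.emeasure_eq_1_AE AE_pmfI) auto
  then show "emeasure (measure_pmf \<nu>) (carrier G) = 1" .
qed simp

lemma sequence_space_incr_law: "sequence_space incr_law"
proof -
  interpret prob_space incr_law by (rule prob_space_incr_law)
  show ?thesis by unfold_locales
qed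

abbreviation path_space :: "(nat \<Rightarrow> 'a) measure" where "path_space \<equiv> increments G \<nu>"

lemma path_space_eq: "path_space = (\<Pi>\<^sub>M i\<in>UNIV. incr_law)"
  by (simp add: increments_def)

lemma prob_space_path_space: "prob_space path_space"
  unfolding path_space_eq by (intro prob_space_PiM prob_space_incr_law)

lemma walk_measurable:
  assumes "x \<in> carrier G"
  shows "(\<lambda>\<omega>. walk G x \<omega> k) \<in> path_space \<rightarrow>\<^sub>M count_space (carrier G)"
proof (induction k)
  case 0 then show ?case using assms by simp
next
  case (Suc k)
  have c: "(\<lambda>\<omega>. \<omega> k) \<in> path_space \<rightarrow>\<^sub>M count_space (carrier G)"
    unfolding path_space_eq measurable_cong_sets[OF refl sets_incr_law[symmetric]]
    by (rule measurable_component_singleton) simp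
  have "(\<lambda>\<omega>. y \<otimes> \<omega> k) \<in> path_space \<rightarrow>\<^sub>M count_space (carrier G)" if "y \<in> carrier G" for y
    by (rule measurable_compose[OF c]) (use that in auto)
  from measurable_compose_countable'[OF this Suc countable_carrier] show ?case by simp
qed

definition confined :: "real \<Rightarrow> real \<Rightarrow> nat \<Rightarrow> 'a \<Rightarrow> (nat \<Rightarrow> 'a) set" where
  "confined b \<tau> n x = {\<omega> \<in> space path_space. (\<forall>k\<le>n. len (walk G x \<omega> k) \<le> b) \<and> len (walk G x \<omega> n) \<le> \<tau>}"

lemma confined_measurable:
  assumes x: "x \<in> carrier G" shows "confined b \<tau> n x \<in> sets path_space"
proof -
  have *: "{\<omega> \<in> space path_space. len (walk G x \<omega> k) \<le> t} \<in> sets path_space" for k t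
  proof -
    have "(\<lambda>\<omega>. walk G x \<omega> k) -` {g \<in> carrier G. len g \<le> t} \<inter> space path_space \<in> sets path_space"
      by (rule measurable_sets[OF walk_measurable[OF x]]) simp
    also have "(\<lambda>\<omega>. walk G x \<omega> k) -` {g \<in> carrier G. len g \<le> t} \<inter> space path_space
        = {\<omega> \<in> space path_space. len (walk G x \<omega> k) \<le> t}"
      using measurable_space[OF walk_measurable[OF x]] by auto
    finally show ?thesis .
  qed
  have "confined b \<tau> n x = (\<Inter>k\<in>{..n}. {\<omega> \<in> space path_space. len (walk G x \<omega> k) \<le> b})
      \<inter> {\<omega> \<in> space path_space. len (walk G x \<omega> n) \<le> \<tau>}"
    by (auto simp: confined_def)
  also have "\<dots> \<in> sets path_space" by (intro sets.Int sets.finite_INT *) auto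
  finally show ?thesis .
qed

lemma prob_confined_Suc:
  assumes x: "x \<in> carrier G" "len x \<le> b"
  shows "measure path_space (confined b \<tau> (Suc n) x)
    = measure_pmf.expectation \<nu> (\<lambda>y. measure path_space (confined b \<tau> n (x \<otimes> y)))"
proof -
  interpret PS: prob_space path_space by (rule prob_space_path_space)
  have slice: "{\<omega> \<in> space path_space. case_nat y \<omega> \<in> confined b \<tau> (Suc n) x} = confined b \<tau> n (x \<otimes> y)"
    if y: "y \<in> carrier G" for y
  proof -
    have sp: "case_nat y \<omega> \<in> space path_space \<longleftrightarrow> \<omega> \<in> space path_space" for \<omega>
      using y by (auto simp: path_space_eq space_PiM PiE_iff split: nat.splits)
    have all: "(\<forall>k\<le>Suc n. len (walk G x (case_nat y \<omega>) k) \<le> b) \<longleftrightarrow> (\<forall>k\<le>n. len (walk G (x \<otimes> y) \<omega> k) \<le> b)" for \<omega>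
    proof
      assume *: "\<forall>k\<le>Suc n. len (walk G x (case_nat y \<omega>) k) \<le> b"
      show "\<forall>k\<le>n. len (walk G (x \<otimes> y) \<omega> k) \<le> b"
      proof (intro allI impI)
        fix k assume "k \<le> n"
        then show "len (walk G (x \<otimes> y) \<omega> k) \<le> b" using *[rule_format, of "Suc k"] unfolding walk_case_nat by simp
      qed
    next
      assume *: "\<forall>k\<le>n. len (walk G (x \<otimes> y) \<omega> k) \<le> b"
      show "\<forall>k\<le>Suc n. len (walk G x (case_nat y \<omega>) k) \<le> b"
      proof (intro allI impI)
        fix k assume k: "k \<le> Suc n"
        show "len (walk G x (case_nat y \<omega>) k) \<le> b"
        proof (cases k)
          case 0 then show ?thesis using x by simp
        next
          case (Suc j)
          then show ?thesis using * k unfolding Suc walk_case_nat by simp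
        qed
      qed
    qed
    show ?thesis
      unfolding confined_def mem_Collect_eq all walk_case_nat sp by blast
  qed
  have "ennreal (measure path_space (confined b \<tau> (Suc n) x)) = emeasure path_space (confined b \<tau> (Suc n) x)"
    by (simp add: PS.emeasure_eq_measure)
  also have "\<dots> = (\<integral>\<^sup>+y. emeasure path_space {\<omega> \<in> space path_space. case_nat y \<omega> \<in> confined b \<tau> (Suc n) x} \<partial>incr_law)"
    using sequence_space.emeasure_first_step[OF sequence_space_incr_law] confined_measurable[OF x(1)]
    unfolding path_space_eq by blast
  also have "\<dots> = (\<integral>\<^sup>+y. ennreal (measure path_space (confined b \<tau> n (x \<otimes> y))) \<partial>incr_law)"
    by (intro nn_integral_cong) (simp add: slice PS.emeasure_eq_measure)
  also have "\<dots> = (\<integral>\<^sup>+y. ennreal (measure path_space (confined b \<tau> n (x \<otimes> y))) * indicator (carrier G) y \<partial>measure_pmf \<nu>)"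
    by (rule nn_integral_restrict_space) simp
  also have "\<dots> = (\<integral>\<^sup>+y. ennreal (measure path_space (confined b \<tau> n (x \<otimes> y))) \<partial>measure_pmf \<nu>)"
    using on_groupD[OF on_\<nu>] by (intro nn_integral_cong_AE AE_pmfI) simp
  also have "\<dots> = ennreal (measure_pmf.expectation \<nu> (\<lambda>y. measure path_space (confined b \<tau> n (x \<otimes> y))))"
    by (intro nn_integral_eq_integral integrable_bounded_pmf[where B = 1]) auto
  finally show ?thesis by (simp add: Bochner_Integration.integral_nonneg)
qed

text \<open>Transfers estimates from the recursively defined exit probabilities to the path space.\<close>

lemma prob_confined_ge:
  "x \<in> carrier G \<Longrightarrow> measure_pmf.prob (\<mu> n) {h. len (x \<otimes> h) \<le> \<tau>} - exit_prob b n x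
     \<le> measure path_space (confined b \<tau> n x)"
proof (induction n arbitrary: x)
  case (0 x)
  interpret PS: prob_space path_space by (rule prob_space_path_space)
  show ?case
  proof (cases "len x \<le> b \<and> len x \<le> \<tau>")
    case True
    then have "confined b \<tau> 0 x = space path_space" by (auto simp: confined_def)
    then have "measure path_space (confined b \<tau> 0 x) = 1" using PS.prob_space by simp
    then show ?thesis
      using exit_prob_bounds[of b 0 x] measure_pmf.prob_le_1[of "\<mu> 0" "{h. len (x \<otimes> h) \<le> \<tau>}"] by linarith
  next
    case False
    then show ?thesis using 0 by (auto simp: measure_return_pmf indicator_def intro: order_trans[OF _ measure_nonneg])
  qed
next
  case (Suc n x)
  show ?case
  proof (cases "b < len x")
    case True
    then have "exit_prob b (Suc n) x = 1" by simp
    then have "measure_pmf.prob (\<mu> (Suc n)) {h. len (x \<otimes> h) \<le> \<tau>} - exit_prob b (Suc n) x \<le> 0"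
      by (simp add: measure_pmf.prob_le_1)
    then show ?thesis by (rule order_trans) simp
  next
    case False
    have i1: "integrable (measure_pmf \<nu>) (\<lambda>y. measure_pmf.prob (\<mu> n) {h. len ((x \<otimes> y) \<otimes> h) \<le> \<tau>})"
      by (rule integrable_bounded_pmf[where B = 1]) auto
    have i2: "integrable (measure_pmf \<nu>) (\<lambda>y. exit_prob b n (x \<otimes> y))"
      by (rule integrable_bounded_pmf[where B = 1]) (simp_all add: exit_prob_bounds)
    interpret PS: prob_space path_space by (rule prob_space_path_space)
    have i3: "integrable (measure_pmf \<nu>) (\<lambda>y. measure path_space (confined b \<tau> n (x \<otimes> y)))"
      by (rule integrable_bounded_pmf[where B = 1]) auto
    have "measure_pmf.prob (\<mu> (Suc n)) {h. len (x \<otimes> h) \<le> \<tau>} - exit_prob b (Suc n) x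
        = measure_pmf.expectation \<nu> (\<lambda>y. measure_pmf.prob (\<mu> n) {h. len ((x \<otimes> y) \<otimes> h) \<le> \<tau>} - exit_prob b n (x \<otimes> y))"
      using False prob_\<mu>_Suc[OF Suc.prems, of n "\<lambda>w. len w \<le> \<tau>"]
      by (simp add: Bochner_Integration.integral_diff[OF i1 i2])
    also have "\<dots> \<le> measure_pmf.expectation \<nu> (\<lambda>y. measure path_space (confined b \<tau> n (x \<otimes> y)))"
    proof (rule integral_mono_AE)
      show "AE y in measure_pmf \<nu>. measure_pmf.prob (\<mu> n) {h. len ((x \<otimes> y) \<otimes> h) \<le> \<tau>} - exit_prob b n (x \<otimes> y)
          \<le> measure path_space (confined b \<tau> n (x \<otimes> y))"
        using Suc.IH Suc.prems on_groupD[OF on_\<nu>] by (intro AE_pmfI) auto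
    qed (intro Bochner_Integration.integrable_diff i1 i2 i3)+
    also have "\<dots> = measure path_space (confined b \<tau> (Suc n) x)"
      using Suc.prems False by (intro prob_confined_Suc[symmetric]) auto
    finally show ?thesis .
  qed
qed

end

context jump_walk
begin

text \<open>The constant \<open>A\<close> makes the exit probability at most half the probability of ending in the ball
  of radius \<open>\<tau>\<close>: radii comparable to \<open>r (A n)\<close> are exceeded with probability at most \<open>C / A\<close>,
  while \<open>r (A n)\<close> is still comparable to \<open>\<tau>\<close>.\<close>

lemma confinement:
  "\<exists>\<epsilon>>0. \<exists>\<gamma>\<ge>1. \<forall>n. \<forall>\<tau>>0. 1 / 2 * \<rho> \<tau> \<le> real n \<and> real n \<le> \<rho> \<tau> \<longrightarrow>
     (\<forall>x\<in>carrier G. len x \<le> \<tau> \<longrightarrow> \<epsilon> \<le> measure path_space (confined (\<gamma> * \<tau>) \<tau> n x))"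
proof -
  obtain K where K: "K \<ge> 1" "\<And>x. x \<ge> 1 \<Longrightarrow> r x \<le> K * r (1 / 2 * x)"
    using r_ratio_bounded[of "1 / 2"] by auto
  have "lower_bound_at (2 * K)" using K(1) by (intro lower_bound) auto
  then obtain c where c: "c > 0" "\<And>n g. n \<ge> 1 \<Longrightarrow> g \<in> carrier G \<Longrightarrow> len g \<le> 2 * K * r (real n) \<Longrightarrow> c / vol (r (real n)) \<le> pmf (\<mu> n) g"
    unfolding lower_bound_at_def by blast
  obtain C where C: "C \<ge> 1" "\<And>x n. x > 0 \<Longrightarrow> measure_pmf.prob (\<mu> n) {g. 2 * r x \<le> len g} \<le> C * real n / x"
    using displacement_tail by blast
  define A where "A = C * (2 + 4 / c)"
  have A: "A \<ge> 1" "C / A \<le> 1 / 2" "C / A \<le> c / 4" "0 \<le> C / A"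
  proof -
    have "1 * 1 \<le> C * (2 + 4 / c)" using C(1) c(1) by (intro mult_mono) (auto simp: add_increasing2)
    then show "A \<ge> 1" by (simp add: A_def)
    have eq: "C / A = 1 / (2 + 4 / c)" using C(1) by (simp add: A_def)
    show "C / A \<le> 1 / 2" "C / A \<le> c / 4" "0 \<le> C / A" unfolding eq using c(1) by (simp_all add: field_simps)
  qed
  have "1 / A > 0" using A(1) by simp
  then obtain D where D: "D \<ge> 1" "\<And>x. x \<ge> 1 \<Longrightarrow> r x \<le> D * r (1 / A * x)" using r_ratio_bounded by blast
  define \<gamma> where "\<gamma> = 4 * D + 2"
  have "c / 2 \<le> measure path_space (confined (\<gamma> * \<tau>) \<tau> n x)"
    if \<tau>: "\<tau> > 0" and n: "1 / 2 * \<rho> \<tau> \<le> real n" "real n \<le> \<rho> \<tau>" and x: "x \<in> carrier G" "len x \<le> \<tau>" for n \<tau> x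
  proof -
    have "0 < real n" using n(1) \<rho>_pos[OF \<tau>] by linarith
    then have n1: "n \<ge> 1" by simp
    have r_le: "r (real n) \<le> \<tau>" using r_mono[of "real n" "\<rho> \<tau>"] n n1 r_\<rho>[OF \<tau>] by simp
    have "\<tau> = r (\<rho> \<tau>)" using r_\<rho>[OF \<tau>] by simp
    also have "\<dots> \<le> r (2 * real n)" using n \<rho>_pos[OF \<tau>] by (intro r_mono) auto
    also have "\<dots> \<le> K * r (real n)" using K(2)[of "2 * real n"] n1 by simp
    finally have \<tau>_le: "\<tau> \<le> K * r (real n)" .
    have v: "vol (r (real n)) > 0" using n1 by (intro vol_r_pos) auto
    define F where "F = (\<lambda>y. inv x \<otimes> y) ` ball_len \<tau>"
    have inj: "inj_on (\<lambda>y. inv x \<otimes> y) (ball_len \<tau>)" using x by (auto simp: inj_on_def ball_len_def)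
    have F: "finite F" "real (card F) = vol \<tau>" by (simp_all add: F_def vol_eq card_image[OF inj])
    have "c * vol (r (real n)) \<le> c * vol \<tau>" using vol_mono[OF r_le] c(1) by (intro mult_left_mono) auto
    then have "c \<le> vol \<tau> * (c / vol (r (real n)))" using v by (simp add: field_simps)
    also have "\<dots> = (\<Sum>h\<in>F. c / vol (r (real n)))" using F by simp
    also have "\<dots> \<le> (\<Sum>h\<in>F. pmf (\<mu> n) h)"
    proof (rule sum_mono)
      fix h assume "h \<in> F"
      then obtain y where y: "y \<in> carrier G" "len y \<le> \<tau>" "h = inv x \<otimes> y" by (auto simp: F_def ball_len_def)
      have "len h \<le> len (inv x) + len y" unfolding y(3) using x y by (intro len_mult) auto
      also have "\<dots> \<le> 2 * \<tau>" using x y by simp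
      also have "\<dots> \<le> 2 * K * r (real n)" using \<tau>_le by simp
      finally show "c / vol (r (real n)) \<le> pmf (\<mu> n) h" using n1 x y by (intro c(2)) auto
    qed
    also have "\<dots> = measure_pmf.prob (\<mu> n) F" using F by (simp add: measure_measure_pmf_finite)
    also have "\<dots> \<le> measure_pmf.prob (\<mu> n) {h. len (x \<otimes> h) \<le> \<tau>}"
    proof (rule measure_pmf.finite_measure_mono)
      show "F \<subseteq> {h. len (x \<otimes> h) \<le> \<tau>}"
        using x by (auto simp: F_def ball_len_def m_assoc[symmetric])
    qed simp
    finally have end_prob: "c \<le> measure_pmf.prob (\<mu> n) {h. len (x \<otimes> h) \<le> \<tau>}" .
    have An: "A * real n \<ge> 1" using A(1) n1 mult_mono[of 1 A 1 "real n"] by simp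
    have "r (A * real n) \<le> D * r (1 / A * (A * real n))" using An by (rule D(2))
    also have "\<dots> \<le> D * \<tau>" using A(1) D(1) r_le by simp
    finally have rA: "2 * r (A * real n) \<le> 2 * D * \<tau>" by simp
    have tail: "measure_pmf.prob (\<mu> j) {h. t \<le> len h} \<le> C / A" if "j \<le> n" "2 * D * \<tau> \<le> t" for j t
    proof -
      have "measure_pmf.prob (\<mu> j) {h. t \<le> len h} \<le> measure_pmf.prob (\<mu> j) {h. 2 * r (A * real n) \<le> len h}"
        using that rA by (intro measure_pmf.finite_measure_mono) auto
      also have "\<dots> \<le> C * real j / (A * real n)" using An by (intro C(2)) auto
      also have "\<dots> \<le> C * real n / (A * real n)" using that C(1) A(1) by (intro divide_right_mono mult_left_mono) auto
      also have "\<dots> = C / A" using n1 by simp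
      finally show ?thesis .
    qed
    define b where "b = \<gamma> * \<tau>"
    define a where "a = (2 * D + 1) * \<tau>"
    have ab: "b - a = (2 * D + 1) * \<tau>" "a - \<tau> = 2 * D * \<tau>" by (simp_all add: a_def b_def \<gamma>_def algebra_simps)
    have "(1 - C / A) * exit_prob b n x \<le> measure_pmf.prob (\<mu> n) {h. a \<le> len (x \<otimes> h)}"
    proof (rule ottaviani[where n = n])
      show "measure_pmf.prob (\<mu> j) {h. b - a \<le> len h} \<le> C / A" if "j \<le> n" for j
        using that \<tau> unfolding ab by (intro tail) (auto simp: algebra_simps)
    qed (use x in auto)
    also have "\<dots> \<le> measure_pmf.prob (\<mu> n) {h. a - \<tau> \<le> len h}"
    proof (rule measure_pmf.finite_measure_mono_AE)
      show "AE h in measure_pmf (\<mu> n). h \<in> {h. a \<le> len (x \<otimes> h)} \<longrightarrow> h \<in> {h. a - \<tau> \<le> len h}"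
      proof (rule AE_pmfI)
        fix h assume "h \<in> set_pmf (\<mu> n)"
        then have "h \<in> carrier G" by (rule on_groupD[OF on_\<mu>])
        then show "h \<in> {h. a \<le> len (x \<otimes> h)} \<longrightarrow> h \<in> {h. a - \<tau> \<le> len h}" using len_mult[OF x(1), of h] x(2) by auto
      qed
    qed simp
    also have "\<dots> \<le> C / A" unfolding ab by (intro tail) auto
    finally have "(1 - C / A) * exit_prob b n x \<le> C / A" .
    moreover have "1 / 2 * exit_prob b n x \<le> (1 - C / A) * exit_prob b n x"
      using A(2) exit_prob_bounds by (intro mult_right_mono) auto
    ultimately have "exit_prob b n x \<le> c / 2" using A(3) by linarith
    then show ?thesis using prob_confined_ge[OF x(1), of n \<tau> b] end_prob by (simp add: b_def)
  qed
  moreover have "c / 2 > 0" "\<gamma> \<ge> 1" using c(1) D(1) by (simp_all add: \<gamma>_def)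
  ultimately show ?thesis by blast
qed

lemma strongly_controlled_walk: "strongly_controlled G len r \<nu>"
proof -
  obtain \<epsilon> \<gamma> where \<epsilon>: "\<epsilon> > 0" and \<gamma>: "\<gamma> \<ge> 1"
    and conf: "\<And>n \<tau> x. \<tau> > 0 \<Longrightarrow> 1 / 2 * \<rho> \<tau> \<le> real n \<Longrightarrow> real n \<le> \<rho> \<tau> \<Longrightarrow> x \<in> carrier G \<Longrightarrow> len x \<le> \<tau> \<Longrightarrow>
      \<epsilon> \<le> measure path_space (confined (\<gamma> * \<tau>) \<tau> n x)"
    using confinement by blast
  have event: "measure path_space (confined b \<tau> n x)
      = walk_prob G \<nu> x (\<lambda>X. (SUP k\<in>{0..n}. len (X k)) \<le> b \<and> len (X n) \<le> \<tau>)" for b \<tau> n x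
  proof -
    have "(SUP k\<in>{0..n}. len (walk G x \<omega> k)) \<le> b \<longleftrightarrow> (\<forall>k\<le>n. len (walk G x \<omega> k) \<le> b)" for \<omega>
      by (subst cSUP_le_iff) (auto intro: bdd_above_finite)
    then show ?thesis by (simp add: walk_prob_def confined_def)
  qed
  have "\<epsilon> \<le> (INF x\<in>{x \<in> carrier G. len x \<le> \<tau>}.
      walk_prob G \<nu> x (\<lambda>X. (SUP k\<in>{0..n}. len (X k)) \<le> \<gamma> * \<tau> \<and> len (X n) \<le> \<tau>))"
    if "\<tau> > 0" "1 / 2 * \<rho> (\<tau> / 1) \<le> real n \<and> real n \<le> \<rho> (\<tau> / 1)" for n :: nat and \<tau>
  proof (rule cINF_greatest)
    have "\<one> \<in> {x \<in> carrier G. len x \<le> \<tau>}" using that(1) by simp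
    then show "{x \<in> carrier G. len x \<le> \<tau>} \<noteq> {}" by blast
  qed (use that conf in \<open>auto simp: event[symmetric]\<close>)
  then have "\<exists>\<epsilon>>0. \<exists>\<gamma>\<^sub>1>0. \<exists>\<gamma>\<^sub>2\<ge>1. \<forall>n::nat. \<forall>\<tau>>0.
      1 / 2 * \<rho> (\<tau> / \<gamma>\<^sub>1) \<le> real n \<and> real n \<le> \<rho> (\<tau> / \<gamma>\<^sub>1) \<longrightarrow>
      \<epsilon> \<le> (INF x\<in>{x \<in> carrier G. len x \<le> \<tau>}.
        walk_prob G \<nu> x (\<lambda>X. (SUP k\<in>{0..n}. len (X k)) \<le> \<gamma>\<^sub>2 * \<tau> \<and> len (X n) \<le> \<tau>))"
    using \<epsilon> \<gamma> by (intro exI[of _ \<epsilon>] conjI exI[of _ 1] exI[of _ \<gamma>]) auto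
  moreover have "increasing_bijection r" using r_inverse by (simp add: inverse_near_infinity_def)
  ultimately show ?thesis
    unfolding strongly_controlled_def Let_def \<rho>_def
    using group_norm_len \<nu>_sym heat_kernel_bounds by blast
qed

end

theorem theorem1p5:
  fixes G :: "('a, 'b) monoid_scheme" and S :: "'a set"
    and \<phi> r :: "real \<Rightarrow> real" and \<alpha> :: real and \<nu> :: "'a pmf"
  assumes "group G"
    and "finite S" and "symmetric_generating_set G S"
    and "polynomial_growth G S"
    and "continuous_on {0..} \<phi>" and "\<And>t. 0 \<le> t \<Longrightarrow> 1 \<le> \<phi> t"
    and "0 < \<alpha>" and "regularly_varying \<phi> \<alpha>"
    and "inverse_near_infinity r (scaling \<phi>)"
    and "symmetric_prob G \<nu>"
    and "simeq_on (carrier G) (pmf \<nu>)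
           (\<lambda>g. 1 / (\<phi> (word_length G S g) * volume_fun G (word_length G S) (word_length G S g)))"
  shows "strongly_controlled G (word_length G S) r \<nu>"
proof -
  interpret group G by (rule assms(1))
  interpret jump_walk G S \<phi> \<alpha> \<nu> r
    by unfold_locales (use assms in auto)
  show ?thesis by (rule strongly_controlled_walk)
qed

end
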